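(* There is a positive constant $C$ such that, with $\epsilon(k,m):=C\sqrt{k\log m/m}$, the following holds for every $m\ge2$ and every $k\ge1$. Consider the extended stochastic ball model (ESBM) in $\mathbb{R}^m$ with $k$ balls $B^m_{r_i}(c_i)$, probability measures $\mu_i$ and sample sizes $n_i$, $i\in[k]$, as defined in the context. For every $i\in[k]$, assume that the probability space $(\mu_i,B^m_{r_i}(c_i))$ satisfies (a1), (a2), (a3). For every $i\in[k]$, assume $n_i=n$, $r_i=1$, and denote $E_i:=\mathbb{E}\,d(x,c_i)$, where $x$ is a random vector drawn according to $\mu_i$. Further assume $E_1=\cdots=E_k$. If for every $i\ne j$ we have $d(c_i,c_j)>2+\epsilon(k,m)$, then (LP) achieves exact recovery with high probability.
   Context: Notation: $d$ is the Euclidean distance, $B^m_r(c)$ the closed ball of radius $r>0$ and center $c$ in $\mathbb{R}^m$, $[k]=\{1,\dots,k\}$. ESBM: for every $i\in[k]$, $(\mu_i,B^m_{r_i}(c_i))$ is a probability space (i.e. $\mu_i$ is a Borel probability measure on the ball) and $\beta_i\ge1$ is fixed. For each $i\in[k]$ one draws $n_i:=\beta_i n$ i.i.d. random vectors $x^{(i)}_\ell$, $\ell\in[n_i]$, according to $\mu_i$ (draws from different balls being independent). Here $\beta_i=1$. Assumptions: (a1) $\mu_i$ is invariant under rotations centered in $c_i$; (a2) every open subset of $B^m_{r_i}(c_i)$ containing $c_i$ has positive probability measure; (a3) every subset of $B^m_{r_i}(c_i)$ with zero Lebesgue measure has zero probability measure. With $P$ the set of all sampled points, (LP) is \[ \min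 \sum_{p,q\in P} d(p,q)z_{pq}\ \text{ s.t. }\ \sum_{p\in P}z_{pq}=1\ \forall q\in P;\ z_{pq}\le y_p\ \forall p,q\in P;\ \sum_{p\in P}y_p=k;\ y_p,z_{pq}\ge0\ \forall p,q\in P, \] and (IP) is the same program with $y_p,z_{pq}\in\{0,1\}$. (LP) achieves exact recovery if it has a unique optimal solution, this solution is also feasible (thus optimal) to (IP), and it assigns each point to the ball from which it is drawn (exactly one point drawn from each ball has $y_p=1$, and $z_{pq}=1$ only if $p,q$ are drawn from the same ball). An event $A_n$ depending on the parameter $n$ happens with high probability if for every $\delta\in(0,1)$ there exists $N>0$ such that $\mathbb{P}(A_n)>1-\delta$ whenever $n>N$. *)

theory Defs
  imports "HOL-Probability.Probability" "Jordan_Normal_Form.Determinant"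
begin

text \<open>
  The dimension \<open>m\<close> is quantified inside the statement, so \<open>\<real>\<^sup>m\<close> is not a type here: its points
  are the functions in \<open>{..<m} \<rightarrow>\<^sub>E UNIV\<close>, the common carrier of the library's product measures
  and product topologies over \<open>{..<m}\<close>.
\<close>

definition eucl :: "nat \<Rightarrow> (nat \<Rightarrow> real) set" where
  "eucl m = ({..<m} \<rightarrow>\<^sub>E UNIV)"

definition eucl_dist :: "nat \<Rightarrow> (nat \<Rightarrow> real) \<Rightarrow> (nat \<Rightarrow> real) \<Rightarrow> real" where
  "eucl_dist m x y = L2_set (\<lambda>i. x i - y i) {..<m}"

lemma Metric_space_eucl: "Metric_space (eucl m) (eucl_dist m)"
proof
  fix x y z
  show "0 \<le> eucl_dist m x y"
    by (simp add: eucl_dist_def)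
  show "eucl_dist m x y = eucl_dist m y x"
    by (simp add: eucl_dist_def L2_set_def power2_commute)
  show "x \<in> eucl m \<Longrightarrow> y \<in> eucl m \<Longrightarrow> (eucl_dist m x y = 0) = (x = y)"
    unfolding eucl_dist_def eucl_def
    by (auto simp: L2_set_eq_0_iff intro: PiE_ext)
  have "eucl_dist m x z = L2_set (\<lambda>i. (x i - y i) + (y i - z i)) {..<m}"
    by (simp add: eucl_dist_def)
  also have "\<dots> \<le> eucl_dist m x y + eucl_dist m y z"
    unfolding eucl_dist_def by (rule L2_set_triangle_ineq)
  finally show "eucl_dist m x z \<le> eucl_dist m x y + eucl_dist m y z" .
qed

abbreviation eucl_cball :: "nat \<Rightarrow> (nat \<Rightarrow> real) \<Rightarrow> real \<Rightarrow> (nat \<Rightarrow> real) set" where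
  "eucl_cball m \<equiv> Metric_space.mcball (eucl m) (eucl_dist m)"

abbreviation eucl_topology :: "nat \<Rightarrow> (nat \<Rightarrow> real) topology" where
  "eucl_topology m \<equiv> Metric_space.mtopology (eucl m) (eucl_dist m)"

text \<open>
  As \<open>\<real>\<close> is second countable, the product \<open>\<sigma>\<close>-algebras below are the Borel \<open>\<sigma>\<close>-algebra of
  \<open>\<real>\<^sup>m\<close>, and \<open>eucl_lborel m\<close> is Lebesgue measure on it.
\<close>

definition eucl_borel :: "nat \<Rightarrow> (nat \<Rightarrow> real) measure" where
  "eucl_borel m = PiM {..<m} (\<lambda>_. borel)"

definition eucl_lborel :: "nat \<Rightarrow> (nat \<Rightarrow> real) measure" where
  "eucl_lborel m = PiM {..<m} (\<lambda>_. lborel)"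

text \<open>The map \<open>x \<mapsto> c + A (x - c)\<close>; it is a rotation centered in \<open>c\<close> when \<open>A\<close> lies in \<open>SO(m)\<close>.\<close>

definition affine_about ::
  "nat \<Rightarrow> (nat \<Rightarrow> real) \<Rightarrow> real mat \<Rightarrow> (nat \<Rightarrow> real) \<Rightarrow> nat \<Rightarrow> real" where
  "affine_about m c A x = (\<lambda>i\<in>{..<m}. c i + (\<Sum>j<m. A $$ (i, j) * (x j - c j)))"

definition SO :: "nat \<Rightarrow> real mat set" where
  "SO m = {A \<in> carrier_mat m m. A * transpose_mat A = 1\<^sub>m m \<and> Determinant.det A = 1}"

definition rotation_invariant :: "nat \<Rightarrow> (nat \<Rightarrow> real) \<Rightarrow> (nat \<Rightarrow> real) measure \<Rightarrow> bool" where
  "rotation_invariant m c \<mu> \<longleftrightarrow> (\<forall>A\<in>SO m. distr \<mu> \<mu> (affine_about m c A) = \<mu>)"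

definition positive_near_center ::
  "nat \<Rightarrow> (nat \<Rightarrow> real) \<Rightarrow> real \<Rightarrow> (nat \<Rightarrow> real) measure \<Rightarrow> bool" where
  "positive_near_center m c r \<mu> \<longleftrightarrow>
     (\<forall>U. openin (subtopology (eucl_topology m) (eucl_cball m c r)) U \<and> c \<in> U \<longrightarrow> measure \<mu> U > 0)"

text \<open>
  Quantifying over Borel null sets loses nothing: a Lebesgue null set is contained in a Borel
  null set.
\<close>

definition null_on_lebesgue_null ::
  "nat \<Rightarrow> (nat \<Rightarrow> real) \<Rightarrow> real \<Rightarrow> (nat \<Rightarrow> real) measure \<Rightarrow> bool" where
  "null_on_lebesgue_null m c r \<mu> \<longleftrightarrow>
     (\<forall>A\<in>null_sets (eucl_lborel m). A \<subseteq> eucl_cball m c r \<longrightarrow> A \<in> null_sets \<mu>)"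

definition esbm ::
  "nat \<Rightarrow> nat \<Rightarrow> (nat \<Rightarrow> nat \<Rightarrow> real) \<Rightarrow> (nat \<Rightarrow> real) \<Rightarrow> (nat \<Rightarrow> (nat \<Rightarrow> real) measure) \<Rightarrow> bool" where
  "esbm m k c r \<mu> \<longleftrightarrow>
     (\<forall>i\<in>{1..k}. c i \<in> eucl m \<and> r i > 0 \<and> prob_space (\<mu> i) \<and>
        sets (\<mu> i) = sets (restrict_space (eucl_borel m) (eucl_cball m (c i) (r i))))"

text \<open>Sample space: \<open>\<omega> (i, l)\<close> is the \<open>l\<close>-th of the \<open>ns i\<close> points drawn from ball \<open>i\<close>.\<close>

definition esbm_sample ::
  "nat \<Rightarrow> (nat \<Rightarrow> (nat \<Rightarrow> real) measure) \<Rightarrow> (nat \<Rightarrow> nat) \<Rightarrow> (nat \<times> nat \<Rightarrow> nat \<Rightarrow> real) measure" where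
  "esbm_sample k \<mu> ns = PiM (SIGMA i:{1..k}. {1..ns i}) (\<lambda>(i, l). \<mu> i)"

definition drawn_from :: "(nat \<Rightarrow> nat) \<Rightarrow> (nat \<times> nat \<Rightarrow> 'a) \<Rightarrow> nat \<Rightarrow> 'a set" where
  "drawn_from ns \<omega> i = (\<lambda>l. \<omega> (i, l)) ` {1..ns i}"

definition lp_cost :: "('a \<Rightarrow> 'a \<Rightarrow> real) \<Rightarrow> 'a set \<Rightarrow> ('a \<Rightarrow> 'a \<Rightarrow> real) \<Rightarrow> real" where
  "lp_cost d P z = (\<Sum>p\<in>P. \<Sum>q\<in>P. d p q * z p q)"

definition lp_feasible :: "'a set \<Rightarrow> nat \<Rightarrow> ('a \<Rightarrow> real) \<Rightarrow> ('a \<Rightarrow> 'a \<Rightarrow> real) \<Rightarrow> bool" where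
  "lp_feasible P k y z \<longleftrightarrow>
     (\<forall>q\<in>P. (\<Sum>p\<in>P. z p q) = 1) \<and>
     (\<forall>p\<in>P. \<forall>q\<in>P. z p q \<le> y p) \<and>
     (\<Sum>p\<in>P. y p) = real k \<and>
     (\<forall>p\<in>P. y p \<ge> 0) \<and> (\<forall>p\<in>P. \<forall>q\<in>P. z p q \<ge> 0)"

definition ip_feasible :: "'a set \<Rightarrow> nat \<Rightarrow> ('a \<Rightarrow> real) \<Rightarrow> ('a \<Rightarrow> 'a \<Rightarrow> real) \<Rightarrow> bool" where
  "ip_feasible P k y z \<longleftrightarrow>
     lp_feasible P k y z \<and> (\<forall>p\<in>P. y p \<in> {0, 1}) \<and> (\<forall>p\<in>P. \<forall>q\<in>P. z p q \<in> {0, 1})"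

definition lp_optimal ::
  "('a \<Rightarrow> 'a \<Rightarrow> real) \<Rightarrow> 'a set \<Rightarrow> nat \<Rightarrow> ('a \<Rightarrow> real) \<Rightarrow> ('a \<Rightarrow> 'a \<Rightarrow> real) \<Rightarrow> bool" where
  "lp_optimal d P k y z \<longleftrightarrow>
     lp_feasible P k y z \<and> (\<forall>y' z'. lp_feasible P k y' z' \<longrightarrow> lp_cost d P z \<le> lp_cost d P z')"

text \<open>
  \<open>S i\<close> is the set of points drawn from ball \<open>i\<close>. The variables of the program are the values of
  \<open>y\<close> and \<open>z\<close> on \<open>P\<close>, so uniqueness means agreement there.
\<close>

definition exact_recovery ::
  "('a \<Rightarrow> 'a \<Rightarrow> real) \<Rightarrow> nat \<Rightarrow> (nat \<Rightarrow> 'a set) \<Rightarrow> bool" where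
  "exact_recovery d k S \<longleftrightarrow> (let P = (\<Union>i\<in>{1..k}. S i) in
     \<exists>y z. lp_optimal d P k y z \<and>
       (\<forall>y' z'. lp_optimal d P k y' z' \<longrightarrow>
          (\<forall>p\<in>P. y' p = y p) \<and> (\<forall>p\<in>P. \<forall>q\<in>P. z' p q = z p q)) \<and>
       ip_feasible P k y z \<and>
       (\<forall>i\<in>{1..k}. \<exists>!p. p \<in> S i \<and> y p = 1) \<and>
       (\<forall>p\<in>P. \<forall>q\<in>P. z p q = 1 \<longrightarrow> (\<exists>i\<in>{1..k}. p \<in> S i \<and> q \<in> S i)))"

definition with_high_probability ::
  "(nat \<Rightarrow> 'a measure) \<Rightarrow> (nat \<Rightarrow> 'a \<Rightarrow> bool) \<Rightarrow> bool" where
  "with_high_probability M A \<longleftrightarrow>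
     (\<forall>\<delta>::real. 0 < \<delta> \<and> \<delta> < 1 \<longrightarrow>
        (\<exists>N>0. \<forall>n>N. measure (M n) {\<omega> \<in> space (M n). A n \<omega>} > 1 - \<delta>))"

end

theory Submission
  imports Defs
begin

text \<open>
  Linear programming duality reduces exact recovery to a certificate: a median \<open>p i\<close> in each ball and
  budgets \<open>A i\<close> such that \<open>p i\<close> sees (is within budget of) every point of its own ball and no point of
  another, the total visible budget \<open>\<Sum>q. max 0 (A - d p q)\<close> equals \<open>\<gamma>\<close> at the medians, and it is smaller
  than \<open>\<gamma>\<close> at all other sample points. Put \<open>C = 20\<close> and let \<open>2 * \<eta>\<close> be the guaranteed gap between the balls.
  If \<open>\<eta> \<ge> 2\<close>, the balls do not interact. Otherwise take budgets near \<open>1 + \<eta>\<close>. Moving from the centre to a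
  point at distance \<open>s\<close> loses about \<open>s\<^sup>2 / 6\<close> (for \<open>s \<le> \<eta>\<close>, where no other ball is visible) or
  \<open>\<eta>\<^sup>2 / 6 - 1 / m\<close> of the own ball's visible budget, while each other ball contributes at most
  \<open>(1 + \<eta>) / m\<close>; since \<open>k / m\<close> is small against \<open>\<eta>\<^sup>2\<close>, the centre wins. These bounds need only second
  moments: the inner product of \<open>x - c\<close> with a fixed unit vector has conditional variance \<open>|x - c|\<^sup>2 / m\<close>,
  which follows from invariance under quarter turns of coordinate planes. Hoeffding's inequality on a finite
  net transfers the bounds to the sample, and ties between candidate medians have probability zero.
\<close>

section \<open>The dual certificate\<close>

text \<open>The value \<open>\<gamma>\<close> must be the same for all balls, because it is the
  multiplier of the single constraint that fixes the sum of the \<open>y p\<close>. This is where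
  the equal mean radii enter: with common mean radius \<open>r\<close>, the value
  \<open>\<gamma> = n * (1 + \<eta> - r)\<close> lets every ball reach the required equality
  exactly, with a sample-dependent budget that stays close to \<open>1 + \<eta>\<close>. The strict
  inequality at the other sample points resists concentration near a centre, where the expected loss
  tends to 0 and no uniform margin survives sampling. So the points within \<open>\<eta> / 4\<close>
  of the centre are compared exactly: each of them sees its whole ball and nothing else, and the
  median is chosen as the one with the least empirical mean distance. Only ties can spoil strictness
  there. Farther out the margin is a positive constant that absorbs the sampling errors. The last
  obstacle is formal. A non-measurable set has \<open>measure\<close> 0 by convention, so it is not
  enough to include a likely event in the recovery event: the latter must itself be
  measurable.\<close>

text \<open>Complementary slackness. The dual variables are \<open>A j\<close> for the assignment of
  a point of \<open>S j\<close>, \<open>max 0 (A j - d x q)\<close> for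
  \<open>z x q \<le> y x\<close>, and \<open>\<gamma>\<close> for the number of medians. The cost of
  a feasible solution is the dual value plus a sum of non-negative slackness terms. They all vanish
  at the integral solution, and the strictness in \<open>cross\<close> and \<open>slack\<close>
  makes it the only one.\<close>

lemma exact_recovery_certificate:
  fixes d :: "'a \<Rightarrow> 'a \<Rightarrow> real" and A :: "nat \<Rightarrow> real"
  assumes fin: "\<And>i. i \<in> {1..k} \<Longrightarrow> finite (S i)"
    and disj: "\<And>i j. i \<in> {1..k} \<Longrightarrow> j \<in> {1..k} \<Longrightarrow> i \<noteq> j \<Longrightarrow> S i \<inter> S j = {}"
    and med: "\<And>i. i \<in> {1..k} \<Longrightarrow> p i \<in> S i"
    and own: "\<And>i q. i \<in> {1..k} \<Longrightarrow> q \<in> S i \<Longrightarrow> d (p i) q \<le> A i"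
    and cross: "\<And>i j q. i \<in> {1..k} \<Longrightarrow> j \<in> {1..k} \<Longrightarrow> i \<noteq> j \<Longrightarrow> q \<in> S j \<Longrightarrow> A j < d (p i) q"
    and tight: "\<And>i. i \<in> {1..k} \<Longrightarrow> (\<Sum>q\<in>S i. A i - d (p i) q) = \<gamma>"
    and slack: "\<And>i x. i \<in> {1..k} \<Longrightarrow> x \<in> S i \<Longrightarrow> x \<noteq> p i \<Longrightarrow>
      (\<Sum>j\<in>{1..k}. \<Sum>q\<in>S j. max 0 (A j - d x q)) < \<gamma>"
  shows "exact_recovery d k S"
proof -
  define P where "P = (\<Union>i\<in>{1..k}. S i)"
  define lab where "lab q = (THE i. i \<in> {1..k} \<and> q \<in> S i)" for q
  have lab: "lab q = i" if "i \<in> {1..k}" "q \<in> S i" for i q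
    unfolding lab_def using that disj by (intro the_equality) auto
  have labP: "lab q \<in> {1..k}" "q \<in> S (lab q)" if "q \<in> P" for q
    using that lab unfolding P_def by auto
  have finP: "finite P"
    unfolding P_def using fin by auto
  have medP: "p i \<in> P" if "i \<in> {1..k}" for i
    using med that unfolding P_def by blast
  have labp: "lab (p i) = i" if "i \<in> {1..k}" for i
    using lab med that by auto
  have inj: "inj_on p {1..k}"
    by (rule inj_on_inverseI[where g = lab]) (use labp in auto)
  have sumP: "(\<Sum>q\<in>P. f q) = (\<Sum>i\<in>{1..k}. \<Sum>q\<in>S i. f q)" for f :: "'a \<Rightarrow> real"
    unfolding P_def using fin disj by (intro sum.UNION_disjoint) auto
  define a where "a q = A (lab q)" for q
  define W where "W x = (\<Sum>q\<in>P. max 0 (a q - d x q))" for x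
  have W_alt: "W x = (\<Sum>j\<in>{1..k}. \<Sum>q\<in>S j. max 0 (A j - d x q))" for x
    unfolding W_def sumP a_def using lab by (intro sum.cong refl) auto
  have W_med: "W (p i) = \<gamma>" if i: "i \<in> {1..k}" for i
  proof -
    have "(\<Sum>q\<in>S j. max 0 (A j - d (p i) q)) = (if j = i then \<gamma> else 0)" if j: "j \<in> {1..k}" for j
    proof (cases "j = i")
      case True
      then have "(\<Sum>q\<in>S j. max 0 (A j - d (p i) q)) = (\<Sum>q\<in>S i. A i - d (p i) q)"
        using own[OF i] by (intro sum.cong) auto
      then show ?thesis using tight[OF i] True by simp
    next
      case False
      then have "(\<Sum>q\<in>S j. max 0 (A j - d (p i) q)) = 0"
        using cross[OF i j] by (intro sum.neutral) (auto simp: max_absorb1 less_imp_le)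
      then show ?thesis using False by simp
    qed
    then have "W (p i) = (\<Sum>j\<in>{1..k}. if j = i then \<gamma> else 0)"
      unfolding W_alt by (intro sum.cong) auto
    then show ?thesis using i by simp
  qed
  have W_lt: "W x < \<gamma>" if "x \<in> P" "x \<notin> p ` {1..k}" for x
  proof -
    have "x \<noteq> p (lab x)"
      using that labP by blast
    then show ?thesis
      unfolding W_alt using that slack[of "lab x" x] labP[of x] by auto
  qed
  have W_le: "W x \<le> \<gamma>" if "x \<in> P" for x
    using W_lt[OF that] W_med by fastforce
  \<comment> \<open>This is \<open>(d x q - a q) * z x q\<close> for an invisible pair and
    \<open>(a q - d x q) * (y x - z x q)\<close> for a visible one, hence non-negative on feasible
    solutions.\<close>
  define T where "T y z x q = (d x q - a q) * z x q + max 0 (a q - d x q) * y x" for y :: "'a \<Rightarrow> real" and z x q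
  define gap where "gap y z = (\<Sum>x\<in>P. \<Sum>q\<in>P. T y z x q) + (\<Sum>x\<in>P. (\<gamma> - W x) * y x)"
    for y :: "'a \<Rightarrow> real" and z
  have cost: "lp_cost d P z = (\<Sum>q\<in>P. a q) - real k * \<gamma> + gap y z" if f: "lp_feasible P k y z" for y z
  proof -
    have 1: "(\<Sum>x\<in>P. \<Sum>q\<in>P. a q * z x q) = (\<Sum>q\<in>P. a q)"
      using f unfolding lp_feasible_def
      by (subst sum.swap) (auto simp: sum_distrib_left[symmetric] intro!: sum.cong)
    have 2: "(\<Sum>x\<in>P. \<gamma> * y x) = real k * \<gamma>"
      using f unfolding lp_feasible_def by (simp add: sum_distrib_left[symmetric])
    have "gap y z = (\<Sum>x\<in>P. (\<Sum>q\<in>P. d x q * z x q) - (\<Sum>q\<in>P. a q * z x q) + \<gamma> * y x)"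
      unfolding gap_def sum.distrib[symmetric]
    proof (intro sum.cong refl)
      fix x
      have "(\<Sum>q\<in>P. T y z x q) = (\<Sum>q\<in>P. d x q * z x q) - (\<Sum>q\<in>P. a q * z x q) + W x * y x"
        unfolding T_def W_def sum_distrib_right
        by (simp add: sum.distrib sum_subtractf left_diff_distrib)
      then show "(\<Sum>q\<in>P. T y z x q) + (\<gamma> - W x) * y x =
          (\<Sum>q\<in>P. d x q * z x q) - (\<Sum>q\<in>P. a q * z x q) + \<gamma> * y x"
        by (simp add: algebra_simps)
    qed
    then show ?thesis
      using 1 2 unfolding lp_cost_def by (simp add: sum.distrib sum_subtractf)
  qed
  have T_nonneg: "T y z x q \<ge> 0" if f: "lp_feasible P k y z" and "x \<in> P" "q \<in> P" for y z x q
  proof (cases "d x q \<ge> a q")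
    case True
    then show ?thesis using that unfolding T_def lp_feasible_def by auto
  next
    case False
    then have "T y z x q = (a q - d x q) * (y x - z x q)"
      unfolding T_def by (simp add: algebra_simps max_def)
    then show ?thesis using False that unfolding lp_feasible_def by auto
  qed
  have U_nonneg: "(\<gamma> - W x) * y x \<ge> 0" if "lp_feasible P k y z" "x \<in> P" for y z x
    using that W_le unfolding lp_feasible_def by auto
  have gap_nonneg: "gap y z \<ge> 0" if "lp_feasible P k y z" for y z
    unfolding gap_def using that T_nonneg U_nonneg by (intro add_nonneg_nonneg sum_nonneg) auto

  define y0 where "y0 x = (if x \<in> p ` {1..k} then 1 else 0 :: real)" for x
  define z0 where "z0 x q = (if x = p (lab q) then 1 else 0 :: real)" for x q
  have y0_sum: "(\<Sum>x\<in>P. y0 x) = real k"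
  proof -
    have "(\<Sum>x\<in>P. y0 x) = (\<Sum>x\<in>p ` {1..k}. y0 x)"
      using finP medP by (intro sum.mono_neutral_right) (auto simp: y0_def)
    also have "\<dots> = real k"
      by (subst sum.reindex[OF inj]) (simp add: y0_def)
    finally show ?thesis .
  qed
  have feas0: "lp_feasible P k y0 z0"
    unfolding lp_feasible_def
  proof (intro conjI ballI)
    fix q assume "q \<in> P"
    then show "(\<Sum>x\<in>P. z0 x q) = 1"
      using finP medP labP unfolding z0_def by simp
  qed (use y0_sum labP in \<open>auto simp: y0_def z0_def\<close>)
  have T0: "T y0 z0 x q = 0" if "x \<in> P" "q \<in> P" for x q
  proof (cases "x \<in> p ` {1..k}")
    case True
    then obtain i where i: "i \<in> {1..k}" "x = p i" by auto
    show ?thesis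
    proof (cases "lab q = i")
      case True
      then show ?thesis
        using own[of i q] i labP[OF \<open>q \<in> P\<close>] unfolding T_def y0_def z0_def a_def by auto
    next
      case False
      then have "p i \<noteq> p (lab q)"
        using inj i labP[OF \<open>q \<in> P\<close>] by (auto dest: inj_onD)
      then show ?thesis
        using cross[of i "lab q" q] False i labP[OF \<open>q \<in> P\<close>] unfolding T_def y0_def z0_def a_def by auto
    qed
  next
    case False
    then show ?thesis
      using labP[OF \<open>q \<in> P\<close>] unfolding T_def y0_def z0_def by auto
  qed
  have gap0: "gap y0 z0 = 0"
  proof -
    have "(\<gamma> - W x) * y0 x = 0" if "x \<in> P" for x
      using W_med by (auto simp: y0_def)
    then have "(\<Sum>x\<in>P. (\<gamma> - W x) * y0 x) = 0"
      by (intro sum.neutral) blast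
    then show ?thesis
      unfolding gap_def using T0 by simp
  qed
  have opt0: "lp_optimal d P k y0 z0"
    unfolding lp_optimal_def using feas0 cost gap0 gap_nonneg by auto
  have uniq: "(\<forall>x\<in>P. y x = y0 x) \<and> (\<forall>x\<in>P. \<forall>q\<in>P. z x q = z0 x q)" if "lp_optimal d P k y z" for y z
  proof -
    have f: "lp_feasible P k y z" and "lp_cost d P z \<le> lp_cost d P z0"
      using that feas0 unfolding lp_optimal_def by auto
    then have g: "gap y z = 0"
      using cost[OF f] cost[OF feas0] gap0 gap_nonneg[OF f] by simp
    have s1: "(\<Sum>x\<in>P. \<Sum>q\<in>P. T y z x q) = 0" and s2: "(\<Sum>x\<in>P. (\<gamma> - W x) * y x) = 0"
      using g sum_nonneg[of P "\<lambda>x. \<Sum>q\<in>P. T y z x q"] sum_nonneg[of P "\<lambda>x. (\<gamma> - W x) * y x"]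
        T_nonneg[OF f] U_nonneg[OF f] unfolding gap_def by (smt (verit) sum_nonneg)+
    have T: "T y z x q = 0" if "x \<in> P" "q \<in> P" for x q
    proof -
      have "(\<Sum>q\<in>P. T y z x q) = 0"
        using s1 that by (subst (asm) sum_nonneg_eq_0_iff) (auto intro!: sum_nonneg T_nonneg[OF f] simp: finP)
      then show ?thesis
        using that by (subst (asm) sum_nonneg_eq_0_iff) (auto intro!: T_nonneg[OF f] simp: finP)
    qed
    have U: "(\<gamma> - W x) * y x = 0" if "x \<in> P" for x
      using s2 that U_nonneg[OF f] by (subst (asm) sum_nonneg_eq_0_iff) (auto simp: finP)
    have y_0: "y x = 0" if "x \<in> P" "x \<notin> p ` {1..k}" for x
      using U[of x] W_lt[of x] that by auto
    \<comment> \<open>A foreign median has positive reduced cost at \<open>q\<close> by the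
      strictness of \<open>cross\<close>; a point that is no median has \<open>y x = 0\<close>,
      which caps \<open>z x q\<close>.\<close>
    have z_0: "z x q = 0" if "x \<in> P" "q \<in> P" "x \<noteq> p (lab q)" for x q
    proof (cases "x \<in> p ` {1..k}")
      case True
      then obtain i where i: "i \<in> {1..k}" "x = p i" by auto
      then have "i \<noteq> lab q" using that by auto
      then have "a q < d x q"
        using cross[of i "lab q" q] i labP[OF \<open>q \<in> P\<close>] unfolding a_def by auto
      then show ?thesis using T[of x q] that unfolding T_def by auto
    next
      case False
      then show ?thesis using y_0[of x] that f unfolding lp_feasible_def by (smt (verit))
    qed
    have z_1: "z (p (lab q)) q = 1" if "q \<in> P" for q
    proof -
      have "1 = (\<Sum>x\<in>P. z x q)" using f that unfolding lp_feasible_def by auto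
      also have "\<dots> = (\<Sum>x\<in>P. if x = p (lab q) then z x q else 0)"
        using z_0 that by (intro sum.cong) auto
      also have "\<dots> = z (p (lab q)) q"
        using finP medP labP[OF that] by simp
      finally show ?thesis by simp
    qed
    \<comment> \<open>Each median serves itself, which forces mass at least 1 on it; the total
      \<open>k\<close> then leaves exactly 1.\<close>
    have y_ge: "y (p i) \<ge> 1" if "i \<in> {1..k}" for i
    proof -
      have "z (p i) (p i) = 1"
        using z_1[OF medP[OF that]] labp[OF that] by simp
      moreover have "z (p i) (p i) \<le> y (p i)"
        using f medP[OF that] unfolding lp_feasible_def by auto
      ultimately show ?thesis by simp
    qed
    have "(\<Sum>i\<in>{1..k}. y (p i) - 1) = 0"
    proof -
      have "real k = (\<Sum>x\<in>P. y x)" using f unfolding lp_feasible_def by simp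
      also have "\<dots> = (\<Sum>x\<in>p ` {1..k}. y x)"
        using finP medP y_0 by (intro sum.mono_neutral_right) auto
      also have "\<dots> = (\<Sum>i\<in>{1..k}. y (p i))"
        by (subst sum.reindex[OF inj]) simp
      finally show ?thesis by (simp add: sum_subtractf)
    qed
    then have y_1: "y (p i) = 1" if "i \<in> {1..k}" for i
      using y_ge that by (subst (asm) sum_nonneg_eq_0_iff) auto
    show ?thesis
      using y_0 y_1 z_0 z_1 by (auto simp: y0_def z0_def)
  qed
  have "\<exists>!x. x \<in> S i \<and> y0 x = 1" if i: "i \<in> {1..k}" for i
  proof (rule ex1I[of _ "p i"])
    show "p i \<in> S i \<and> y0 (p i) = 1"
      using med i by (auto simp: y0_def)
    fix x assume x: "x \<in> S i \<and> y0 x = 1"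
    then obtain j where "j \<in> {1..k}" "x = p j"
      unfolding y0_def by (auto split: if_splits)
    then show "x = p i"
      using lab[OF i, of x] labp[of j] x by auto
  qed
  moreover have "\<exists>i\<in>{1..k}. x \<in> S i \<and> q \<in> S i" if "q \<in> P" "z0 x q = 1" for x q
    using that labP[OF \<open>q \<in> P\<close>] med[of "lab q"] unfolding z0_def by (auto split: if_splits)
  moreover have "ip_feasible P k y0 z0"
    unfolding ip_feasible_def using feas0 by (auto simp: y0_def z0_def)
  ultimately show ?thesis
    unfolding exact_recovery_def Let_def P_def[symmetric] using opt0 uniq by blast
qed

section \<open>Measurability of exact recovery\<close>

lemma lp_cost_cong:
  assumes "\<And>p q. p \<in> P \<Longrightarrow> q \<in> P \<Longrightarrow> d p q * z p q = d' p q * z' p q"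
  shows "lp_cost d P z = lp_cost d' P z'"
  unfolding lp_cost_def using assms by (intro sum.cong refl) auto

lemma lp_feasible_cong:
  assumes "\<And>p. p \<in> P \<Longrightarrow> y p = y' p" "\<And>p q. p \<in> P \<Longrightarrow> q \<in> P \<Longrightarrow> z p q = z' p q"
  shows "lp_feasible P k y z \<longleftrightarrow> lp_feasible P k y' z'"
  using assms unfolding lp_feasible_def by (simp cong: sum.cong ball_cong)

lemma lp_feasible_image:
  assumes "inj_on f Q"
  shows "lp_feasible (f ` Q) k y z \<longleftrightarrow> lp_feasible Q k (y \<circ> f) (\<lambda>a b. z (f a) (f b))"
  unfolding lp_feasible_def by (simp add: sum.reindex[OF assms])

lemma lp_cost_image:
  assumes "inj_on f Q"
  shows "lp_cost d (f ` Q) z = lp_cost (\<lambda>a b. d (f a) (f b)) Q (\<lambda>a b. z (f a) (f b))"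
  unfolding lp_cost_def by (simp add: sum.reindex[OF assms])

lemma lp_optimal_image:
  assumes inj: "inj_on f Q"
  shows "lp_optimal d (f ` Q) k y z \<longleftrightarrow>
    lp_optimal (\<lambda>a b. d (f a) (f b)) Q k (y \<circ> f) (\<lambda>a b. z (f a) (f b))"
proof -
  let ?g = "inv_into Q f"
  let ?D = "\<lambda>a b. d (f a) (f b)"
  have *: "lp_cost ?D Q w \<le> lp_cost ?D Q z'"
    if "\<And>y' z'. lp_feasible (f ` Q) k y' z' \<Longrightarrow> lp_cost ?D Q w \<le> lp_cost d (f ` Q) z'"
      and f: "lp_feasible Q k y' z'" for w y' z'
  proof -
    have "lp_feasible (f ` Q) k (y' \<circ> ?g) (\<lambda>a b. z' (?g a) (?g b)) \<longleftrightarrow> lp_feasible Q k y' z'"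
      unfolding lp_feasible_image[OF inj] using inj by (intro lp_feasible_cong) auto
    then have "lp_cost ?D Q w \<le> lp_cost d (f ` Q) (\<lambda>a b. z' (?g a) (?g b))"
      using that by blast
    also have "\<dots> = lp_cost ?D Q z'"
      unfolding lp_cost_image[OF inj] using inj by (intro lp_cost_cong) auto
    finally show ?thesis .
  qed
  show ?thesis
    unfolding lp_optimal_def lp_feasible_image[OF inj, of k y z] lp_cost_image[OF inj, of d z]
    using * by (auto simp: lp_feasible_image[OF inj] lp_cost_image[OF inj])
qed

lemma lp_optimal_cong:
  assumes "\<And>p. p \<in> P \<Longrightarrow> y p = y' p" "\<And>p q. p \<in> P \<Longrightarrow> q \<in> P \<Longrightarrow> z p q = z' p q"
  shows "lp_optimal d P k y z \<longleftrightarrow> lp_optimal d P k y' z'"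
proof -
  have "lp_feasible P k y z \<longleftrightarrow> lp_feasible P k y' z'" "lp_cost d P z = lp_cost d P z'"
    using assms by (intro lp_feasible_cong lp_cost_cong; simp)+
  then show ?thesis
    unfolding lp_optimal_def by simp
qed

text \<open>Replaces the random point set by a fixed set of indices, so that the sample enters only
  through the matrix of distances. Both directions relabel solutions along \<open>f\<close> and
  \<open>inv_into R f\<close>, where \<open>R\<close> is the set of indices that occur in some
  \<open>T i\<close>.\<close>

lemma exact_recovery_image:
  assumes inj: "inj_on f Q" and T: "\<And>i. i \<in> {1..k} \<Longrightarrow> T i \<subseteq> Q"
  shows "exact_recovery d k (\<lambda>i. f ` T i) \<longleftrightarrow> exact_recovery (\<lambda>a b. d (f a) (f b)) k T"
proof -
  let ?D = "\<lambda>a b. d (f a) (f b)"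
  define I where "I = {1..k}"
  have T: "T i \<subseteq> Q" if "i \<in> I" for i
    using T that unfolding I_def by blast
  define R where "R = (\<Union>i\<in>I. T i)"
  have "R \<subseteq> Q" unfolding R_def using T by blast
  then have injR: "inj_on f R" using inj inj_on_subset by blast
  have P: "(\<Union>i\<in>I. f ` T i) = f ` R" unfolding R_def by blast
  let ?g = "inv_into R f"
  have gf [simp]: "?g (f a) = a" if "a \<in> R" for a
    using injR that by simp
  have memb: "f a \<in> f ` T i \<longleftrightarrow> a \<in> T i" if "a \<in> R" "i \<in> I" for a i
  proof -
    have "T i \<subseteq> R" using that unfolding R_def by blast
    then show ?thesis using inj_on_image_mem_iff[OF injR that(1)] by blast
  qed
  let ?E = "\<lambda>y z. ip_feasible (f ` R) k y z \<and>
      (\<forall>i\<in>I. \<exists>!p. p \<in> f ` T i \<and> y p = 1) \<and>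
      (\<forall>p\<in>f ` R. \<forall>q\<in>f ` R. z p q = 1 \<longrightarrow> (\<exists>i\<in>I. p \<in> f ` T i \<and> q \<in> f ` T i))"
  let ?F = "\<lambda>y z. ip_feasible R k y z \<and>
      (\<forall>i\<in>I. \<exists>!p. p \<in> T i \<and> y p = 1) \<and>
      (\<forall>p\<in>R. \<forall>q\<in>R. z p q = 1 \<longrightarrow> (\<exists>i\<in>I. p \<in> T i \<and> q \<in> T i))"
  have ex1: "(\<exists>!p. p \<in> f ` T i \<and> y p = (1::real)) \<longleftrightarrow> (\<exists>!a. a \<in> T i \<and> y (f a) = 1)" if "i \<in> I" for i y
  proof -
    have "T i \<subseteq> R" using that unfolding R_def by blast
    then have "inj_on f (T i)" using injR inj_on_subset by blast
    then show ?thesis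
      unfolding Ex1_def inj_on_def by (safe; blast)
  qed
  have EF: "?E y z \<longleftrightarrow> ?F (y \<circ> f) (\<lambda>a b. z (f a) (f b))" for y z
    unfolding ip_feasible_def lp_feasible_image[OF injR]
    using memb ex1 by (simp cong: ball_cong bex_cong)
  have F_cong: "?F y z \<longleftrightarrow> ?F y' z'"
    if "\<And>a. a \<in> R \<Longrightarrow> y a = y' a" "\<And>a b. a \<in> R \<Longrightarrow> b \<in> R \<Longrightarrow> z a b = z' a b" for y y' z z'
  proof -
    have "(\<exists>!p. p \<in> T i \<and> y p = 1) \<longleftrightarrow> (\<exists>!p. p \<in> T i \<and> y' p = 1)" if "i \<in> I" for i
      using that \<open>\<And>a. a \<in> R \<Longrightarrow> y a = y' a\<close> unfolding R_def by (metis UN_I)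
    then show ?thesis
      unfolding ip_feasible_def using that lp_feasible_cong[of R y y' z z' k]
      by (simp cong: ball_cong)
  qed
  have O: "lp_optimal d (f ` R) k y z \<longleftrightarrow> lp_optimal ?D R k (y \<circ> f) (\<lambda>a b. z (f a) (f b))" for y z
    by (rule lp_optimal_image[OF injR])
  show ?thesis
  proof
    assume "exact_recovery d k (\<lambda>i. f ` T i)"
    then obtain y z where *: "lp_optimal d (f ` R) k y z \<and> (\<forall>y' z'. lp_optimal d (f ` R) k y' z' \<longrightarrow>
          (\<forall>p\<in>f ` R. y' p = y p) \<and> (\<forall>p\<in>f ` R. \<forall>q\<in>f ` R. z' p q = z p q)) \<and> ?E y z"
      unfolding exact_recovery_def Let_def I_def[symmetric] P by (elim exE) (rule that)
    note o = *[THEN conjunct1] and u = *[THEN conjunct2, THEN conjunct1, rule_format]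
      and e = *[THEN conjunct2, THEN conjunct2]
    have "(\<forall>a\<in>R. y' a = y (f a)) \<and> (\<forall>a\<in>R. \<forall>b\<in>R. z' a b = z (f a) (f b))"
      if "lp_optimal ?D R k y' z'" for y' z'
    proof -
      have "lp_optimal d (f ` R) k (y' \<circ> ?g) (\<lambda>a b. z' (?g a) (?g b))"
        unfolding O using that by (subst lp_optimal_cong[of R _ y' _ z']) simp_all
      from u[OF this] show ?thesis by auto
    qed
    then have u': "\<forall>y' z'. lp_optimal ?D R k y' z' \<longrightarrow>
        (\<forall>a\<in>R. y' a = (y \<circ> f) a) \<and> (\<forall>a\<in>R. \<forall>b\<in>R. z' a b = z (f a) (f b))"
      by (simp only: o_apply) blast
    show "exact_recovery ?D k T"
      unfolding exact_recovery_def Let_def I_def[symmetric] R_def[symmetric]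
      by (rule exI, rule exI, rule conjI[OF o[unfolded O] conjI[OF u' e[unfolded EF]]])
  next
    assume "exact_recovery ?D k T"
    then obtain y z where *: "lp_optimal ?D R k y z \<and> (\<forall>y' z'. lp_optimal ?D R k y' z' \<longrightarrow>
          (\<forall>p\<in>R. y' p = y p) \<and> (\<forall>p\<in>R. \<forall>q\<in>R. z' p q = z p q)) \<and> ?F y z"
      unfolding exact_recovery_def Let_def I_def[symmetric] R_def[symmetric] by (elim exE) (rule that)
    note o = *[THEN conjunct1] and u = *[THEN conjunct2, THEN conjunct1, rule_format]
      and e = *[THEN conjunct2, THEN conjunct2]
    let ?y = "y \<circ> ?g" and ?z = "\<lambda>a b. z (?g a) (?g b)"
    have 1: "lp_optimal d (f ` R) k ?y ?z"
      unfolding O using o by (subst lp_optimal_cong[of R _ y _ z]) simp_all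
    have 2: "?E ?y ?z"
      unfolding EF using e by (subst F_cong[of _ y _ z]) simp_all
    have 3: "(\<forall>p\<in>f ` R. y' p = ?y p) \<and> (\<forall>p\<in>f ` R. \<forall>q\<in>f ` R. z' p q = ?z p q)"
      if "lp_optimal d (f ` R) k y' z'" for y' z'
      using u[of "y' \<circ> f"] that unfolding O by auto
    show "exact_recovery d k (\<lambda>i. f ` T i)"
      unfolding exact_recovery_def Let_def I_def[symmetric] P 
      by (rule exI, rule exI, rule conjI[OF 1 conjI[OF _ 2]]) (use 3 in blast)
  qed
qed

text \<open>Tychonoff's theorem; the index type may be infinite.\<close>

lemma compact_box:
  "compact {w :: 'b \<Rightarrow> real. \<forall>i. w i \<in> {l i..u i}}"
proof -
  have "compactin (product_topology (\<lambda>_. euclidean) UNIV) (\<Pi>\<^sub>E i\<in>UNIV. {l i..u i})"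
    by (subst compactin_PiE) auto
  moreover have "(\<Pi>\<^sub>E i\<in>UNIV. {l i..u i}) = {w. \<forall>i. w i \<in> {l i..u i}}"
    by (auto simp: PiE_def)
  ultimately show ?thesis
    by (simp add: euclidean_product_topology)
qed

text \<open>\<open>D\<close> is uncurried because functions on \<open>'a \<times> 'a\<close> carry
  the product topology, whose Borel sets serve as events for distance matrices.\<close>

definition excess :: "('a \<times> 'a \<Rightarrow> real) \<Rightarrow> 'a set \<Rightarrow> ('a \<Rightarrow> 'a \<Rightarrow> real) \<Rightarrow> ('a \<Rightarrow> 'a \<Rightarrow> real) \<Rightarrow> real" where
  "excess D P z0 z = lp_cost (curry D) P z - lp_cost (curry D) P z0"

text \<open>
  On the compact set of feasible solutions at distance at least \<open>1/N\<close> from a unique optimum, the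
  excess cost attains a positive minimum; for fixed \<open>N\<close> and fixed bound this is a closed condition.
\<close>

lemma sets_unique_optimum:
  fixes P :: "'a :: countable set"
  assumes fin: "finite P" and f0: "lp_feasible P k y0 z0"
  shows "{D. \<forall>y z. lp_feasible P k y z \<and> \<not> ((\<forall>p\<in>P. y p = y0 p) \<and> (\<forall>p\<in>P. \<forall>q\<in>P. z p q = z0 p q)) \<longrightarrow>
      0 < excess D P z0 z} \<in> sets (borel :: ('a \<times> 'a \<Rightarrow> real) measure)"
    (is "?U \<in> _")
proof -
  \<comment> \<open>A solution is encoded as a single function: index \<open>(p, None)\<close> holds
    \<open>y p\<close> and index \<open>(p, Some q)\<close> holds \<open>z p q\<close>.\<close>
  define Y where "Y w = (\<lambda>p. w (p, None))" for w :: "'a \<times> 'a option \<Rightarrow> real"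
  define Z where "Z w = (\<lambda>p q. w (p, Some q))" for w :: "'a \<times> 'a option \<Rightarrow> real"
  define dist0 where "dist0 w = (\<Sum>p\<in>P. \<bar>Y w p - y0 p\<bar>) + (\<Sum>p\<in>P. \<Sum>q\<in>P. \<bar>Z w p q - z0 p q\<bar>)" for w
  define F where "F = {w. lp_feasible P k (Y w) (Z w)}"
  \<comment> \<open>Feasibility bounds \<open>y\<close> and \<open>z\<close> by \<open>k\<close> on
    \<open>P\<close>. Pinning the rows outside \<open>P\<close> to 0 confines the representatives to
    a compact box, and every feasible solution has one.\<close>
  define B where "B = {w :: 'a \<times> 'a option \<Rightarrow> real. \<forall>i. w i \<in> {0..if fst i \<in> P then real k else 0}}"
  define K where "K N = {w\<in>F \<inter> B. dist0 w \<ge> inverse (real (Suc N))}" for N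
  have cont [continuous_intros]: "continuous_on UNIV (\<lambda>w :: 'b \<Rightarrow> real. w i)" for i :: 'b
    by simp
  have contY: "continuous_on UNIV (\<lambda>w. Y w p)" and contZ: "continuous_on UNIV (\<lambda>w. Z w p q)" for p q
    unfolding Y_def Z_def by simp_all
  have "closed F"
    unfolding F_def lp_feasible_def
    unfolding Ball_def
    by (intro closed_Collect_conj closed_Collect_all closed_Collect_imp closed_Collect_eq closed_Collect_le
        continuous_intros contY contZ open_Collect_const)
  have "closed {w. dist0 w \<ge> inverse (real (Suc N))}" for N
    unfolding dist0_def by (intro closed_Collect_le continuous_intros contY contZ)
  then have "compact (K N)" for N
  proof -
    have "K N = B \<inter> (F \<inter> {w. dist0 w \<ge> inverse (real (Suc N))})"
      unfolding K_def by auto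
    moreover have "compact B"
      unfolding B_def by (rule compact_box)
    ultimately show ?thesis
      using \<open>closed F\<close> \<open>closed {w. dist0 w \<ge> inverse (real (Suc N))}\<close>
      by (metis closed_Int compact_Int_closed)
  qed
  note compK = this
  define C where "C N M = {D. \<forall>w\<in>K N. inverse (real (Suc M)) \<le> excess D P z0 (Z w)}" for N M
  have "closed (C N M)" for N M
  proof -
    have "C N M = (\<Inter>w\<in>K N. {D. inverse (real (Suc M)) \<le> excess D P z0 (Z w)})"
      unfolding C_def by auto
    moreover have "closed {D. inverse (real (Suc M)) \<le> excess D P z0 (Z w)}" for w
      unfolding excess_def lp_cost_def curry_def
      by (intro closed_Collect_le continuous_intros cont)
    ultimately show ?thesis by auto
  qed
  then have C: "C N M \<in> sets borel" for N M
    by (intro borel_closed)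
  have "?U = (\<Inter>N. \<Union>M. C N M)"
  proof (intro equalityI subsetI)
    fix D assume D: "D \<in> ?U"
    show "D \<in> (\<Inter>N. \<Union>M. C N M)"
    proof
      fix N
      show "D \<in> (\<Union>M. C N M)"
      proof (cases "K N = {}")
        case True
        then show ?thesis unfolding C_def by auto
      next
        case False
        have "continuous_on (K N) (\<lambda>w. excess D P z0 (Z w))"
          unfolding excess_def lp_cost_def
          by (intro continuous_intros continuous_on_subset[OF contZ]) auto
        from continuous_attains_inf[OF compK False this]
        obtain w where w: "w \<in> K N" "\<And>v. v \<in> K N \<Longrightarrow> excess D P z0 (Z w) \<le> excess D P z0 (Z v)"
          by blast
        have "\<not> ((\<forall>p\<in>P. Y w p = y0 p) \<and> (\<forall>p\<in>P. \<forall>q\<in>P. Z w p q = z0 p q))"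
        proof
          assume "(\<forall>p\<in>P. Y w p = y0 p) \<and> (\<forall>p\<in>P. \<forall>q\<in>P. Z w p q = z0 p q)"
          then have "dist0 w = 0" unfolding dist0_def by simp
          then show False using w(1) unfolding K_def by (auto simp: field_simps)
        qed
        then have "0 < excess D P z0 (Z w)"
          using D w(1) unfolding K_def F_def by blast
        then obtain M where "inverse (real (Suc M)) < excess D P z0 (Z w)"
          using reals_Archimedean by blast
        then have "D \<in> C N M"
          unfolding C_def using w(2) by fastforce
        then show ?thesis by blast
      qed
    qed
  next
    fix D assume D: "D \<in> (\<Inter>N. \<Union>M. C N M)"
    show "D \<in> ?U"
    proof (intro CollectI allI impI)
      fix y z assume yz: "lp_feasible P k y z \<and> \<not> ((\<forall>p\<in>P. y p = y0 p) \<and> (\<forall>p\<in>P. \<forall>q\<in>P. z p q = z0 p q))"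
      define w where "w i = (if fst i \<notin> P then 0 else case snd i of None \<Rightarrow> y (fst i)
        | Some q \<Rightarrow> if q \<in> P then z (fst i) q else 0)" for i
      have Yw: "Y w p = y p" if "p \<in> P" for p
        using that unfolding Y_def w_def by simp
      have Zw: "Z w p q = z p q" if "p \<in> P" "q \<in> P" for p q
        using that unfolding Z_def w_def by simp
      have "w \<in> F"
        unfolding F_def using yz lp_feasible_cong[of P "Y w" y "Z w" z k] Yw Zw by auto
      moreover have "w \<in> B"
        unfolding B_def
      proof (intro CollectI allI)
        fix i
        have y: "0 \<le> y p" "y p \<le> real k" if "p \<in> P" for p
        proof -
          show "0 \<le> y p" using yz that unfolding lp_feasible_def by auto
          have "y p \<le> (\<Sum>p\<in>P. y p)"
            using yz that fin unfolding lp_feasible_def by (intro member_le_sum) auto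
          then show "y p \<le> real k" using yz unfolding lp_feasible_def by auto
        qed
        moreover have "0 \<le> z p q" "z p q \<le> real k" if "p \<in> P" "q \<in> P" for p q
          using yz that y(2)[of p] unfolding lp_feasible_def by (auto intro: order_trans)
        ultimately show "w i \<in> {0..if fst i \<in> P then real k else 0}"
          unfolding w_def by (auto split: option.split)
      qed
      moreover have "dist0 w > 0"
      proof -
        have "dist0 w \<noteq> 0"
        proof
          assume "dist0 w = 0"
          then have "(\<Sum>p\<in>P. \<bar>Y w p - y0 p\<bar>) = 0" "(\<Sum>p\<in>P. \<Sum>q\<in>P. \<bar>Z w p q - z0 p q\<bar>) = 0"
            unfolding dist0_def by (smt (verit) sum_nonneg abs_ge_zero)+
          then have "(\<forall>p\<in>P. y p = y0 p) \<and> (\<forall>p\<in>P. \<forall>q\<in>P. z p q = z0 p q)"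
            using Yw Zw fin by (simp add: sum_nonneg_eq_0_iff sum_nonneg)
          then show False using yz by blast
        qed
        moreover have "dist0 w \<ge> 0"
          unfolding dist0_def by (intro add_nonneg_nonneg sum_nonneg) auto
        ultimately show ?thesis by simp
      qed
      then obtain N where "inverse (real (Suc N)) < dist0 w"
        using reals_Archimedean by blast
      ultimately have "w \<in> K N"
        unfolding K_def by auto
      moreover obtain M where "D \<in> C N M"
        using D by blast
      ultimately have "inverse (real (Suc M)) \<le> excess D P z0 (Z w)"
        unfolding C_def by blast
      also have "excess D P z0 (Z w) = excess D P z0 z"
        unfolding excess_def using Zw lp_cost_cong[of P "curry D" "Z w" "curry D" z] by simp
      finally show "0 < excess D P z0 z"
        by (smt (verit) inverse_positive_iff_positive of_nat_0_less_iff zero_less_Suc)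
    qed
  qed
  then show ?thesis using C by auto
qed

lemma exact_recovery_cong_dist:
  assumes "\<And>i j p q. i \<in> {1..k} \<Longrightarrow> j \<in> {1..k} \<Longrightarrow> p \<in> S i \<Longrightarrow> q \<in> S j \<Longrightarrow> d p q = d' p q"
  shows "exact_recovery d k S \<longleftrightarrow> exact_recovery d' k S"
proof -
  have "lp_cost d (\<Union>i\<in>{1..k}. S i) = lp_cost d' (\<Union>i\<in>{1..k}. S i)"
    by (intro ext lp_cost_cong) (use assms in force)
  then have "lp_optimal d (\<Union>i\<in>{1..k}. S i) = lp_optimal d' (\<Union>i\<in>{1..k}. S i)"
    unfolding lp_optimal_def by (intro ext) simp
  then show ?thesis
    unfolding exact_recovery_def by simp
qed

lemma exact_recovery_cong_sets:
  assumes "\<And>i. i \<in> {1..k} \<Longrightarrow> S i = S' i"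
  shows "exact_recovery d k S \<longleftrightarrow> exact_recovery d k S'"
proof -
  define K where "K = {1..k}"
  have *: "S i = S' i" if "i \<in> K" for i
    using assms that unfolding K_def by blast
  have P: "(\<Union>i\<in>K. S i) = (\<Union>i\<in>K. S' i)"
    using * by simp
  have A: "(\<forall>i\<in>K. \<exists>!p. p \<in> S i \<and> y p = 1) \<longleftrightarrow> (\<forall>i\<in>K. \<exists>!p. p \<in> S' i \<and> y p = 1)" for y :: "'a \<Rightarrow> real"
    by (rule ball_cong) (simp_all add: *)
  have B: "(\<exists>i\<in>K. p \<in> S i \<and> q \<in> S i) \<longleftrightarrow> (\<exists>i\<in>K. p \<in> S' i \<and> q \<in> S' i)" for p q
    by (rule bex_cong) (simp_all add: *)
  show ?thesis
    unfolding exact_recovery_def Let_def K_def[symmetric] P A B ..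
qed

text \<open>Optimality and uniqueness together mean that every other feasible solution costs
  strictly more. In this form the optimum is compared with feasible solutions only, and feasibility
  does not depend on the distances.\<close>

lemma exact_recovery_iff_strict:
  "exact_recovery d k S \<longleftrightarrow> (let P = (\<Union>i\<in>{1..k}. S i) in
     \<exists>y z. (\<forall>y' z'. lp_feasible P k y' z' \<and> \<not> ((\<forall>p\<in>P. y' p = y p) \<and> (\<forall>p\<in>P. \<forall>q\<in>P. z' p q = z p q)) \<longrightarrow>
         lp_cost d P z < lp_cost d P z') \<and>
       ip_feasible P k y z \<and>
       (\<forall>i\<in>{1..k}. \<exists>!p. p \<in> S i \<and> y p = 1) \<and>
       (\<forall>p\<in>P. \<forall>q\<in>P. z p q = 1 \<longrightarrow> (\<exists>i\<in>{1..k}. p \<in> S i \<and> q \<in> S i)))"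
proof -
  have key: "lp_optimal d P k y z \<and> (\<forall>y' z'. lp_optimal d P k y' z' \<longrightarrow>
          (\<forall>p\<in>P. y' p = y p) \<and> (\<forall>p\<in>P. \<forall>q\<in>P. z' p q = z p q)) \<longleftrightarrow>
      (\<forall>y' z'. lp_feasible P k y' z' \<and> \<not> ((\<forall>p\<in>P. y' p = y p) \<and> (\<forall>p\<in>P. \<forall>q\<in>P. z' p q = z p q)) \<longrightarrow>
         lp_cost d P z < lp_cost d P z')" (is "?O \<longleftrightarrow> ?S")
    if "ip_feasible P k y z" for P y z
  proof
    have f: "lp_feasible P k y z"
      using that unfolding ip_feasible_def by blast
    show ?S if ?O
    proof (intro allI impI)
      fix y' z' assume *: "lp_feasible P k y' z' \<and> \<not> ((\<forall>p\<in>P. y' p = y p) \<and> (\<forall>p\<in>P. \<forall>q\<in>P. z' p q = z p q))"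
      have "\<not> lp_cost d P z' \<le> lp_cost d P z"
      proof
        assume "lp_cost d P z' \<le> lp_cost d P z"
        then have "lp_optimal d P k y' z'"
          using \<open>?O\<close> * unfolding lp_optimal_def by (meson order_trans)
        then show False using \<open>?O\<close> * by blast
      qed
      then show "lp_cost d P z < lp_cost d P z'" by simp
    qed
    show ?O if ?S
    proof
      show "lp_optimal d P k y z"
        unfolding lp_optimal_def
      proof (intro conjI f allI impI)
        fix y' z' assume f': "lp_feasible P k y' z'"
        show "lp_cost d P z \<le> lp_cost d P z'"
        proof (cases "(\<forall>p\<in>P. y' p = y p) \<and> (\<forall>p\<in>P. \<forall>q\<in>P. z' p q = z p q)")
          case True
          then have "lp_cost d P z = lp_cost d P z'" by (intro lp_cost_cong) simp
          then show ?thesis by simp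
        next
          case False
          then show ?thesis using \<open>?S\<close> f' by (meson less_imp_le)
        qed
      qed
      show "\<forall>y' z'. lp_optimal d P k y' z' \<longrightarrow>
          (\<forall>p\<in>P. y' p = y p) \<and> (\<forall>p\<in>P. \<forall>q\<in>P. z' p q = z p q)"
      proof (intro allI impI)
        fix y' z' assume "lp_optimal d P k y' z'"
        then have "lp_feasible P k y' z'" "\<not> lp_cost d P z < lp_cost d P z'"
          unfolding lp_optimal_def using f by (auto simp: not_less)
        then show "(\<forall>p\<in>P. y' p = y p) \<and> (\<forall>p\<in>P. \<forall>q\<in>P. z' p q = z p q)"
          using \<open>?S\<close> by blast
      qed
    qed
  qed
  have aux: "(A \<and> B \<and> E \<and> R) = (S \<and> E \<and> R)" if "E \<Longrightarrow> (A \<and> B) = S" for A B E R S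
    using that by blast
  show ?thesis
    unfolding exact_recovery_def Let_def by (intro ex_cong1, rule aux, erule key)
qed

text \<open>The required optimum is integral, so on the finite set \<open>P\<close> there are only
  finitely many candidates for it. The event is the finite union, over the candidates, of the sets
  in \<open>sets_unique_optimum\<close>.\<close>

lemma sets_exact_recovery:
  fixes T :: "nat \<Rightarrow> 'a :: countable set"
  assumes fin: "\<And>i. i \<in> {1..k} \<Longrightarrow> finite (T i)"
  shows "{D. exact_recovery (curry D) k T} \<in> sets (borel :: ('a \<times> 'a \<Rightarrow> real) measure)"
proof -
  define I where "I = {1..k}"
  define P where "P = (\<Union>i\<in>I. T i)"
  have finP: "finite P" unfolding P_def I_def using fin by auto
  define F where "F y z \<longleftrightarrow> ip_feasible P k y z \<and>
       (\<forall>i\<in>I. \<exists>!p. p \<in> T i \<and> y p = 1) \<and>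
       (\<forall>p\<in>P. \<forall>q\<in>P. z p q = 1 \<longrightarrow> (\<exists>i\<in>I. p \<in> T i \<and> q \<in> T i))" for y :: "'a \<Rightarrow> real" and z
  define U where "U y z = {D. \<forall>y' z'. lp_feasible P k y' z' \<and>
      \<not> ((\<forall>p\<in>P. y' p = y p) \<and> (\<forall>p\<in>P. \<forall>q\<in>P. z' p q = z p q)) \<longrightarrow> 0 < excess D P z z'}" for y z
  define C where "C = {(y, w) \<in> (P \<rightarrow>\<^sub>E {0, 1::real}) \<times> (P \<times> P \<rightarrow>\<^sub>E {0, 1::real}). F y (curry w)}"
  have "finite C"
    unfolding C_def by (rule finite_subset[of _ "(P \<rightarrow>\<^sub>E {0, 1}) \<times> (P \<times> P \<rightarrow>\<^sub>E {0, 1})"])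
      (auto intro!: finite_PiE finP)
  moreover have "U y (curry w) \<in> sets borel" if "(y, w) \<in> C" for y w
    unfolding U_def using that
    by (intro sets_unique_optimum finP) (auto simp: C_def F_def ip_feasible_def curry_def)
  ultimately have "(\<Union>(y, w)\<in>C. U y (curry w)) \<in> sets borel"
    by (intro sets.finite_UN) auto
  also have "(\<Union>(y, w)\<in>C. U y (curry w)) = {D. exact_recovery (curry D) k T}"
  proof -
    have er: "exact_recovery (curry D) k T \<longleftrightarrow> (\<exists>y z. D \<in> U y z \<and> F y z)" for D
      unfolding exact_recovery_iff_strict Let_def I_def[symmetric] P_def[symmetric] U_def F_def excess_def
      by simp
    have "\<exists>(y, w)\<in>C. D \<in> U y (curry w)" if "D \<in> U y z" "F y z" for D y z
    proof -
      let ?y = "restrict y P" and ?w = "restrict (case_prod z) (P \<times> P)"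
      have "lp_cost d P (curry ?w) = lp_cost d P z" for d
        by (intro lp_cost_cong) simp
      then have "U ?y (curry ?w) = U y z"
        unfolding U_def excess_def by simp
      moreover have "F ?y (curry ?w)"
      proof -
        have "lp_feasible P k ?y (curry ?w) \<longleftrightarrow> lp_feasible P k y z"
          by (intro lp_feasible_cong) auto
        moreover have "(\<exists>!p. p \<in> T i \<and> ?y p = 1) \<longleftrightarrow> (\<exists>!p. p \<in> T i \<and> y p = 1)" if "i \<in> I" for i
        proof -
          have "p \<in> T i \<and> ?y p = 1 \<longleftrightarrow> p \<in> T i \<and> y p = 1" for p
            using that unfolding P_def by auto
          then show ?thesis by simp
        qed
        ultimately show ?thesis
          using that(2) unfolding F_def ip_feasible_def by (simp cong: ball_cong)
      qed
      moreover have "?y \<in> P \<rightarrow>\<^sub>E {0, 1}" "?w \<in> P \<times> P \<rightarrow>\<^sub>E {0, 1}"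
        using that(2) unfolding F_def ip_feasible_def by auto
      ultimately have "(?y, ?w) \<in> C" "D \<in> U ?y (curry ?w)"
        using that(1) unfolding C_def by auto
      then show ?thesis by blast
    qed
    moreover have "F y (curry w)" if "(y, w) \<in> C" for y w
      using that unfolding C_def by simp
    ultimately show ?thesis
      unfolding er by fast
  qed
  finally show ?thesis .
qed

text \<open>
  Sample points may coincide, so the index set of the program varies with \<open>\<omega>\<close>. A map \<open>f\<close> that
  selects one index per sample point reduces the event to one over a fixed set of indices.
\<close>

lemma sets_exact_recovery_event:
  fixes d :: "'b \<Rightarrow> 'b \<Rightarrow> real" and I :: "'a :: countable set"
  assumes fin: "finite I" and T: "\<And>i. i \<in> {1..k} \<Longrightarrow> T i \<subseteq> I"
    and meas: "\<And>a b. a \<in> I \<Longrightarrow> b \<in> I \<Longrightarrow> (\<lambda>\<omega>. d (\<omega> a) (\<omega> b)) \<in> borel_measurable M"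
    and eq: "\<And>\<omega> a b. \<omega> \<in> space M \<Longrightarrow> a \<in> I \<Longrightarrow> b \<in> I \<Longrightarrow> d (\<omega> a) (\<omega> b) = 0 \<longleftrightarrow> \<omega> a = \<omega> b"
  shows "{\<omega>\<in>space M. exact_recovery d k (\<lambda>i. \<omega> ` T i)} \<in> sets M"
proof -
  \<comment> \<open>On \<open>G f\<close> the index \<open>f a\<close> represents the sample point
    \<open>\<omega> a\<close>, with equal points sharing a representative. Equality is phrased by
    vanishing distance, which is what \<open>meas\<close> makes measurable.\<close>
  define G where "G f = {\<omega>\<in>space M. (\<forall>a\<in>I. d (\<omega> (f a)) (\<omega> a) = 0) \<and>
      (\<forall>a\<in>I. \<forall>b\<in>I. d (\<omega> (f a)) (\<omega> (f b)) = 0 \<longrightarrow> f a = f b)}" for f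
  define H where "H f = {\<omega>\<in>space M. exact_recovery (\<lambda>a b. d (\<omega> a) (\<omega> b)) k (\<lambda>i. f ` T i)}" for f :: "'a \<Rightarrow> 'a"
  have G: "G f \<in> sets M" if f: "f \<in> I \<rightarrow>\<^sub>E I" for f
  proof -
    have [measurable]: "(\<lambda>\<omega>. d (\<omega> (f a)) (\<omega> a)) \<in> borel_measurable M"
      "(\<lambda>\<omega>. d (\<omega> (f a)) (\<omega> (f b))) \<in> borel_measurable M" if "a \<in> I" "b \<in> I" for a b
      using f that by (auto intro!: meas)
    show ?thesis
      unfolding G_def using fin by measurable
  qed
  have H: "H f \<in> sets M" if f: "f \<in> I \<rightarrow>\<^sub>E I" for f
  proof -
    \<comment> \<open>Set to 0 outside \<open>I\<close>, so that every coordinate is measurable;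
      since the index type is countable, this gives measurability into the function space.\<close>
    define D where "D \<omega> = (\<lambda>(a, b). if a \<in> I \<and> b \<in> I then d (\<omega> a) (\<omega> b) else 0)" for \<omega>
    have D: "D \<in> borel_measurable M"
    proof (rule measurable_coordinatewise_then_product)
      fix i
      show "(\<lambda>\<omega>. D \<omega> i) \<in> borel_measurable M"
        by (cases "fst i \<in> I \<and> snd i \<in> I") (auto simp: D_def split_beta intro!: meas)
    qed
    have fT: "f ` T i \<subseteq> I" if "i \<in> {1..k}" for i
      using f T[OF that] by auto
    have "exact_recovery (curry (D \<omega>)) k (\<lambda>i. f ` T i) \<longleftrightarrow>
        exact_recovery (\<lambda>a b. d (\<omega> a) (\<omega> b)) k (\<lambda>i. f ` T i)" for \<omega>
      by (rule exact_recovery_cong_dist) (use fT in \<open>auto simp: D_def subset_iff\<close>)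
    then have "H f = D -` {D. exact_recovery (curry D) k (\<lambda>i. f ` T i)} \<inter> space M"
      unfolding H_def by auto
    also have "\<dots> \<in> sets M"
      using fT fin by (intro measurable_sets[OF D] sets_exact_recovery) (meson finite_subset)
    finally show ?thesis .
  qed
  have *: "exact_recovery d k (\<lambda>i. \<omega> ` T i) \<longleftrightarrow> exact_recovery (\<lambda>a b. d (\<omega> a) (\<omega> b)) k (\<lambda>i. f ` T i)"
    if f: "f \<in> I \<rightarrow>\<^sub>E I" and \<omega>: "\<omega> \<in> G f" for f \<omega>
  proof -
    have sp: "\<omega> \<in> space M" using \<omega> unfolding G_def by blast
    have fI: "f a \<in> I" if "a \<in> I" for a using f that by auto
    have 1: "\<omega> (f a) = \<omega> a" if "a \<in> I" for a
      using \<omega> that eq[OF sp fI[OF that] that] unfolding G_def by blast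
    have inj: "inj_on \<omega> (f ` I)"
      using \<omega> eq[OF sp fI fI] unfolding G_def inj_on_def by auto
    have ff: "\<omega> ` f ` T i = \<omega> ` T i" if "i \<in> {1..k}" for i
      unfolding image_image using 1 T[OF that] by (intro image_cong) auto
    have "exact_recovery d k (\<lambda>i. \<omega> ` T i) \<longleftrightarrow> exact_recovery d k (\<lambda>i. \<omega> ` f ` T i)"
      by (rule exact_recovery_cong_sets) (simp add: ff)
    also have "\<dots> \<longleftrightarrow> exact_recovery (\<lambda>a b. d (\<omega> a) (\<omega> b)) k (\<lambda>i. f ` T i)"
      by (rule exact_recovery_image[OF inj]) (use T in auto)
    finally show ?thesis .
  qed
  have ex: "\<exists>f\<in>I \<rightarrow>\<^sub>E I. \<omega> \<in> G f" if \<omega>: "\<omega> \<in> space M" for \<omega>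
  proof -
    define f where "f = (\<lambda>a\<in>I. inv_into I \<omega> (\<omega> a))"
    have fI: "f a \<in> I" and 1: "\<omega> (f a) = \<omega> a" if "a \<in> I" for a
      using inv_into_into[of "\<omega> a" \<omega> I] f_inv_into_f[of "\<omega> a" \<omega> I] that unfolding f_def by simp_all
    have "f \<in> I \<rightarrow>\<^sub>E I"
      using fI unfolding f_def by auto
    moreover have "f a = f b" if "\<omega> a = \<omega> b" "a \<in> I" "b \<in> I" for a b
      using that unfolding f_def by simp
    note inj = this
    moreover have "\<omega> \<in> G f"
      unfolding G_def
    proof (intro CollectI conjI ballI impI \<omega>)
      fix a b assume a: "a \<in> I" "b \<in> I"
      show "d (\<omega> (f a)) (\<omega> a) = 0"
        using eq[OF \<omega> fI a(1)] 1 a by simp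
      assume "d (\<omega> (f a)) (\<omega> (f b)) = 0"
      then show "f a = f b"
        using eq[OF \<omega> fI[OF a(1)] fI[OF a(2)]] 1[OF a(1)] 1[OF a(2)] inj[OF _ a] by metis
    qed
    ultimately show ?thesis by blast
  qed
  have "{\<omega>\<in>space M. exact_recovery d k (\<lambda>i. \<omega> ` T i)} = (\<Union>f\<in>I \<rightarrow>\<^sub>E I. G f \<inter> H f)"
  proof (intro equalityI subsetI)
    fix \<omega> assume \<omega>: "\<omega> \<in> {\<omega>\<in>space M. exact_recovery d k (\<lambda>i. \<omega> ` T i)}"
    then obtain f where "f \<in> I \<rightarrow>\<^sub>E I" "\<omega> \<in> G f"
      using ex by blast
    then show "\<omega> \<in> (\<Union>f\<in>I \<rightarrow>\<^sub>E I. G f \<inter> H f)"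
      using \<omega> *[of f \<omega>] unfolding H_def by blast
  next
    fix \<omega> assume "\<omega> \<in> (\<Union>f\<in>I \<rightarrow>\<^sub>E I. G f \<inter> H f)"
    then obtain f where f: "f \<in> I \<rightarrow>\<^sub>E I" "\<omega> \<in> G f" "\<omega> \<in> H f"
      by blast
    then show "\<omega> \<in> {\<omega>\<in>space M. exact_recovery d k (\<lambda>i. \<omega> ` T i)}"
      using *[OF f(1,2)] unfolding H_def by blast
  qed
  also have "\<dots> \<in> sets M"
    using G H fin by (intro sets.finite_UN finite_PiE sets.Int) auto
  finally show ?thesis .
qed

section \<open>Isotropic measures on a ball\<close>

lemma eucl_dist_commute: "eucl_dist m x y = eucl_dist m y x"
  by (rule Metric_space.commute[OF Metric_space_eucl])

lemma eucl_dist_nonneg [simp]: "0 \<le> eucl_dist m x y"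
  by (rule Metric_space.nonneg[OF Metric_space_eucl])

lemma eucl_dist_triangle: "eucl_dist m x z \<le> eucl_dist m x y + eucl_dist m y z"
proof -
  have "eucl_dist m x z = L2_set (\<lambda>i. (x i - y i) + (y i - z i)) {..<m}"
    by (simp add: eucl_dist_def)
  also have "\<dots> \<le> eucl_dist m x y + eucl_dist m y z"
    unfolding eucl_dist_def by (rule L2_set_triangle_ineq)
  finally show ?thesis .
qed

lemma eucl_dist_sq: "(eucl_dist m x y)\<^sup>2 = (\<Sum>i<m. (x i - y i)\<^sup>2)"
  unfolding eucl_dist_def L2_set_def by (simp add: sum_nonneg)

lemma eucl_dist_eq_0: "x \<in> eucl m \<Longrightarrow> y \<in> eucl m \<Longrightarrow> eucl_dist m x y = 0 \<longleftrightarrow> x = y"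
  by (rule Metric_space.zero[OF Metric_space_eucl])

lemma mem_eucl_cball: "x \<in> eucl_cball m c r \<longleftrightarrow> c \<in> eucl m \<and> x \<in> eucl m \<and> eucl_dist m x c \<le> r"
  by (auto simp: Metric_space.mcball_def[OF Metric_space_eucl] eucl_dist_commute)

lemma space_eucl_borel [simp]: "space (eucl_borel m) = eucl m"
  by (simp add: eucl_borel_def eucl_def space_PiM)

lemma measurable_eucl_component [measurable]:
  "i < m \<Longrightarrow> (\<lambda>x. x i) \<in> borel_measurable (eucl_borel m)"
  unfolding eucl_borel_def by measurable

lemma measurable_eucl_dist [measurable]: "(\<lambda>x. eucl_dist m x y) \<in> borel_measurable (eucl_borel m)"
  unfolding eucl_dist_def L2_set_def by measurable

lemma sets_eucl_cball:
  assumes "c \<in> eucl m"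
  shows "eucl_cball m c r \<in> sets (eucl_borel m)"
proof -
  have "eucl_cball m c r = {x \<in> space (eucl_borel m). eucl_dist m x c \<le> r}"
    using assms by (auto simp: mem_eucl_cball)
  also have "\<dots> \<in> sets (eucl_borel m)" by measurable
  finally show ?thesis .
qed

definition dotp :: "nat \<Rightarrow> (nat \<Rightarrow> real) \<Rightarrow> (nat \<Rightarrow> real) \<Rightarrow> (nat \<Rightarrow> real) \<Rightarrow> real" where
  "dotp m c x p = (\<Sum>i<m. (x i - c i) * (p i - c i))"

lemma eucl_dist_sq_dotp:
  "(eucl_dist m x p)\<^sup>2 = (eucl_dist m x c)\<^sup>2 + (eucl_dist m p c)\<^sup>2 - 2 * dotp m c x p"
  unfolding eucl_dist_sq dotp_def sum_distrib_left sum.distrib[symmetric] sum_subtractf[symmetric]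
  by (intro sum.cong) (auto simp: power2_eq_square algebra_simps)

lemma abs_dotp_le: "\<bar>dotp m c x p\<bar> \<le> eucl_dist m x c * eucl_dist m p c"
proof -
  have "\<bar>dotp m c x p\<bar> \<le> (\<Sum>i<m. \<bar>x i - c i\<bar> * \<bar>p i - c i\<bar>)"
    unfolding dotp_def abs_mult[symmetric] by (rule sum_abs)
  also have "\<dots> \<le> eucl_dist m x c * eucl_dist m p c"
    unfolding eucl_dist_def by (rule L2_set_mult_ineq)
  finally show ?thesis .
qed

lemma abs_component_le_eucl_dist: "i < m \<Longrightarrow> \<bar>x i - c i\<bar> \<le> eucl_dist m x c"
  unfolding eucl_dist_def using member_le_L2_set[of "{..<m}" i "\<lambda>i. \<bar>x i - c i\<bar>"]
  by (simp add: L2_set_def)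

text \<open>The rotation by a right angle in the plane of coordinates \<open>i\<close> and \<open>j\<close> is a signed transposition.\<close>

definition quarter_sgn :: "nat \<Rightarrow> nat \<Rightarrow> real" where
  "quarter_sgn j a = (if a = j then -1 else 1)"

definition quarter_swap :: "nat \<Rightarrow> nat \<Rightarrow> nat \<Rightarrow> nat" where
  "quarter_swap i j a = (if a = i then j else if a = j then i else a)"

lemma quarter_swap_swap [simp]: "quarter_swap i j (quarter_swap i j a) = a"
  by (simp add: quarter_swap_def)

lemma quarter_swap_less: "i < m \<Longrightarrow> j < m \<Longrightarrow> a < m \<Longrightarrow> quarter_swap i j a < m"
  by (simp add: quarter_swap_def)

lemma quarter_sgn_sq [simp]: "quarter_sgn j a * quarter_sgn j a = 1" "(quarter_sgn j a)\<^sup>2 = 1"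
  by (simp_all add: quarter_sgn_def)

definition quarter_mat :: "nat \<Rightarrow> nat \<Rightarrow> nat \<Rightarrow> real mat" where
  "quarter_mat m i j = multrow j (-1) (swaprows_mat m i j)"

lemma quarter_mat_index:
  assumes "i < m" "j < m" "i \<noteq> j" "a < m" "b < m"
  shows "quarter_mat m i j $$ (a, b) = (if b = quarter_swap i j a then quarter_sgn j a else 0)"
  using assms unfolding quarter_mat_def
  by (cases "a = i"; cases "a = j") (simp_all add: quarter_swap_def quarter_sgn_def)

text \<open>Swapping two rows has determinant -1 and negating one of them restores 1. The sign is
  what distinguishes a rotation from a reflection, for which no invariance is assumed.\<close>

lemma quarter_mat_SO:
  assumes "i < m" "j < m" "i \<noteq> j"
  shows "quarter_mat m i j \<in> SO m"
proof -
  let ?A = "quarter_mat m i j"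
  have c: "?A \<in> carrier_mat m m"
    unfolding quarter_mat_def by simp
  have "?A * transpose_mat ?A = 1\<^sub>m m"
  proof (rule eq_matI)
    fix a b assume "a < dim_row (1\<^sub>m m :: real mat)" "b < dim_col (1\<^sub>m m :: real mat)"
    then have ab: "a < m" "b < m" by auto
    have "(?A * transpose_mat ?A) $$ (a, b) = (\<Sum>l<m. ?A $$ (a, l) * ?A $$ (b, l))"
      using ab c by (auto simp: scalar_prod_def atLeast0LessThan intro!: sum.cong)
    also have "\<dots> = (\<Sum>l<m. if l = quarter_swap i j a then
        (if l = quarter_swap i j b then quarter_sgn j a * quarter_sgn j b else 0) else 0)"
      using assms ab by (intro sum.cong) (auto simp: quarter_mat_index)
    also have "\<dots> = (if a = b then 1 else 0)"
      using quarter_swap_less[OF assms(1,2) ab(1)]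
      by (auto simp: quarter_swap_def quarter_sgn_def split: if_splits)
    finally show "(?A * transpose_mat ?A) $$ (a, b) = (1\<^sub>m m) $$ (a, b)"
      using ab by simp
  qed (use c in auto)
  moreover have "Determinant.det ?A = 1"
    unfolding quarter_mat_def using assms
    by (subst det_multrow[OF \<open>j < m\<close>]) (auto simp: det_swaprows_mat)
  ultimately show ?thesis
    unfolding SO_def using c by simp
qed

lemma affine_about_quarter_mat:
  assumes "i < m" "j < m" "i \<noteq> j"
  shows "affine_about m c (quarter_mat m i j) x =
    (\<lambda>a\<in>{..<m}. c a + quarter_sgn j a * (x (quarter_swap i j a) - c (quarter_swap i j a)))"
  unfolding affine_about_def
proof (intro restrict_ext arg_cong2[where f = "(+)"] refl)
  fix a assume "a \<in> {..<m}"
  then have a: "a < m" by simp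
  have "(\<Sum>b<m. quarter_mat m i j $$ (a, b) * (x b - c b)) =
      (\<Sum>b<m. if b = quarter_swap i j a then quarter_sgn j a * (x b - c b) else 0)"
    using assms a by (intro sum.cong) (auto simp: quarter_mat_index)
  then show "(\<Sum>b<m. quarter_mat m i j $$ (a, b) * (x b - c b)) =
      quarter_sgn j a * (x (quarter_swap i j a) - c (quarter_swap i j a))"
    using quarter_swap_less[OF assms(1,2) a] by simp
qed

section \<open>Moments of a rotation-invariant measure\<close>

locale isotropic_ball = prob_space \<mu> for \<mu> :: "(nat \<Rightarrow> real) measure" +
  fixes m :: nat and c :: "nat \<Rightarrow> real"
  assumes m2: "m \<ge> 2" and center: "c \<in> eucl m"
    and sets_\<mu>: "sets \<mu> = sets (restrict_space (eucl_borel m) (eucl_cball m c 1))"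
    and rot: "rotation_invariant m c \<mu>"
begin

abbreviation \<rho> :: "(nat \<Rightarrow> real) \<Rightarrow> real" where "\<rho> x \<equiv> eucl_dist m x c"

lemma space_\<mu>: "space \<mu> = eucl_cball m c 1"
proof -
  have "space \<mu> = eucl_cball m c 1 \<inter> eucl m"
    using sets_eq_imp_space_eq[OF sets_\<mu>] by (simp add: space_restrict_space)
  also have "\<dots> = eucl_cball m c 1"
    using mem_eucl_cball by blast
  finally show ?thesis .
qed

lemma space_D: "x \<in> space \<mu> \<Longrightarrow> x \<in> eucl m" "x \<in> space \<mu> \<Longrightarrow> \<rho> x \<le> 1"
  by (auto simp: space_\<mu> mem_eucl_cball)

lemma measurable_\<mu>I: "f \<in> borel_measurable (eucl_borel m) \<Longrightarrow> f \<in> borel_measurable \<mu>"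
  using measurable_cong_sets[OF sets_\<mu> refl] measurable_restrict_space1 by blast

lemma measurable_comp_\<mu> [measurable]: "i < m \<Longrightarrow> (\<lambda>x. x i) \<in> borel_measurable \<mu>"
  by (rule measurable_\<mu>I) measurable

lemma measurable_dist_\<mu> [measurable]: "(\<lambda>x. eucl_dist m x p) \<in> borel_measurable \<mu>"
  by (rule measurable_\<mu>I) measurable

lemma measurable_dotp [measurable]: "(\<lambda>x. dotp m c x p) \<in> borel_measurable \<mu>"
  unfolding dotp_def
  by (intro borel_measurable_sum borel_measurable_times borel_measurable_diff measurable_comp_\<mu>) auto

lemma integrable_bounded:
  fixes f :: "(nat \<Rightarrow> real) \<Rightarrow> real"
  assumes "f \<in> borel_measurable \<mu>" "\<And>x. x \<in> space \<mu> \<Longrightarrow> \<bar>f x\<bar> \<le> K"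
  shows "integrable \<mu> f"
  using assms by (intro integrable_const_bound[where B = K]) (auto intro: AE_I2)

lemma quarter_turn:
  assumes ij: "i < m" "j < m" "i \<noteq> j"
  defines "R \<equiv> affine_about m c (quarter_mat m i j)"
  shows "R \<in> measurable \<mu> \<mu>" and "\<And>x. \<rho> (R x) = \<rho> x"
    and "\<And>x. R x i - c i = x j - c j" and "\<And>x. R x j - c j = - (x i - c i)"
    and "\<And>f :: _ \<Rightarrow> real. f \<in> borel_measurable \<mu> \<Longrightarrow> (\<integral>x. f (R x) \<partial>\<mu>) = (\<integral>x. f x \<partial>\<mu>)"
proof -
  have R: "R x = (\<lambda>a\<in>{..<m}. c a + quarter_sgn j a * (x (quarter_swap i j a) - c (quarter_swap i j a)))" for x
    unfolding R_def by (rule affine_about_quarter_mat[OF ij])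
  show \<rho>R: "\<rho> (R x) = \<rho> x" for x
  proof -
    have "(\<rho> (R x))\<^sup>2 = (\<Sum>a<m. (x (quarter_swap i j a) - c (quarter_swap i j a))\<^sup>2)"
      unfolding eucl_dist_sq R by (intro sum.cong) (auto simp: power_mult_distrib)
    also have "\<dots> = (\<Sum>a<m. (x a - c a)\<^sup>2)"
      by (rule sum.reindex_bij_witness[of _ "quarter_swap i j" "quarter_swap i j"])
        (auto intro: quarter_swap_less[OF ij(1,2)])
    finally show ?thesis
      unfolding eucl_dist_sq[symmetric] by simp
  qed
  show "R x i - c i = x j - c j" "R x j - c j = - (x i - c i)" for x
    using ij unfolding R by (simp_all add: quarter_sgn_def quarter_swap_def)
  have "R \<in> measurable \<mu> (restrict_space (eucl_borel m) (eucl_cball m c 1))"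
  proof (rule measurable_restrict_space2)
    show "R \<in> space \<mu> \<rightarrow> eucl_cball m c 1"
    proof
      fix x assume "x \<in> space \<mu>"
      moreover have "R x \<in> eucl m"
        unfolding R eucl_def by (rule restrict_PiE_iff[THEN iffD2]) simp
      ultimately show "R x \<in> eucl_cball m c 1"
        unfolding mem_eucl_cball using space_D(2)[of x] \<rho>R[of x] center by simp
    qed
    show "R \<in> measurable \<mu> (eucl_borel m)"
      unfolding R eucl_borel_def
    proof (rule measurable_restrict)
      fix a assume "a \<in> {..<m}"
      then have [measurable]: "(\<lambda>x. x (quarter_swap i j a)) \<in> borel_measurable \<mu>"
        using quarter_swap_less[OF ij(1,2)] by (intro measurable_comp_\<mu>) simp
      show "(\<lambda>x. c a + quarter_sgn j a * (x (quarter_swap i j a) - c (quarter_swap i j a))) \<in> borel_measurable \<mu>"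
        by measurable
    qed
  qed
  then show RM: "R \<in> measurable \<mu> \<mu>"
    using measurable_cong_sets[OF refl sets_\<mu>] by blast
  fix f :: "_ \<Rightarrow> real" assume f: "f \<in> borel_measurable \<mu>"
  have "distr \<mu> \<mu> R = \<mu>"
    using rot quarter_mat_SO[OF ij] unfolding rotation_invariant_def R_def by blast
  then show "(\<integral>x. f (R x) \<partial>\<mu>) = (\<integral>x. f x \<partial>\<mu>)"
    using integral_distr[OF RM f] by simp
qed

text \<open>A quarter turn keeps \<open>\<rho> x\<close>, and with it the weight. Applied twice it
  negates coordinate \<open>i\<close>; applied once it negates the product of coordinates
  \<open>i\<close> and \<open>j\<close>, and exchanges their squares.\<close>

lemma coordinate_moments:
  assumes [measurable]: "g \<in> borel_measurable borel" and ij: "i < m" "j < m" "i \<noteq> j"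
  shows "(\<integral>x. g (\<rho> x) * (x i - c i) \<partial>\<mu>) = 0"
    and "(\<integral>x. g (\<rho> x) * ((x i - c i) * (x j - c j)) \<partial>\<mu>) = 0"
    and "(\<integral>x. g (\<rho> x) * (x i - c i)\<^sup>2 \<partial>\<mu>) = (\<integral>x. g (\<rho> x) * (x j - c j)\<^sup>2 \<partial>\<mu>)"
proof -
  note [measurable] = measurable_comp_\<mu>[OF ij(1)] measurable_comp_\<mu>[OF ij(2)]
  note q = quarter_turn[OF ij]
  have "(\<integral>x. g (\<rho> x) * (x i - c i) \<partial>\<mu>) = (\<integral>x. g (\<rho> x) * (x j - c j) \<partial>\<mu>)"
    by (subst q(5)[symmetric]) (simp_all add: q(2,3))
  also have "\<dots> = (\<integral>x. - (g (\<rho> x) * (x i - c i)) \<partial>\<mu>)"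
    by (subst q(5)[symmetric]) (simp_all add: q(2,4) algebra_simps)
  finally show "(\<integral>x. g (\<rho> x) * (x i - c i) \<partial>\<mu>) = 0" by simp
  have "(\<integral>x. g (\<rho> x) * ((x i - c i) * (x j - c j)) \<partial>\<mu>) =
      (\<integral>x. - (g (\<rho> x) * ((x i - c i) * (x j - c j))) \<partial>\<mu>)"
    by (subst q(5)[symmetric]) (simp_all add: q(2,3,4) algebra_simps)
  then show "(\<integral>x. g (\<rho> x) * ((x i - c i) * (x j - c j)) \<partial>\<mu>) = 0" by simp
  show "(\<integral>x. g (\<rho> x) * (x i - c i)\<^sup>2 \<partial>\<mu>) = (\<integral>x. g (\<rho> x) * (x j - c j)\<^sup>2 \<partial>\<mu>)"
    by (subst q(5)[symmetric]) (simp_all add: q(2,3))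
qed

text \<open>In dimension one \<open>SO m\<close> is trivial; a quarter turn needs a second
  coordinate.\<close>

lemma ex_other_coordinate: "i < m \<Longrightarrow> \<exists>j<m. i \<noteq> j"
  using m2 by (intro exI[of _ "if i = 0 then 1 else 0"]) auto

lemma first_moment:
  assumes [measurable]: "g \<in> borel_measurable borel"
    and K: "\<And>t. 0 \<le> t \<Longrightarrow> t \<le> 1 \<Longrightarrow> \<bar>g t\<bar> * t \<le> K"
  shows "(\<integral>x. g (\<rho> x) * dotp m c x p \<partial>\<mu>) = 0"
proof -
  have int: "integrable \<mu> (\<lambda>x. g (\<rho> x) * (x i - c i))" if [simp]: "i < m" for i
  proof (rule integrable_bounded[where K = K])
    fix x assume x: "x \<in> space \<mu>"
    have "\<bar>g (\<rho> x) * (x i - c i)\<bar> \<le> \<bar>g (\<rho> x)\<bar> * \<rho> x"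
      unfolding abs_mult by (intro mult_left_mono abs_component_le_eucl_dist that) simp
    then show "\<bar>g (\<rho> x) * (x i - c i)\<bar> \<le> K"
      using K[of "\<rho> x"] space_D[OF x] by simp
  qed measurable
  have "(\<integral>x. g (\<rho> x) * dotp m c x p \<partial>\<mu>) = (\<integral>x. (\<Sum>i<m. (p i - c i) * (g (\<rho> x) * (x i - c i))) \<partial>\<mu>)"
    unfolding dotp_def sum_distrib_left by (simp add: mult_ac)
  also have "\<dots> = (\<Sum>i<m. (p i - c i) * (\<integral>x. g (\<rho> x) * (x i - c i) \<partial>\<mu>))"
    using int by (subst Bochner_Integration.integral_sum) auto
  also have "\<dots> = 0"
  proof (intro sum.neutral ballI)
    fix i assume "i \<in> {..<m}"
    then obtain j where "i < m" "j < m" "i \<noteq> j"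
      using ex_other_coordinate by auto
    then show "(p i - c i) * (\<integral>x. g (\<rho> x) * (x i - c i) \<partial>\<mu>) = 0"
      by (simp add: coordinate_moments(1)[OF assms(1)])
  qed
  finally show ?thesis .
qed

text \<open>The mixed moments vanish and the diagonal ones agree, so each of the latter is the
  \<open>m\<close>-th part of the weighted mean of \<open>(\<rho> x)^2\<close>. All terms of order
  \<open>1 / m\<close> in the later estimates come from here. The bound is put on
  \<open>g t * t^2\<close> instead of \<open>g t\<close> to admit the weights \<open>1 / t\<close>
  and \<open>1 / t^2\<close>, which blow up at the centre.\<close>

lemma second_moment:
  assumes [measurable]: "g \<in> borel_measurable borel"
    and K: "\<And>t. 0 \<le> t \<Longrightarrow> t \<le> 1 \<Longrightarrow> \<bar>g t\<bar> * t\<^sup>2 \<le> K"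
  shows "(\<integral>x. g (\<rho> x) * (dotp m c x p)\<^sup>2 \<partial>\<mu>) = (\<rho> p)\<^sup>2 / m * (\<integral>x. g (\<rho> x) * (\<rho> x)\<^sup>2 \<partial>\<mu>)"
proof -
  define h where "h i j x = g (\<rho> x) * ((x i - c i) * (x j - c j))" for i j x
  have int: "integrable \<mu> (h i j)" if [simp]: "i < m" "j < m" for i j
  proof (rule integrable_bounded[where K = K])
    fix x assume x: "x \<in> space \<mu>"
    have "\<bar>h i j x\<bar> \<le> \<bar>g (\<rho> x)\<bar> * (\<rho> x * \<rho> x)"
      unfolding abs_mult h_def by (intro mult_left_mono mult_mono abs_component_le_eucl_dist that) simp_all
    then show "\<bar>h i j x\<bar> \<le> K"
      using K[of "\<rho> x"] space_D[OF x] by (simp add: power2_eq_square)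
  qed (unfold h_def, measurable)
  define V where "V = integral\<^sup>L \<mu> (h 0 0)"
  have off: "integral\<^sup>L \<mu> (h i j) = 0" if "i < m" "j < m" "i \<noteq> j" for i j
    using coordinate_moments(2)[OF assms(1) that] unfolding h_def .
  have diag: "integral\<^sup>L \<mu> (h i i) = V" if "i < m" for i
  proof (cases "i = 0")
    case False
    then show ?thesis
      using coordinate_moments(3)[OF assms(1) that _ False] that
      unfolding h_def V_def by (simp add: power2_eq_square)
  qed (simp add: V_def)
  have "(\<integral>x. g (\<rho> x) * (\<rho> x)\<^sup>2 \<partial>\<mu>) = (\<integral>x. (\<Sum>i<m. h i i x) \<partial>\<mu>)"
    unfolding eucl_dist_sq[of m _ c] h_def sum_distrib_left by (simp add: power2_eq_square)
  also have "\<dots> = m * V"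
    using int diag by (subst Bochner_Integration.integral_sum) auto
  finally have 1: "(\<integral>x. g (\<rho> x) * (\<rho> x)\<^sup>2 \<partial>\<mu>) = m * V" .
  have "g (\<rho> x) * (dotp m c x p)\<^sup>2 = (\<Sum>i<m. \<Sum>j<m. (p i - c i) * (p j - c j) * h i j x)" for x
  proof -
    have "(dotp m c x p)\<^sup>2 = (\<Sum>i<m. \<Sum>j<m. ((x i - c i) * (p i - c i)) * ((x j - c j) * (p j - c j)))"
      unfolding dotp_def power2_eq_square by (rule sum_product)
    then show ?thesis
      unfolding h_def by (simp add: sum_distrib_left mult_ac)
  qed
  then have "(\<integral>x. g (\<rho> x) * (dotp m c x p)\<^sup>2 \<partial>\<mu>) =
      (\<integral>x. (\<Sum>i<m. \<Sum>j<m. (p i - c i) * (p j - c j) * h i j x) \<partial>\<mu>)"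
    by simp
  also have "\<dots> = (\<Sum>i<m. \<Sum>j<m. (p i - c i) * (p j - c j) * integral\<^sup>L \<mu> (h i j))"
  proof (subst Bochner_Integration.integral_sum)
    show "integrable \<mu> (\<lambda>x. \<Sum>j<m. (p i - c i) * (p j - c j) * h i j x)" if "i \<in> {..<m}" for i
      using int that by (intro Bochner_Integration.integrable_sum integrable_mult_right) auto
    show "(\<Sum>i<m. \<integral>x. (\<Sum>j<m. (p i - c i) * (p j - c j) * h i j x) \<partial>\<mu>) =
        (\<Sum>i<m. \<Sum>j<m. (p i - c i) * (p j - c j) * integral\<^sup>L \<mu> (h i j))"
      using int by (intro sum.cong refl, subst Bochner_Integration.integral_sum)
        (auto intro!: integrable_mult_right)
  qed
  also have "\<dots> = (\<Sum>i<m. \<Sum>j<m. if j = i then (p i - c i)\<^sup>2 * V else 0)"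
    using off diag by (intro sum.cong) (auto simp: power2_eq_square)
  also have "\<dots> = (\<rho> p)\<^sup>2 * V"
    unfolding eucl_dist_sq by (simp add: sum_distrib_right)
  finally show ?thesis
    using 1 m2 by simp
qed

end

section \<open>Visible budgets in the population\<close>

text \<open>With \<open>r = sqrt w\<close> and \<open>q = sqrt a\<close>, the difference of the two
  sides times \<open>2 * q^3\<close> factors as \<open>(r - q)^2 * (r^2 + 2 * r * q)\<close>.
  Taylor's formula has the coefficient 1/8 in place of 1/2; the value 1/2 is the smallest for which
  the bound reaches down to \<open>w = 0\<close>.\<close>

lemma sqrt_ge_quadratic:
  assumes "a > 0" "w \<ge> 0"
  shows "sqrt w \<ge> sqrt a + (w - a) / (2 * sqrt a) - (w - a)\<^sup>2 / (2 * (a * sqrt a))"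
proof -
  define r q where "r = sqrt w" and "q = sqrt a"
  have q: "q > 0" and r: "r \<ge> 0" and w: "w = r\<^sup>2" and a: "a = q\<^sup>2"
    using assms by (auto simp: r_def q_def)
  have "r * (2 * q ^ 3) - (2 * q ^ 3 * q + q\<^sup>2 * (r\<^sup>2 - q\<^sup>2) - (r\<^sup>2 - q\<^sup>2)\<^sup>2) = (r - q)\<^sup>2 * (r\<^sup>2 + 2 * r * q)"
    by (simp add: power2_eq_square power3_eq_cube algebra_simps)
  also have "\<dots> \<ge> 0"
    using q r by simp
  finally have "(2 * q ^ 3 * q + q\<^sup>2 * (r\<^sup>2 - q\<^sup>2) - (r\<^sup>2 - q\<^sup>2)\<^sup>2) / (2 * q ^ 3) \<le> r"
    using q by (simp add: pos_divide_le_eq)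
  moreover have "(2 * q ^ 3 * q + q\<^sup>2 * u - u\<^sup>2) / (2 * q ^ 3) = q + u / (2 * q) - u\<^sup>2 / (2 * (q\<^sup>2 * q))" for u
    using q by (simp add: add_divide_distrib diff_divide_distrib power2_eq_square power3_eq_cube)
  ultimately show ?thesis
    unfolding r_def[symmetric] q_def[symmetric] unfolding w a by simp
qed

text \<open>Here \<open>\<rho>\<close> is the distance of a ball point to the centre and
  \<open>d\<close> its distance to an observer at distance \<open>s\<close> from the centre. A gain
  \<open>d - \<rho>\<close> is at most \<open>s\<close>, and truncation at \<open>1 + \<eta>\<close>
  leaves room for at least \<open>\<eta>\<close> of it, hence the fraction \<open>l\<close>
  survives. A loss is not truncated and is charged separately.\<close>

lemma min_minus_ge:
  fixes \<rho> s d \<eta> :: real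
  assumes "0 \<le> \<rho>" "\<rho> \<le> 1" "0 < s" "0 < \<eta>" "d \<le> \<rho> + s"
  defines "l \<equiv> min 1 (\<eta> / s)"
  shows "min (1 + \<eta>) d - \<rho> \<ge> l * (d - \<rho>) - max 0 (\<rho> - d)"
proof -
  have l: "0 \<le> l" "l \<le> 1" "l * s \<le> \<eta>"
    using assms by (auto simp: l_def min_def field_simps)
  show ?thesis
  proof (cases "d < \<rho>")
    case True
    then have "l * (d - \<rho>) \<le> 0"
      using l by (simp add: mult_nonneg_nonpos)
    then show ?thesis using True assms(1-5) by linarith
  next
    case False
    have "l * (d - \<rho>) \<le> 1 * (d - \<rho>)"
      using l False by (intro mult_right_mono) auto
    moreover have "l * (d - \<rho>) \<le> l * s"
      using l assms by (intro mult_left_mono) auto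
    moreover have "\<eta> \<le> 1 + \<eta> - \<rho>"
      using assms(2) by simp
    ultimately have "l * (d - \<rho>) \<le> 1 + \<eta> - \<rho>" "l * (d - \<rho>) \<le> d - \<rho>"
      using l(3) by (meson order_trans, simp only: mult_1)
    then show ?thesis using False by (simp add: min_def)
  qed
qed

text \<open>Since \<open>\<rho>^2 - d^2 = 2 * D - s^2\<close>, the distance shrinks only when this
  is positive, and \<open>(D / s - s)^2 \<ge> 0\<close> bounds it by \<open>D^2 / s^2\<close>. With
  \<open>D\<close> the inner product of the two displacements, the bound is quadratic in
  \<open>D\<close>, so \<open>second_moment\<close> with weight \<open>1 / \<rho>\<close> evaluates
  its mean.\<close>

lemma norm_deficit_le:
  fixes \<rho> s d D :: real
  assumes "d\<^sup>2 = \<rho>\<^sup>2 + s\<^sup>2 - 2 * D" "0 \<le> \<rho>" "0 < s" "0 \<le> d"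
  shows "max 0 (\<rho> - d) \<le> inverse \<rho> * D\<^sup>2 / s\<^sup>2"
proof (cases "d < \<rho>")
  case True
  then have "\<rho> > 0" using assms by simp
  have "0 \<le> (D / s - s)\<^sup>2" by simp
  then have *: "2 * D - s\<^sup>2 \<le> D\<^sup>2 / s\<^sup>2"
    using assms by (simp add: power2_diff power_divide)
  have "(\<rho> - d) * \<rho> \<le> (\<rho> - d) * (\<rho> + d)"
    using True assms by (intro mult_left_mono) auto
  also have "\<dots> = 2 * D - s\<^sup>2"
    using assms(1) by (simp add: power2_eq_square algebra_simps)
  also note *
  finally have "(\<rho> - d) * \<rho> \<le> D\<^sup>2 / s\<^sup>2" .
  then have "\<rho> - d \<le> D\<^sup>2 / s\<^sup>2 / \<rho>"
    using \<open>\<rho> > 0\<close> by (simp only: pos_le_divide_eq)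
  also have "\<dots> = inverse \<rho> * D\<^sup>2 / s\<^sup>2"
    by (simp add: divide_inverse mult_ac)
  finally have "\<rho> - d \<le> inverse \<rho> * D\<^sup>2 / s\<^sup>2" .
  then show ?thesis using True by simp
qed (use assms in auto)

text \<open>The quantity \<open>y\<close> in the proof is the squared cosine of the angle at the
  centre. The distance from the observer to the line through the centre and the ball point gives
  \<open>d^2 \<ge> t^2 * (1 - y)\<close>, hence \<open>d \<ge> t * (1 - y)\<close> for
  \<open>y \<le> 1\<close>. When \<open>\<rho> = 0\<close> the convention
  \<open>inverse 0 = 0\<close> makes the right-hand side 0, and \<open>D = 0\<close> yields
  \<open>d = t \<ge> \<alpha>\<close>.\<close>

lemma truncated_deficit_le:
  fixes \<rho> t d D \<alpha> :: real
  assumes d: "d\<^sup>2 = \<rho>\<^sup>2 + t\<^sup>2 - 2 * D" and D: "\<rho> = 0 \<Longrightarrow> D = 0" and "0 \<le> \<rho>" "0 < \<alpha>" "\<alpha> \<le> t" "0 \<le> d"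
  shows "max 0 (\<alpha> - d) \<le> \<alpha> / t\<^sup>2 * (inverse (\<rho>\<^sup>2) * D\<^sup>2)"
proof (cases "\<rho> = 0")
  case True
  then have "d\<^sup>2 = t\<^sup>2" using d D by simp
  then have "d = t" using assms by (simp add: power2_eq_iff_nonneg)
  then show ?thesis using True assms by simp
next
  case False
  then have "\<rho> > 0" "t > 0" using assms by auto
  define y where "y = inverse (\<rho>\<^sup>2) * D\<^sup>2 / t\<^sup>2"
  have y0: "0 \<le> y" unfolding y_def by simp
  have "0 \<le> (D / \<rho> - \<rho>)\<^sup>2" by simp
  also have "\<dots> = D\<^sup>2 / \<rho>\<^sup>2 - 2 * D + \<rho>\<^sup>2"
    using \<open>\<rho> > 0\<close> by (simp add: power2_diff power_divide)
  also have "D\<^sup>2 / \<rho>\<^sup>2 = y * t\<^sup>2"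
    using \<open>t > 0\<close> by (simp add: y_def divide_inverse mult_ac)
  finally have "2 * D - \<rho>\<^sup>2 \<le> y * t\<^sup>2" by simp
  then have dy: "t\<^sup>2 - d\<^sup>2 \<le> y * t\<^sup>2"
    using d by simp
  have "\<alpha> - d \<le> \<alpha> * y"
  proof (cases "y \<le> 1")
    case True
    have "(t * (1 - y))\<^sup>2 \<le> t\<^sup>2 * (1 - y)"
    proof -
      have "(1 - y) * (1 - y) \<le> 1 * (1 - y)"
        using True y0 by (intro mult_right_mono) auto
      then show ?thesis
        by (simp add: power_mult_distrib power2_eq_square[of "1 - y"] mult_left_mono)
    qed
    also have "\<dots> \<le> d\<^sup>2" using dy by (simp add: algebra_simps)
    finally have "t * (1 - y) \<le> d"
      by (rule power2_le_imp_le) (use \<open>0 \<le> d\<close> in simp)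
    moreover have "\<alpha> * (1 - y) \<le> t * (1 - y)"
      using assms True by (intro mult_right_mono) auto
    ultimately show ?thesis by (simp add: algebra_simps)
  next
    case False
    then have "\<alpha> * 1 \<le> \<alpha> * y"
      using assms by (intro mult_left_mono) auto
    then show ?thesis using \<open>0 \<le> d\<close> by linarith
  qed
  moreover have "\<alpha> / t\<^sup>2 * (inverse (\<rho>\<^sup>2) * D\<^sup>2) = \<alpha> * y"
    unfolding y_def by simp
  moreover have "\<alpha> * y \<ge> 0" using y0 assms by simp
  ultimately show ?thesis by simp
qed

section \<open>Expected visible budget of one ball\<close>

context isotropic_ball
begin

lemma integrable_first:
  assumes [measurable]: "g \<in> borel_measurable borel"
    and K: "\<And>t. 0 \<le> t \<Longrightarrow> t \<le> 1 \<Longrightarrow> \<bar>g t\<bar> * t \<le> K"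
  shows "integrable \<mu> (\<lambda>x. g (\<rho> x) * dotp m c x p)"
proof (rule integrable_bounded[where K = "K * \<rho> p"])
  fix x assume x: "x \<in> space \<mu>"
  have "\<bar>g (\<rho> x) * dotp m c x p\<bar> \<le> \<bar>g (\<rho> x)\<bar> * (\<rho> x * \<rho> p)"
    unfolding abs_mult by (intro mult_left_mono abs_dotp_le) simp
  also have "\<dots> \<le> K * \<rho> p"
    using K[of "\<rho> x"] space_D[OF x] by (simp add: mult.assoc[symmetric] mult_right_mono)
  finally show "\<bar>g (\<rho> x) * dotp m c x p\<bar> \<le> K * \<rho> p" .
qed measurable

lemma integrable_second:
  assumes [measurable]: "g \<in> borel_measurable borel"
    and K: "\<And>t. 0 \<le> t \<Longrightarrow> t \<le> 1 \<Longrightarrow> \<bar>g t\<bar> * t\<^sup>2 \<le> K"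
  shows "integrable \<mu> (\<lambda>x. g (\<rho> x) * (dotp m c x p)\<^sup>2)"
proof (rule integrable_bounded[where K = "K * (\<rho> p)\<^sup>2"])
  fix x assume x: "x \<in> space \<mu>"
  have "\<bar>dotp m c x p\<bar>\<^sup>2 \<le> (\<rho> x * \<rho> p)\<^sup>2"
    by (intro power_mono abs_dotp_le) simp
  then have "\<bar>g (\<rho> x) * (dotp m c x p)\<^sup>2\<bar> \<le> \<bar>g (\<rho> x)\<bar> * ((\<rho> x)\<^sup>2 * (\<rho> p)\<^sup>2)"
    unfolding abs_mult by (intro mult_left_mono) (auto simp: power_mult_distrib)
  also have "\<dots> \<le> K * (\<rho> p)\<^sup>2"
    using K[of "\<rho> x"] space_D[OF x] by (simp add: mult.assoc[symmetric] mult_right_mono)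
  finally show "\<bar>g (\<rho> x) * (dotp m c x p)\<^sup>2\<bar> \<le> K * (\<rho> p)\<^sup>2" .
qed measurable

lemma dist_le_sum: "x \<in> space \<mu> \<Longrightarrow> eucl_dist m x p \<le> 1 + \<rho> p"
  using eucl_dist_triangle[of m x p c] space_D(2)[of x] eucl_dist_commute[of m c p] by simp

lemma integrable_dist [simp]: "integrable \<mu> (\<lambda>x. eucl_dist m x p)"
  by (rule integrable_bounded[where K = "1 + \<rho> p"]) (auto intro: dist_le_sum)

text \<open>The population counterpart, per sample point, of the budget that an observer at
  \<open>p\<close> sees in this ball.\<close>

definition \<Phi> :: "real \<Rightarrow> (nat \<Rightarrow> real) \<Rightarrow> real" where
  "\<Phi> \<alpha> p = (\<integral>x. max 0 (\<alpha> - eucl_dist m x p) \<partial>\<mu>)"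

definition mean_radius :: real where
  "mean_radius = (\<integral>x. \<rho> x \<partial>\<mu>)"

lemma integrable_min [simp]: "integrable \<mu> (\<lambda>x. min \<alpha> (eucl_dist m x p))"
proof (rule integrable_bounded[where K = "\<bar>\<alpha>\<bar> + (1 + \<rho> p)"])
  fix x assume "x \<in> space \<mu>"
  then show "\<bar>min \<alpha> (eucl_dist m x p)\<bar> \<le> \<bar>\<alpha>\<bar> + (1 + \<rho> p)"
    using dist_le_sum[of x p] eucl_dist_nonneg[of m x p] by linarith
qed measurable

lemma integrable_max [simp]: "integrable \<mu> (\<lambda>x. max 0 (\<alpha> - eucl_dist m x p))"
proof (rule integrable_bounded[where K = "\<bar>\<alpha>\<bar>"])
  fix x
  show "\<bar>max 0 (\<alpha> - eucl_dist m x p)\<bar> \<le> \<bar>\<alpha>\<bar>"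
    using eucl_dist_nonneg[of m x p] by linarith
qed measurable

lemma \<Phi>_eq: "\<Phi> \<alpha> p = \<alpha> - (\<integral>x. min \<alpha> (eucl_dist m x p) \<partial>\<mu>)"
proof -
  have "\<Phi> \<alpha> p = (\<integral>x. \<alpha> - min \<alpha> (eucl_dist m x p) \<partial>\<mu>)"
    unfolding \<Phi>_def by (intro Bochner_Integration.integral_cong) (auto simp: min_def)
  then show ?thesis by (simp add: prob_space)
qed

text \<open>The distance is expanded around \<open>q = sqrt ((\<rho> x)^2 + s^2)\<close>, its value
  for orthogonal displacements. As \<open>q\<close> depends on \<open>x\<close> only through
  \<open>\<rho> x\<close>, the linear term has mean 0, and by \<open>second_moment\<close> the
  quadratic term costs at most \<open>2 * s^2 / (m * q)\<close>. The gain
  \<open>q - \<rho> x\<close> is at least \<open>s^2 / (2 * q)\<close>; \<open>m \<ge> 8\<close>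
  spends at most half of it, and \<open>q \<le> 3 / 2\<close> turns the rest into
  \<open>s^2 / 6\<close>.\<close>

lemma mean_dist_ge:
  assumes m8: "m \<ge> 8" and s: "0 < \<rho> p" "\<rho> p \<le> 1"
  shows "(\<integral>x. eucl_dist m x p \<partial>\<mu>) \<ge> mean_radius + (\<rho> p)\<^sup>2 / 6"
proof -
  define s where "s = \<rho> p"
  have s01: "0 < s" "s \<le> 1" using s by (simp_all add: s_def)
  define W where "W t = t\<^sup>2 + s\<^sup>2" for t :: real
  have W: "W t > 0" "sqrt (W t) > 0" for t
    using s01 by (auto simp: W_def add_nonneg_pos)
  have W_le: "sqrt (W t) \<le> 3 / 2" if "0 \<le> t" "t \<le> 1" for t
  proof -
    have "t\<^sup>2 \<le> 1" "s\<^sup>2 \<le> 1" using that s01 by (auto simp: power_le_one)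
    then have "W t \<le> (3 / 2)\<^sup>2" unfolding W_def by (simp add: power2_eq_square)
    then show ?thesis by (intro real_le_lsqrt) (use W[of t] in auto)
  qed
  have W_ge: "t \<le> sqrt (W t)" "s \<le> sqrt (W t)" if "0 \<le> t" for t
    using that s01 unfolding W_def by (auto intro!: real_le_rsqrt)
  define g1 where "g1 t = 1 / sqrt (W t)" for t
  define g2 where "g2 t = 2 / (W t * sqrt (W t))" for t
  have [measurable]: "W \<in> borel_measurable borel" unfolding W_def by measurable
  have g[measurable]: "g1 \<in> borel_measurable borel" "g2 \<in> borel_measurable borel"
    unfolding g1_def g2_def by measurable
  have K1: "\<bar>g1 t\<bar> * t \<le> 1" if "0 \<le> t" for t
    using W[of t] W_ge(1)[OF that] by (simp add: g1_def)
  have g2_sq: "g2 t * t\<^sup>2 \<le> 2 / sqrt (W t)" for t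
  proof -
    have "g2 t * t\<^sup>2 = 2 / sqrt (W t) * (t\<^sup>2 / W t)" by (simp add: g2_def)
    also have "\<dots> \<le> 2 / sqrt (W t) * 1"
      using W[of t] by (intro mult_left_mono) (auto simp: W_def)
    finally show ?thesis by simp
  qed
  have K2: "\<bar>g2 t\<bar> * t\<^sup>2 \<le> 2 / s" if "0 \<le> t" for t
  proof -
    have "2 / sqrt (W t) \<le> 2 / s"
      using W_ge(2)[OF that] s01 by (intro frac_le) auto
    then show ?thesis using g2_sq[of t] W[of t] by (simp add: g2_def)
  qed
  let ?D = "\<lambda>x. dotp m c x p"
  have lower: "eucl_dist m x p \<ge> sqrt (W (\<rho> x)) - g1 (\<rho> x) * ?D x - g2 (\<rho> x) * (?D x)\<^sup>2" for x
  proof -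
    have d: "(eucl_dist m x p)\<^sup>2 - W (\<rho> x) = - 2 * ?D x"
      unfolding eucl_dist_sq_dotp[of m x p c] W_def s_def by simp
    have "eucl_dist m x p = sqrt ((eucl_dist m x p)\<^sup>2)" by simp
    also have "\<dots> \<ge> sqrt (W (\<rho> x)) + (- 2 * ?D x) / (2 * sqrt (W (\<rho> x)))
        - (- 2 * ?D x)\<^sup>2 / (2 * (W (\<rho> x) * sqrt (W (\<rho> x))))"
      unfolding d[symmetric] by (rule sqrt_ge_quadratic) (use W in auto)
    finally show ?thesis
      unfolding g1_def g2_def by (simp add: power_mult_distrib)
  qed
  have upper: "\<rho> x + s\<^sup>2 / 6 \<le> sqrt (W (\<rho> x)) - s\<^sup>2 / m * (g2 (\<rho> x) * (\<rho> x)\<^sup>2)"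
    if x: "x \<in> space \<mu>" for x
  proof -
    define q where "q = sqrt (W (\<rho> x))"
    have q: "q > 0" "q \<le> 3 / 2" "\<rho> x \<le> q" "q\<^sup>2 = (\<rho> x)\<^sup>2 + s\<^sup>2"
      using W W_le space_D(2)[OF x] W_ge less_imp_le[OF W(1)] unfolding q_def by (auto simp: W_def)
    have "s\<^sup>2 / m * (g2 (\<rho> x) * (\<rho> x)\<^sup>2) \<le> s\<^sup>2 / m * (2 / q)"
      using g2_sq unfolding q_def by (intro mult_left_mono) auto
    also have "\<dots> \<le> s\<^sup>2 / 8 * (2 / q)"
      using m8 q by (intro mult_right_mono divide_left_mono) auto
    finally have 1: "s\<^sup>2 / m * (g2 (\<rho> x) * (\<rho> x)\<^sup>2) \<le> s\<^sup>2 / (4 * q)" by simp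
    have "s\<^sup>2 = (q - \<rho> x) * (q + \<rho> x)"
      using q(4) by (simp add: power2_eq_square algebra_simps)
    also have "\<dots> \<le> (q - \<rho> x) * (2 * q)"
      using q by (intro mult_left_mono) auto
    finally have 2: "s\<^sup>2 / (2 * q) \<le> q - \<rho> x"
      using q by (simp add: field_simps)
    have "s\<^sup>2 / 6 \<le> s\<^sup>2 / (4 * q)"
      using q by (intro divide_left_mono) auto
    moreover have "s\<^sup>2 / (2 * q) = s\<^sup>2 / (4 * q) + s\<^sup>2 / (4 * q)" by simp
    ultimately show ?thesis using 1 2 unfolding q_def[symmetric] by linarith
  qed
  have intW: "integrable \<mu> (\<lambda>x. sqrt (W (\<rho> x)))"
    by (rule integrable_bounded[where K = "3 / 2"])
      (use W_le space_D less_imp_le[OF W(2)] in \<open>auto simp: abs_of_nonneg\<close>)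
  have int2: "integrable \<mu> (\<lambda>x. g2 (\<rho> x) * (\<rho> x)\<^sup>2)"
    by (rule integrable_bounded[where K = "2 / s"]) (use K2 in \<open>auto simp: abs_mult\<close>)
  have i1: "integrable \<mu> (\<lambda>x. g1 (\<rho> x) * ?D x)"
    by (rule integrable_first[OF g(1) K1])
  have i2: "integrable \<mu> (\<lambda>x. g2 (\<rho> x) * (?D x)\<^sup>2)"
    by (rule integrable_second[OF g(2) K2])
  have "mean_radius + s\<^sup>2 / 6 = (\<integral>x. \<rho> x + s\<^sup>2 / 6 \<partial>\<mu>)"
    unfolding mean_radius_def by (simp add: prob_space)
  also have "\<dots> \<le> (\<integral>x. sqrt (W (\<rho> x)) - s\<^sup>2 / m * (g2 (\<rho> x) * (\<rho> x)\<^sup>2) \<partial>\<mu>)"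
    using upper intW int2 by (intro integral_mono) auto
  also have "\<dots> = (\<integral>x. sqrt (W (\<rho> x)) - g1 (\<rho> x) * ?D x - g2 (\<rho> x) * (?D x)\<^sup>2 \<partial>\<mu>)"
    using intW int2 i1 i2 first_moment[OF g(1) K1, of p] second_moment[OF g(2) K2, of p]
    by (simp add: s_def)
  also have "\<dots> \<le> (\<integral>x. eucl_dist m x p \<partial>\<mu>)"
    using lower intW i1 i2 by (intro integral_mono) auto
  finally show ?thesis unfolding s_def .
qed

text \<open>All points of the ball lie within \<open>1 + \<rho> p \<le> 1 + \<eta>\<close> of
  \<open>p\<close>, so the truncation never acts.\<close>

lemma \<Phi>_own_near:
  assumes "m \<ge> 8" "0 < \<rho> p" "\<rho> p \<le> 1" "\<rho> p \<le> \<eta>"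
  shows "\<Phi> (1 + \<eta>) p \<le> 1 + \<eta> - mean_radius - (\<rho> p)\<^sup>2 / 6"
proof -
  have "(\<integral>x. min (1 + \<eta>) (eucl_dist m x p) \<partial>\<mu>) = (\<integral>x. eucl_dist m x p \<partial>\<mu>)"
  proof (intro Bochner_Integration.integral_cong refl)
    fix x assume "x \<in> space \<mu>"
    then show "min (1 + \<eta>) (eucl_dist m x p) = eucl_dist m x p"
      using dist_le_sum[of x p] assms by linarith
  qed
  then show ?thesis
    unfolding \<Phi>_eq using mean_dist_ge[OF assms(1-3)] by simp
qed

text \<open>By \<open>min_minus_ge\<close> the truncation keeps the fraction
  \<open>min 1 (\<eta> / \<rho> p)\<close> of the gain in \<open>mean_dist_ge\<close>. The charge
  for shrinking distances is bounded in \<open>norm_deficit_le\<close>, whose right-hand side has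
  mean at most \<open>1 / m\<close>.\<close>

lemma \<Phi>_own_far:
  assumes m8: "m \<ge> 8" and s: "0 < \<rho> p" "\<rho> p \<le> 1" and \<eta>: "0 < \<eta>"
  shows "\<Phi> (1 + \<eta>) p \<le> 1 + \<eta> - mean_radius - min 1 (\<eta> / \<rho> p) * ((\<rho> p)\<^sup>2 / 6) + 1 / m"
proof -
  define l where "l = min 1 (\<eta> / \<rho> p)"
  have l0: "0 \<le> l" using s \<eta> by (simp add: l_def)
  let ?D = "\<lambda>x. dotp m c x p"
  have inv_meas: "(inverse :: real \<Rightarrow> real) \<in> borel_measurable borel" by measurable
  have K: "\<bar>inverse t\<bar> * t\<^sup>2 \<le> 1" if "0 \<le> t" "t \<le> 1" for t :: real
    using that by (cases "t = 0") (auto simp: power2_eq_square mult.assoc[symmetric])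
  have i2: "integrable \<mu> (\<lambda>x. inverse (\<rho> x) * (?D x)\<^sup>2)"
    by (rule integrable_second[OF inv_meas K])
  have i2': "integrable \<mu> (\<lambda>x. inverse (\<rho> x) * (\<rho> x)\<^sup>2)"
    by (rule integrable_bounded[where K = 1]) (use K space_D in \<open>auto simp: abs_mult\<close>)
  have "(\<integral>x. inverse (\<rho> x) * (\<rho> x)\<^sup>2 \<partial>\<mu>) \<le> (\<integral>x. 1 \<partial>\<mu>)"
    using i2' K space_D by (intro integral_mono) (auto simp: abs_of_nonneg)
  moreover have "(\<integral>x. 1 \<partial>\<mu>) = (1 :: real)" by (simp add: prob_space)
  ultimately have I1: "(\<integral>x. inverse (\<rho> x) * (\<rho> x)\<^sup>2 \<partial>\<mu>) \<le> 1"
    by (rule ord_le_eq_trans)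
  have "(\<integral>x. inverse (\<rho> x) * (?D x)\<^sup>2 / (\<rho> p)\<^sup>2 \<partial>\<mu>) =
      (\<rho> p)\<^sup>2 / m * (\<integral>x. inverse (\<rho> x) * (\<rho> x)\<^sup>2 \<partial>\<mu>) / (\<rho> p)\<^sup>2"
    by (simp only: integral_divide_zero second_moment[OF inv_meas K])
  also have "\<dots> = (\<integral>x. inverse (\<rho> x) * (\<rho> x)\<^sup>2 \<partial>\<mu>) / m"
    using s by simp
  also have "\<dots> \<le> 1 / m"
    using I1 by (intro divide_right_mono) auto
  finally have le1: "(\<integral>x. inverse (\<rho> x) * (?D x)\<^sup>2 / (\<rho> p)\<^sup>2 \<partial>\<mu>) \<le> 1 / m" .
  have "mean_radius + l * ((\<rho> p)\<^sup>2 / 6) - 1 / m \<le>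
      mean_radius + l * ((\<integral>x. eucl_dist m x p \<partial>\<mu>) - mean_radius) - (\<integral>x. inverse (\<rho> x) * (?D x)\<^sup>2 / (\<rho> p)\<^sup>2 \<partial>\<mu>)"
    using mean_dist_ge[OF m8 s] le1 l0 by (intro diff_mono add_mono mult_left_mono) auto
  also have "\<dots> = (\<integral>x. \<rho> x + l * (eucl_dist m x p - \<rho> x) - inverse (\<rho> x) * (?D x)\<^sup>2 / (\<rho> p)\<^sup>2 \<partial>\<mu>)"
    using i2 unfolding mean_radius_def by simp
  also have "\<dots> \<le> (\<integral>x. min (1 + \<eta>) (eucl_dist m x p) \<partial>\<mu>)"
  proof (rule integral_mono)
    fix x assume x: "x \<in> space \<mu>"
    have "eucl_dist m x p \<le> \<rho> x + \<rho> p"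
      using eucl_dist_triangle[of m x p c] eucl_dist_commute[of m c p] by simp
    then have "min (1 + \<eta>) (eucl_dist m x p) - \<rho> x \<ge>
        l * (eucl_dist m x p - \<rho> x) - max 0 (\<rho> x - eucl_dist m x p)"
      unfolding l_def using space_D(2)[OF x] s \<eta> by (intro min_minus_ge) auto
    moreover have "max 0 (\<rho> x - eucl_dist m x p) \<le> inverse (\<rho> x) * (?D x)\<^sup>2 / (\<rho> p)\<^sup>2"
      using s by (intro norm_deficit_le eucl_dist_sq_dotp) auto
    ultimately show "\<rho> x + l * (eucl_dist m x p - \<rho> x) - inverse (\<rho> x) * (?D x)\<^sup>2 / (\<rho> p)\<^sup>2
        \<le> min (1 + \<eta>) (eucl_dist m x p)" by linarith
  qed (use i2 in simp_all)
  finally show ?thesis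
    unfolding \<Phi>_eq l_def by simp
qed

text \<open>The mean of the squared cosine of the angle between \<open>x - c\<close> and the fixed
  direction \<open>p - c\<close> is at most \<open>1 / m\<close>, and
  \<open>truncated_deficit_le\<close> bounds the visible budget by \<open>\<alpha>\<close> times
  that squared cosine.\<close>

lemma \<Phi>_other:
  assumes \<alpha>: "0 < \<alpha>" "\<alpha> \<le> \<rho> p"
  shows "\<Phi> \<alpha> p \<le> \<alpha> / m"
proof -
  let ?D = "\<lambda>x. dotp m c x p"
  let ?g = "\<lambda>t :: real. inverse (t\<^sup>2)"
  have g: "?g \<in> borel_measurable borel" by measurable
  have K: "\<bar>?g t\<bar> * t\<^sup>2 \<le> 1" for t :: real
    by (cases "t = 0") auto
  have i2: "integrable \<mu> (\<lambda>x. ?g (\<rho> x) * (?D x)\<^sup>2)"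
    by (rule integrable_second[OF g K])
  have i2': "integrable \<mu> (\<lambda>x. ?g (\<rho> x) * (\<rho> x)\<^sup>2)"
    by (rule integrable_bounded[where K = 1]) (use K in \<open>auto simp: abs_mult\<close>)
  have "(\<integral>x. ?g (\<rho> x) * (\<rho> x)\<^sup>2 \<partial>\<mu>) \<le> (\<integral>x. 1 \<partial>\<mu>)"
    using i2' K by (intro integral_mono) (auto simp: abs_of_nonneg)
  then have le1: "(\<integral>x. ?g (\<rho> x) * (\<rho> x)\<^sup>2 \<partial>\<mu>) \<le> 1" by (simp add: prob_space)
  have "\<Phi> \<alpha> p \<le> (\<integral>x. \<alpha> / (\<rho> p)\<^sup>2 * (?g (\<rho> x) * (?D x)\<^sup>2) \<partial>\<mu>)"
    unfolding \<Phi>_def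
  proof (rule integral_mono)
    fix x
    have "?D x = 0" if "\<rho> x = 0" using abs_dotp_le[of m c x p] that by simp
    then show "max 0 (\<alpha> - eucl_dist m x p) \<le> \<alpha> / (\<rho> p)\<^sup>2 * (?g (\<rho> x) * (?D x)\<^sup>2)"
      using \<alpha> by (intro truncated_deficit_le eucl_dist_sq_dotp) auto
  qed (use i2 in simp_all)
  also have "\<dots> = \<alpha> / (\<rho> p)\<^sup>2 * ((\<rho> p)\<^sup>2 / m * (\<integral>x. ?g (\<rho> x) * (\<rho> x)\<^sup>2 \<partial>\<mu>))"
    using second_moment[OF g K, of p] by simp
  also have "\<dots> = \<alpha> / m * (\<integral>x. ?g (\<rho> x) * (\<rho> x)\<^sup>2 \<partial>\<mu>)"
    using \<alpha> by simp
  also have "\<dots> \<le> \<alpha> / m * 1"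
    using le1 \<alpha> by (intro mult_left_mono) auto
  finally show ?thesis by simp
qed

lemma \<Phi>_other_far:
  assumes "1 + \<alpha> \<le> \<rho> p"
  shows "\<Phi> \<alpha> p = 0"
proof -
  have "max 0 (\<alpha> - eucl_dist m x p) = 0" if "x \<in> space \<mu>" for x
    using eucl_dist_triangle[of m p c x] space_D(2)[OF that] eucl_dist_commute[of m x p] assms by simp
  then show ?thesis
    unfolding \<Phi>_def by (subst Bochner_Integration.integral_cong[OF refl]) auto
qed

end

section \<open>Ties are null events\<close>

text \<open>Fubini, with coordinate \<open>j\<close> integrated first. Asking only for a null
  superset of each section lets the coordinate be treated with exceptional sets that are convenient
  to name.\<close>

lemma (in product_sigma_finite) PiM_null_setI:
  assumes fin: "finite I" and j: "j \<in> I" and B: "B \<in> sets (PiM I M)"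
    and null: "\<And>\<omega>. \<omega> \<in> space (PiM (I - {j}) M) \<Longrightarrow>
      \<exists>Z\<in>null_sets (M j). {x\<in>space (M j). fun_upd \<omega> j x \<in> B} \<subseteq> Z"
  shows "B \<in> null_sets (PiM I M)"
proof -
  have I: "insert j (I - {j}) = I" using j by auto
  have "emeasure (PiM I M) B = (\<integral>\<^sup>+ \<omega>. indicator B \<omega> \<partial>PiM (insert j (I - {j})) M)"
    unfolding I using B by simp
  also have "\<dots> = (\<integral>\<^sup>+ \<omega>. (\<integral>\<^sup>+ x. indicator B (fun_upd \<omega> j x) \<partial>M j) \<partial>PiM (I - {j}) M)"
    using fin B by (intro product_nn_integral_insert) (simp_all only: I borel_measurable_indicator, auto)
  also have "\<dots> = (\<integral>\<^sup>+ \<omega>. 0 \<partial>PiM (I - {j}) M)"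
  proof (intro nn_integral_cong)
    fix \<omega> assume \<omega>: "\<omega> \<in> space (PiM (I - {j}) M)"
    obtain Z where Z: "Z \<in> null_sets (M j)" "{x\<in>space (M j). fun_upd \<omega> j x \<in> B} \<subseteq> Z"
      using null[OF \<omega>] by blast
    have "(\<integral>\<^sup>+ x. indicator B (fun_upd \<omega> j x) \<partial>M j) \<le> (\<integral>\<^sup>+ x. indicator Z x \<partial>M j)"
      using Z(2) by (intro nn_integral_mono) (auto simp: indicator_def)
    also have "\<dots> = 0"
      using Z(1) by (subst nn_integral_indicator) auto
    finally show "(\<integral>\<^sup>+ x. indicator B (fun_upd \<omega> j x) \<partial>M j) = 0" by simp
  qed
  finally show ?thesis using B by auto
qed

section \<open>Hyperplanes and level sets of distance differences\<close>

interpretation lborel_prod: product_sigma_finite "\<lambda>_ :: nat. lborel :: real measure"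
  by standard

lemma sets_eucl_lborel: "sets (eucl_lborel m) = sets (eucl_borel m)"
  unfolding eucl_lborel_def eucl_borel_def by (intro sets_PiM_cong) auto

lemma hyperplane_null:
  assumes "i < m"
  shows "{x\<in>eucl m. x i = a} \<in> null_sets (eucl_lborel m)"
  unfolding eucl_lborel_def
proof (rule lborel_prod.PiM_null_setI[of _ i])
  have "{x \<in> space (eucl_borel m). x i = a} \<in> sets (eucl_borel m)"
    using assms by measurable
  then show "{x\<in>eucl m. x i = a} \<in> sets (Pi\<^sub>M {..<m} (\<lambda>_. lborel))"
    using sets_eucl_lborel[of m] unfolding eucl_lborel_def by simp
  fix \<omega> :: "nat \<Rightarrow> real"
  show "\<exists>Z\<in>null_sets lborel. {x \<in> space lborel. fun_upd \<omega> i x \<in> {x \<in> eucl m. x i = a}} \<subseteq> Z"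
    by (rule bexI[of _ "{a}"]) (auto intro: finite_imp_null_set_lborel)
qed (use assms in auto)

text \<open>
  On a line parallel to a coordinate axis the difference of two distances takes each value finitely
  often: squaring twice turns the equation into a quadratic one.
\<close>

lemma finite_sqrt_difference_level:
  fixes p q b1 b2 a :: real
  assumes "p \<noteq> q" "b1 \<ge> 0" "b2 > 0"
  shows "finite {t. sqrt ((t - p)\<^sup>2 + b1) - sqrt ((t - q)\<^sup>2 + b2) = a}"
proof -
  define e where "e = p\<^sup>2 + b1 - a\<^sup>2 - q\<^sup>2 - b2"
  define P where "P = [:e, 2 * (q - p):]\<^sup>2 - [:4 * a\<^sup>2:] * ([:- q, 1:]\<^sup>2 + [:b2:])"
  have poly_P: "poly P t = (e + 2 * (q - p) * t)\<^sup>2 - 4 * a\<^sup>2 * ((t - q)\<^sup>2 + b2)" for t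
    unfolding P_def by (simp add: algebra_simps)
  \<comment> \<open>For \<open>a = 0\<close> the polynomial is the square of a non-constant linear
    form, evaluated where the form is 1. For \<open>a \<noteq> 0\<close> the evaluation point is the
    zero of that form, where the remaining term is negative because \<open>b2 > 0\<close>.\<close>
  have "\<exists>t. poly P t \<noteq> 0"
  proof (cases "a = 0")
    case True
    have "e + 2 * (q - p) * ((1 - e) / (2 * (q - p))) = 1"
      using assms by (simp add: field_simps)
    then have "poly P ((1 - e) / (2 * (q - p))) = 1"
      unfolding poly_P True by simp
    then show ?thesis by (metis zero_neq_one)
  next
    case False
    have 0: "e + 2 * (q - p) * (- e / (2 * (q - p))) = 0"
      using assms by (simp add: field_simps)
    have "poly P (- e / (2 * (q - p))) < 0"
      unfolding poly_P 0 using False assms by (simp add: add_nonneg_pos)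
    then show ?thesis by (metis less_irrefl)
  qed
  then have "P \<noteq> 0" by auto
  have "poly P t = 0" if "sqrt ((t - p)\<^sup>2 + b1) - sqrt ((t - q)\<^sup>2 + b2) = a" for t
  proof -
    define S where "S = sqrt ((t - q)\<^sup>2 + b2)"
    have S: "S\<^sup>2 = (t - q)\<^sup>2 + b2" unfolding S_def using assms by simp
    have "(sqrt ((t - p)\<^sup>2 + b1))\<^sup>2 = (a + S)\<^sup>2"
      using that unfolding S_def by (simp add: algebra_simps)
    then have "(t - p)\<^sup>2 + b1 = (a + S)\<^sup>2"
      using assms by simp
    then have "e + 2 * (q - p) * t = 2 * a * S"
      using S unfolding e_def by (simp add: power2_eq_square algebra_simps)
    then have "poly P t = (2 * a * S)\<^sup>2 - 4 * a\<^sup>2 * S\<^sup>2"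
      unfolding poly_P S by simp
    then show ?thesis by (simp add: power_mult_distrib)
  qed
  then have "{t. sqrt ((t - p)\<^sup>2 + b1) - sqrt ((t - q)\<^sup>2 + b2) = a} \<subseteq> {t. poly P t = 0}" by blast
  then show ?thesis
    using poly_roots_finite[OF \<open>P \<noteq> 0\<close>] finite_subset by blast
qed

text \<open>Fubini along the axis of coordinate 0. The hypothesis \<open>p 0 \<noteq> q 0\<close>
  supplies distinct centres on the line, and \<open>x 1 \<noteq> q 1\<close> makes the line miss
  \<open>q\<close>, which gives the positive \<open>b2\<close>.\<close>

lemma dist_difference_level_null:
  assumes m: "m \<ge> 2" and pq: "p 0 \<noteq> q 0"
  shows "{x\<in>eucl m. eucl_dist m x p - eucl_dist m x q = a \<and> x 1 \<noteq> q 1} \<in> null_sets (eucl_lborel m)"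
    (is "?B \<in> _")
  unfolding eucl_lborel_def
proof (rule lborel_prod.PiM_null_setI[of _ 0])
  have [measurable]: "(\<lambda>x. x 1) \<in> borel_measurable (eucl_borel m)"
    by (rule measurable_eucl_component) (use m in simp)
  have "{x \<in> space (eucl_borel m). eucl_dist m x p - eucl_dist m x q = a \<and> x 1 \<noteq> q 1} \<in> sets (eucl_borel m)"
    by measurable
  then show "?B \<in> sets (Pi\<^sub>M {..<m} (\<lambda>_. lborel))"
    using sets_eucl_lborel[of m] unfolding eucl_lborel_def by simp
  fix \<omega> :: "nat \<Rightarrow> real"
  let ?A = "{t \<in> space lborel. fun_upd \<omega> 0 t \<in> ?B}"
  define b where "b r = (\<Sum>i\<in>{1..<m}. (\<omega> i - r i)\<^sup>2)" for r
  have dist: "eucl_dist m (fun_upd \<omega> 0 t) r = sqrt ((t - r 0)\<^sup>2 + b r)" for t r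
  proof -
    have "{..<m} = insert 0 {1..<m}" using m by auto
    then show ?thesis unfolding eucl_dist_def L2_set_def b_def by simp
  qed
  have "finite ?A"
  proof (cases "\<omega> 1 = q 1")
    case True
    then show ?thesis by simp
  next
    case False
    have "(\<omega> 1 - q 1)\<^sup>2 \<le> b q"
      unfolding b_def using m by (intro member_le_sum) auto
    then have "b q > 0" using False
      by (smt (verit) eq_iff_diff_eq_0 zero_less_power2)
    moreover have "b p \<ge> 0" unfolding b_def by (simp add: sum_nonneg)
    ultimately show ?thesis
      using finite_sqrt_difference_level[OF pq, of "b p" "b q" a]
      by (rule_tac finite_subset[rotated]) (auto simp: dist)
  qed
  then show "\<exists>Z\<in>null_sets lborel. ?A \<subseteq> Z" using finite_imp_null_set_lborel by blast
qed (use m in auto)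

text \<open>The assumptions range over all indices because \<open>product_prob_space\<close> asks
  for a probability space at each of them. A model given on \<open>{1..k}\<close> is extended by
  repeating its first ball.\<close>

locale ball_model =
  fixes m k :: nat and c :: "nat \<Rightarrow> nat \<Rightarrow> real" and \<mu> :: "nat \<Rightarrow> (nat \<Rightarrow> real) measure"
  assumes iso: "\<And>i. isotropic_ball (\<mu> i) m (c i)"
    and null: "\<And>i. null_on_lebesgue_null m (c i) 1 (\<mu> i)"
    and pos: "\<And>i. positive_near_center m (c i) 1 (\<mu> i)"
begin

lemma m2: "m \<ge> 2"
  using isotropic_ball.m2[OF iso] .

lemma prob_\<mu>: "prob_space (\<mu> i)"
  using iso unfolding isotropic_ball_def by blast

definition N :: "nat \<times> nat \<Rightarrow> (nat \<Rightarrow> real) measure" where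
  "N a = \<mu> (fst a)"

definition idx :: "nat \<Rightarrow> (nat \<times> nat) set" where
  "idx n = {1..k} \<times> {1..n}"

abbreviation M :: "nat \<Rightarrow> (nat \<times> nat \<Rightarrow> nat \<Rightarrow> real) measure" where
  "M n \<equiv> PiM (idx n) N"

lemma finite_idx [simp]: "finite (idx n)"
  unfolding idx_def by simp

sublocale prod: product_prob_space N
  by (rule product_prob_spaceI) (simp add: N_def prob_\<mu>)

lemma prob_N: "prob_space (N a)"
  by (simp add: N_def prob_\<mu>)

lemma prob_M: "prob_space (M n)"
  by (rule prob_space_PiM) (simp add: prob_N)

lemma space_M: "\<omega> \<in> space (M n) \<Longrightarrow> a \<in> idx n \<Longrightarrow> \<omega> a \<in> space (N a)"
  by (auto simp: space_PiM)

lemma space_N: "x \<in> space (N a) \<longleftrightarrow> x \<in> eucl m \<and> eucl_dist m x (c (fst a)) \<le> 1"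
  unfolding N_def isotropic_ball.space_\<mu>[OF iso] mem_eucl_cball
  using isotropic_ball.center[OF iso] by simp

lemma measurable_sample_component:
  assumes "a \<in> idx n" "i < m"
  shows "(\<lambda>\<omega>. \<omega> a i) \<in> borel_measurable (M n)"
proof -
  have "(\<lambda>\<omega>. \<omega> a) \<in> measurable (M n) (N a)"
    using assms by measurable
  moreover have "(\<lambda>x. x i) \<in> borel_measurable (N a)"
    unfolding N_def by (rule isotropic_ball.measurable_comp_\<mu>[OF iso assms(2)])
  ultimately show ?thesis
    using measurable_compose by blast
qed

lemma measurable_sample_dist:
  assumes "a \<in> idx n" "b \<in> idx n"
  shows "(\<lambda>\<omega>. eucl_dist m (\<omega> a) (\<omega> b)) \<in> borel_measurable (M n)"
proof -
  have [measurable]: "(\<lambda>\<omega>. \<Sum>i<m. (\<omega> a i - \<omega> b i)\<^sup>2) \<in> borel_measurable (M n)"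
    by (intro borel_measurable_sum borel_measurable_power borel_measurable_diff
        measurable_sample_component assms) auto
  show ?thesis
    unfolding eucl_dist_def L2_set_def by measurable
qed

lemma null_N:
  assumes "{x\<in>eucl m. P x} \<in> null_sets (eucl_lborel m)"
  shows "{x\<in>space (N a). P x} \<in> null_sets (N a)"
proof -
  let ?c = "c (fst a)"
  have "{x\<in>space (N a). P x} = {x\<in>eucl m. P x} \<inter> eucl_cball m ?c 1"
    using isotropic_ball.center[OF iso] by (auto simp: space_N mem_eucl_cball)
  moreover have "\<dots> \<in> null_sets (eucl_lborel m)"
    using assms sets_eucl_cball[OF isotropic_ball.center[OF iso], of "fst a" 1]
    by (intro null_set_Int2) (simp_all add: sets_eucl_lborel)
  ultimately show ?thesis
    using null[of "fst a"] unfolding null_on_lebesgue_null_def N_def by auto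
qed

definition tie :: "nat \<Rightarrow> nat \<Rightarrow> nat \<times> nat \<Rightarrow> nat \<times> nat \<Rightarrow> (nat \<times> nat \<Rightarrow> nat \<Rightarrow> real) set" where
  "tie n i a b = {\<omega>\<in>space (M n). (\<Sum>l\<in>{1..n}. eucl_dist m (\<omega> (i, l)) (\<omega> a)) =
      (\<Sum>l\<in>{1..n}. eucl_dist m (\<omega> (i, l)) (\<omega> b))}"

text \<open>Three samples leave an index \<open>e\<close> other than \<open>a\<close> and
  \<open>b\<close>. With all other points frozen, a tie places the point at \<open>e\<close> on a
  level set of the difference of its distances to two fixed points. The coincidences
  \<open>?B1\<close> and \<open>?B2\<close> of single coordinates are split off first, since that
  level set is known to be null only away from them.\<close>

lemma tie_null:
  assumes n: "n \<ge> 3" and ab: "a \<in> {i} \<times> {1..n}" "b \<in> {i} \<times> {1..n}" "a \<noteq> b" and i: "i \<in> {1..k}"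
  shows "tie n i a b \<in> null_sets (M n)"
proof -
  have "card {snd a, snd b} \<le> 2"
    by (simp add: card_insert_if)
  then have "\<not> {1..n} \<subseteq> {snd a, snd b}"
    using n card_mono[of "{snd a, snd b}" "{1..n}"] by auto
  then obtain l where "l \<in> {1..n}" "l \<noteq> snd a" "l \<noteq> snd b"
    by blast
  then have l: "l \<in> {1..n}" "(i, l) \<noteq> a" "(i, l) \<noteq> b"
    by auto
  define e where "e = (i, l)"
  have idx: "a \<in> idx n" "b \<in> idx n" "e \<in> idx n" "\<And>l. l \<in> {1..n} \<Longrightarrow> (i, l) \<in> idx n"
    using ab i l unfolding idx_def e_def by auto
  note [measurable] = measurable_sample_component[OF idx(1)] measurable_sample_component[OF idx(2)]
    measurable_sample_component[OF idx(3)] measurable_sample_dist[OF idx(4) idx(1)] measurable_sample_dist[OF idx(4) idx(2)]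
  define S where "S r \<omega> = (\<Sum>l\<in>{1..n}. eucl_dist m (\<omega> (i, l)) (\<omega> r))" for r :: "nat \<times> nat" and \<omega>
  have [measurable]: "S a \<in> borel_measurable (M n)" "S b \<in> borel_measurable (M n)"
    unfolding S_def by (intro borel_measurable_sum measurable_sample_dist idx; simp)+
  have [simp]: "0 < m" "Suc 0 < m" using m2 by auto
  let ?B1 = "{\<omega>\<in>space (M n). \<omega> a 0 = \<omega> b 0}"
  let ?B2 = "{\<omega>\<in>space (M n). \<omega> e 1 = \<omega> b 1}"
  let ?B3 = "{\<omega>\<in>space (M n). S a \<omega> = S b \<omega> \<and> \<omega> a 0 \<noteq> \<omega> b 0 \<and> \<omega> e 1 \<noteq> \<omega> b 1}"
  have B1: "?B1 \<in> null_sets (M n)"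
  proof (rule prod.PiM_null_setI[OF finite_idx idx(1)])
    show "?B1 \<in> sets (M n)" by measurable
    fix \<omega> :: "nat \<times> nat \<Rightarrow> nat \<Rightarrow> real"
    have "{x \<in> space (N a). x 0 = \<omega> b 0} \<in> null_sets (N a)"
      by (intro null_N hyperplane_null) simp
    then show "\<exists>Z\<in>null_sets (N a). {x \<in> space (N a). fun_upd \<omega> a x \<in> ?B1} \<subseteq> Z"
      by (rule bexI[rotated]) (use ab in auto)
  qed
  have B2: "?B2 \<in> null_sets (M n)"
  proof (rule prod.PiM_null_setI[OF finite_idx idx(3)])
    show "?B2 \<in> sets (M n)" by measurable
    fix \<omega> :: "nat \<times> nat \<Rightarrow> nat \<Rightarrow> real"
    have "{x \<in> space (N e). x 1 = \<omega> b 1} \<in> null_sets (N e)"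
      by (intro null_N hyperplane_null) simp
    then show "\<exists>Z\<in>null_sets (N e). {x \<in> space (N e). fun_upd \<omega> e x \<in> ?B2} \<subseteq> Z"
      by (rule bexI[rotated]) (use l in \<open>auto simp: e_def\<close>)
  qed
  have B3: "?B3 \<in> null_sets (M n)"
  proof (rule prod.PiM_null_setI[OF finite_idx idx(3)])
    have "?B3 = {\<omega>\<in>space (M n). S a \<omega> = S b \<omega>} - ?B1 - ?B2" by blast
    moreover have "\<dots> \<in> sets (M n)"
      using B1 B2 by (intro sets.Diff) (auto simp: borel_measurable_eq)
    ultimately show "?B3 \<in> sets (M n)" by simp
    fix \<omega> :: "nat \<times> nat \<Rightarrow> nat \<Rightarrow> real"
    define s where "s r = (\<Sum>l\<in>{1..n} - {l}. eucl_dist m (\<omega> (i, l)) r)" for r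
    have sum: "(\<Sum>l\<in>{1..n}. eucl_dist m (fun_upd \<omega> e x (i, l)) r) = eucl_dist m x r + s r" for x r
    proof -
      have "(\<Sum>l\<in>{1..n}. eucl_dist m (fun_upd \<omega> e x (i, l)) r) =
          eucl_dist m (fun_upd \<omega> e x (i, l)) r + (\<Sum>l\<in>{1..n} - {l}. eucl_dist m (fun_upd \<omega> e x (i, l)) r)"
        using l by (intro sum.remove) auto
      also have "(\<Sum>l\<in>{1..n} - {l}. eucl_dist m (fun_upd \<omega> e x (i, l)) r) = s r"
        unfolding s_def by (intro sum.cong) (auto simp: e_def)
      finally show ?thesis by (simp add: e_def)
    qed
    have ne: "fun_upd \<omega> e x a = \<omega> a" "fun_upd \<omega> e x b = \<omega> b" for x
      using l by (auto simp: e_def)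
    show "\<exists>Z\<in>null_sets (N e). {x \<in> space (N e). fun_upd \<omega> e x \<in> ?B3} \<subseteq> Z"
    proof (cases "\<omega> a 0 = \<omega> b 0")
      case True
      then show ?thesis by (intro bexI[of _ "{}"]) (use l in \<open>auto simp: e_def\<close>)
    next
      case False
      let ?Z = "{x \<in> space (N e). eucl_dist m x (\<omega> a) - eucl_dist m x (\<omega> b) = s (\<omega> b) - s (\<omega> a) \<and> x 1 \<noteq> \<omega> b 1}"
      have "?Z \<in> null_sets (N e)"
        by (intro null_N dist_difference_level_null m2 False)
      moreover have "{x \<in> space (N e). fun_upd \<omega> e x \<in> ?B3} \<subseteq> ?Z"
        unfolding mem_Collect_eq S_def ne sum by (auto simp: algebra_simps)
      ultimately show ?thesis by blast
    qed
  qed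
  have tie: "tie n i a b = {\<omega>\<in>space (M n). S a \<omega> = S b \<omega>}"
    unfolding tie_def S_def ..
  have "tie n i a b \<in> sets (M n)"
    unfolding tie by measurable
  moreover have "tie n i a b \<subseteq> ?B1 \<union> ?B2 \<union> ?B3"
    unfolding tie by blast
  moreover have "?B1 \<union> ?B2 \<union> ?B3 \<in> null_sets (M n)"
    using B1 B2 B3 by (intro null_sets.Un)
  ultimately show ?thesis
    using null_sets_subset by blast
qed

end

section \<open>Concentration and the certificate of a sample\<close>

context ball_model
begin

definition samp_mean :: "nat \<Rightarrow> nat \<Rightarrow> ((nat \<Rightarrow> real) \<Rightarrow> real) \<Rightarrow> (nat \<times> nat \<Rightarrow> nat \<Rightarrow> real) \<Rightarrow> real" where
  "samp_mean n j f \<omega> = (\<Sum>l\<in>{1..n}. f (\<omega> (j, l))) / n"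

lemma samp_mean_mono:
  assumes "\<And>l. l \<in> {1..n} \<Longrightarrow> f (\<omega> (j, l)) \<le> g (\<omega> (j, l))"
  shows "samp_mean n j f \<omega> \<le> samp_mean n j g \<omega>"
  unfolding samp_mean_def using assms by (intro divide_right_mono sum_mono) auto

lemma samp_mean_add_const:
  "n > 0 \<Longrightarrow> samp_mean n j (\<lambda>x. f x + e) \<omega> = samp_mean n j f \<omega> + e"
  unfolding samp_mean_def by (simp add: sum.distrib add_divide_distrib)

lemma indep_vars_sample:
  assumes "idx n \<noteq> {}"
  shows "prob_space.indep_vars (M n) N (\<lambda>a \<omega>. \<omega> a) (idx n)"
proof -
  interpret P: prob_space "M n" by (rule prob_M)
  have "distr (M n) (\<Pi>\<^sub>M a\<in>idx n. N a) (\<lambda>\<omega>. \<lambda>a\<in>idx n. \<omega> a) = distr (M n) (M n) (\<lambda>\<omega>. \<omega>)"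
    by (intro distr_cong) (auto simp: space_PiM PiE_def extensional_restrict)
  also have "\<dots> = (\<Pi>\<^sub>M a\<in>idx n. distr (M n) (N a) (\<lambda>\<omega>. \<omega> a))"
    unfolding distr_id using prob_N by (intro PiM_cong refl distr_PiM_component[symmetric]) auto
  finally show ?thesis
    using assms by (subst P.indep_vars_iff_distr_eq_PiM') auto
qed

definition deviation :: "nat \<Rightarrow> nat \<Rightarrow> ((nat \<Rightarrow> real) \<Rightarrow> real) \<Rightarrow> real \<Rightarrow> (nat \<times> nat \<Rightarrow> nat \<Rightarrow> real) set" where
  "deviation n j f \<epsilon> = {\<omega>\<in>space (M n). \<epsilon> \<le> \<bar>samp_mean n j f \<omega> - integral\<^sup>L (\<mu> j) f\<bar>}"

lemma measurable_sample_fun: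
  assumes f: "f \<in> borel_measurable (\<mu> j)" and "j \<in> {1..k}" "l \<in> {1..n}"
  shows "(\<lambda>\<omega>. f (\<omega> (j, l))) \<in> borel_measurable (M n)"
proof -
  have "(\<lambda>\<omega>. \<omega> (j, l)) \<in> measurable (M n) (N (j, l))"
    using assms by (intro measurable_component_singleton) (simp add: idx_def)
  moreover have "f \<in> borel_measurable (N (j, l))"
    using f by (simp add: N_def)
  ultimately show ?thesis
    using measurable_compose by blast
qed

lemma measurable_samp_mean:
  assumes "f \<in> borel_measurable (\<mu> j)" "j \<in> {1..k}"
  shows "samp_mean n j f \<in> borel_measurable (M n)"
  unfolding samp_mean_def
  by (intro borel_measurable_divide borel_measurable_sum measurable_sample_fun[OF assms]) auto

lemma sets_deviation:
  assumes "f \<in> borel_measurable (\<mu> j)" "j \<in> {1..k}"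
  shows "deviation n j f \<epsilon> \<in> sets (M n)"
proof -
  note [measurable] = measurable_samp_mean[OF assms]
  show ?thesis unfolding deviation_def by measurable
qed

text \<open>Hoeffding's inequality for \<open>n\<close> independent variables in an interval of
  length \<open>2 * K\<close>: the exponent \<open>2 * (n * \<epsilon>)^2 / (n * (2 * K)^2)\<close>
  is linear in \<open>n\<close>, so the bound decays geometrically.\<close>

lemma deviation_bound:
  assumes f: "f \<in> borel_measurable (\<mu> j)" and K: "\<And>x. x \<in> space (\<mu> j) \<Longrightarrow> \<bar>f x\<bar> \<le> K" and K0: "K > 0"
    and j: "j \<in> {1..k}" and \<epsilon>: "\<epsilon> > 0" and n: "n > 0"
  shows "measure (M n) (deviation n j f \<epsilon>) \<le> 2 * exp (- (\<epsilon>\<^sup>2 / (2 * K\<^sup>2))) ^ n"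
proof -
  interpret P: prob_space "M n" by (rule prob_M)
  have idx: "(j, l) \<in> idx n" if "l \<in> {1..n}" for l
    using that j by (simp add: idx_def)
  then have ne: "idx n \<noteq> {}" using n by fastforce
  define I where "I = {j} \<times> {1..n}"
  have sumI: "(\<Sum>a\<in>I. h a) = (\<Sum>l\<in>{1..n}. h (j, l))" for h :: "_ \<Rightarrow> real"
  proof -
    have "I = Pair j ` {1..n}" unfolding I_def by auto
    then show ?thesis by (simp add: sum.reindex inj_on_def)
  qed
  have I: "I \<subseteq> idx n" unfolding I_def using idx by auto
  define X where "X a \<omega> = f (\<omega> a)" for a :: "nat \<times> nat" and \<omega> :: "nat \<times> nat \<Rightarrow> nat \<Rightarrow> real"
  have "P.indep_vars N (\<lambda>a \<omega>. \<omega> a) I"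
    by (rule P.indep_vars_subset[OF indep_vars_sample[OF ne] I])
  then have indep: "P.indep_vars (\<lambda>_. borel) X I"
    unfolding X_def by (rule P.indep_vars_compose2) (use f in \<open>auto simp: N_def I_def\<close>)
  have bnd: "X a \<omega> \<in> {- K..K}" if "a \<in> I" "\<omega> \<in> space (M n)" for a \<omega>
  proof -
    have "\<omega> a \<in> space (\<mu> j)"
      using space_M[OF that(2)] I that(1) unfolding N_def I_def by auto
    then show ?thesis
      using K[of "\<omega> a"] unfolding X_def by (auto simp: abs_le_iff)
  qed
  interpret H: Hoeffding_ineq "M n" I X "\<lambda>_. - K" "\<lambda>_. K" "\<Sum>a\<in>I. P.expectation (X a)"
    by unfold_locales (use indep bnd in \<open>auto intro: AE_I2 simp: I_def\<close>)
  have exp: "P.expectation (X a) = integral\<^sup>L (\<mu> j) f" if "a \<in> I" for a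
  proof -
    have a: "a \<in> idx n" "N a = \<mu> j" using I that by (auto simp: N_def I_def)
    have "integral\<^sup>L (\<mu> j) f = integral\<^sup>L (distr (M n) (N a) (\<lambda>\<omega>. \<omega> a)) f"
      using distr_PiM_component[of "idx n" N a] prob_N a by simp
    also have "\<dots> = P.expectation (X a)"
      unfolding X_def using f a
      by (intro integral_distr measurable_component_singleton) auto
    finally show ?thesis by simp
  qed
  have sq: "(\<Sum>a\<in>I. (K - - K)\<^sup>2) = n * (4 * K\<^sup>2)"
    unfolding sumI by (simp add: power2_eq_square)
  have dev: "deviation n j f \<epsilon> =
      {\<omega>\<in>space (M n). n * \<epsilon> \<le> \<bar>(\<Sum>a\<in>I. X a \<omega>) - (\<Sum>a\<in>I. P.expectation (X a))\<bar>}"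
  proof -
    have "(\<Sum>a\<in>I. P.expectation (X a)) = n * integral\<^sup>L (\<mu> j) f"
      using exp by (simp add: I_def)
    moreover have "(\<Sum>a\<in>I. X a \<omega>) = n * samp_mean n j f \<omega>" for \<omega>
      unfolding sumI samp_mean_def X_def using n by simp
    ultimately have "(\<Sum>a\<in>I. X a \<omega>) - (\<Sum>a\<in>I. P.expectation (X a)) =
        n * (samp_mean n j f \<omega> - integral\<^sup>L (\<mu> j) f)" for \<omega>
      by (simp add: right_diff_distrib)
    then show ?thesis
      unfolding deviation_def using n by (simp add: abs_mult)
  qed
  have "measure (M n) (deviation n j f \<epsilon>) \<le> 2 * exp (- 2 * (n * \<epsilon>)\<^sup>2 / (\<Sum>a\<in>I. (K - - K)\<^sup>2))"
  proof -
    have "(\<Sum>a\<in>I. (K - - K)\<^sup>2) > 0"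
      unfolding sq using n K0 by simp
    then show ?thesis
      unfolding dev using \<epsilon> by (intro H.Hoeffding_ineq_abs_ge) auto
  qed
  also have "- 2 * (n * \<epsilon>)\<^sup>2 / (\<Sum>a\<in>I. (K - - K)\<^sup>2) = n * - (\<epsilon>\<^sup>2 / (2 * K\<^sup>2))"
    unfolding sq using n K0 by (simp add: power2_eq_square field_simps)
  also have "exp (n * - (\<epsilon>\<^sup>2 / (2 * K\<^sup>2))) = exp (- (\<epsilon>\<^sup>2 / (2 * K\<^sup>2))) ^ n"
    by (rule exp_of_nat_mult)
  finally show ?thesis .
qed

lemma deviation_tendsto_0:
  assumes f: "f \<in> borel_measurable (\<mu> j)" and K: "\<And>x. x \<in> space (\<mu> j) \<Longrightarrow> \<bar>f x\<bar> \<le> K"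
    and j: "j \<in> {1..k}" and \<epsilon>: "\<epsilon> > 0"
  shows "(\<lambda>n. measure (M n) (deviation n j f \<epsilon>)) \<longlonglongrightarrow> 0"
proof (rule tendsto_sandwich)
  \<comment> \<open>Hoeffding's bound divides by the range, so a possibly vanishing \<open>K\<close>
    is enlarged.\<close>
  define L where "L = max K 1"
  have L: "L > 0" "\<And>x. x \<in> space (\<mu> j) \<Longrightarrow> \<bar>f x\<bar> \<le> L"
    using K by (auto simp: L_def le_max_iff_disj)
  show "\<forall>\<^sub>F n in sequentially. 0 \<le> measure (M n) (deviation n j f \<epsilon>)"
    by simp
  show "\<forall>\<^sub>F n in sequentially. measure (M n) (deviation n j f \<epsilon>) \<le> 2 * exp (- (\<epsilon>\<^sup>2 / (2 * L\<^sup>2))) ^ n"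
    using deviation_bound[OF f L(2) L(1) j \<epsilon>]
    by (auto simp: eventually_sequentially intro!: exI[of _ 1])
  have "\<epsilon>\<^sup>2 / (2 * L\<^sup>2) > 0" using \<epsilon> L by simp
  then have "(\<lambda>n. 2 * exp (- (\<epsilon>\<^sup>2 / (2 * L\<^sup>2))) ^ n) \<longlonglongrightarrow> 2 * 0"
    by (intro tendsto_mult tendsto_const LIMSEQ_realpow_zero) auto
  then show "(\<lambda>n. 2 * exp (- (\<epsilon>\<^sup>2 / (2 * L\<^sup>2))) ^ n) \<longlonglongrightarrow> 0" by simp
qed simp

definition ties :: "nat \<Rightarrow> (nat \<times> nat \<Rightarrow> nat \<Rightarrow> real) set" where
  "ties n = (\<Union>i\<in>{1..k}. \<Union>l\<in>{1..n}. \<Union>l'\<in>{1..n} - {l}. tie n i (i, l) (i, l'))"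

lemma ties_null:
  assumes "n \<ge> 3"
  shows "ties n \<in> null_sets (M n)"
  unfolding ties_def by (intro null_sets_UN' tie_null assms countable_finite) auto

lemma no_ties:
  assumes "\<omega> \<in> space (M n) - ties n" "i \<in> {1..k}" "l \<in> {1..n}" "l' \<in> {1..n}" "l \<noteq> l'"
  shows "samp_mean n i (\<lambda>x. eucl_dist m x (\<omega> (i, l))) \<omega> \<noteq> samp_mean n i (\<lambda>x. eucl_dist m x (\<omega> (i, l'))) \<omega>"
proof
  assume "samp_mean n i (\<lambda>x. eucl_dist m x (\<omega> (i, l))) \<omega> = samp_mean n i (\<lambda>x. eucl_dist m x (\<omega> (i, l'))) \<omega>"
  then have "\<omega> \<in> tie n i (i, l) (i, l')"
    using assms unfolding tie_def samp_mean_def by simp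
  then show False
    using assms unfolding ties_def by blast
qed

text \<open>Here \<open>a\<close> plays the role of \<open>\<gamma> / n\<close>, \<open>s\<close> is
  the radius of the zone around each centre from which the median is taken, and \<open>H\<close>
  bounds all budgets. The budget \<open>a\<close> plus the median's mean distance solves the
  tightness equation exactly. By \<open>upper\<close> and \<open>lower\<close> it lies between
  \<open>1 + s\<close> and \<open>H\<close>, so a point of the zone sees its whole ball and, by
  \<open>sep\<close>, nothing else. Competitors in the zone lose by minimality of the median and
  absence of ties, the others by \<open>far\<close>.\<close>

lemma exact_recovery_if_separated:
  assumes \<omega>: "\<omega> \<in> space (M n) - ties n" and n: "n > 0"
    and sep: "\<And>i j. i \<in> {1..k} \<Longrightarrow> j \<in> {1..k} \<Longrightarrow> i \<noteq> j \<Longrightarrow> eucl_dist m (c i) (c j) > H + 1 + s"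
    and upper: "\<And>i. i \<in> {1..k} \<Longrightarrow> \<exists>l\<in>{1..n}. eucl_dist m (\<omega> (i, l)) (c i) \<le> s \<and>
        a + samp_mean n i (\<lambda>x. eucl_dist m x (\<omega> (i, l))) \<omega> \<le> H"
    and lower: "\<And>i l. i \<in> {1..k} \<Longrightarrow> l \<in> {1..n} \<Longrightarrow> eucl_dist m (\<omega> (i, l)) (c i) \<le> s \<Longrightarrow>
        1 + s \<le> a + samp_mean n i (\<lambda>x. eucl_dist m x (\<omega> (i, l))) \<omega>"
    and far: "\<And>i l. i \<in> {1..k} \<Longrightarrow> l \<in> {1..n} \<Longrightarrow> s < eucl_dist m (\<omega> (i, l)) (c i) \<Longrightarrow>
        (\<Sum>j\<in>{1..k}. samp_mean n j (\<lambda>x. max 0 (H - eucl_dist m x (\<omega> (i, l)))) \<omega>) < a"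
  shows "exact_recovery (eucl_dist m) k (drawn_from (\<lambda>_. n) \<omega>)"
proof -
  define S where "S i = drawn_from (\<lambda>_. n) \<omega> i" for i
  define av where "av i l = samp_mean n i (\<lambda>x. eucl_dist m x (\<omega> (i, l))) \<omega>" for i l
  have ball: "eucl_dist m (\<omega> (i, l)) (c i) \<le> 1" if "i \<in> {1..k}" "l \<in> {1..n}" for i l
    using space_M[of \<omega> n "(i, l)"] \<omega> that by (simp add: space_N idx_def)
  \<comment> \<open>Two indices with the same sample point would have equal mean distances, which is
    a tie.\<close>
  have inj: "inj_on (\<lambda>l. \<omega> (i, l)) {1..n}" if "i \<in> {1..k}" for i
  proof (rule inj_onI, rule ccontr)
    fix l l' assume "l \<in> {1..n}" "l' \<in> {1..n}" "\<omega> (i, l) = \<omega> (i, l')" "l \<noteq> l'"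
    then show False
      using no_ties[OF \<omega> that, of l l'] by simp
  qed
  have sumS: "(\<Sum>q\<in>S i. f q) = n * samp_mean n i f \<omega>" if "i \<in> {1..k}" for i f
    unfolding S_def drawn_from_def using n
    by (subst sum.reindex[OF inj[OF that]]) (simp add: samp_mean_def)
  have "\<exists>l. l \<in> {1..n} \<and> eucl_dist m (\<omega> (i, l)) (c i) \<le> s \<and>
      (\<forall>l'\<in>{1..n}. eucl_dist m (\<omega> (i, l')) (c i) \<le> s \<longrightarrow> av i l \<le> av i l')" if "i \<in> {1..k}" for i
  proof -
    let ?L = "{l\<in>{1..n}. eucl_dist m (\<omega> (i, l)) (c i) \<le> s}"
    have "finite ?L" "?L \<noteq> {}" using upper[OF that] by auto
    then have "arg_min_on (av i) ?L \<in> ?L" "\<And>l'. l' \<in> ?L \<Longrightarrow> av i (arg_min_on (av i) ?L) \<le> av i l'"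
      by (rule arg_min_if_finite(1), rule arg_min_least)
    then show ?thesis by (intro exI[of _ "arg_min_on (av i) ?L"]) auto
  qed
  then have "\<forall>i\<in>{1..k}. \<exists>l. l \<in> {1..n} \<and> eucl_dist m (\<omega> (i, l)) (c i) \<le> s \<and>
      (\<forall>l'\<in>{1..n}. eucl_dist m (\<omega> (i, l')) (c i) \<le> s \<longrightarrow> av i l \<le> av i l')"
    by blast
  from bchoice[OF this] obtain L where "\<forall>i\<in>{1..k}. L i \<in> {1..n} \<and> eucl_dist m (\<omega> (i, L i)) (c i) \<le> s \<and>
      (\<forall>l'\<in>{1..n}. eucl_dist m (\<omega> (i, l')) (c i) \<le> s \<longrightarrow> av i (L i) \<le> av i l')"
    by (elim exE)
  then have L: "\<And>i. i \<in> {1..k} \<Longrightarrow> L i \<in> {1..n}"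
    "\<And>i. i \<in> {1..k} \<Longrightarrow> eucl_dist m (\<omega> (i, L i)) (c i) \<le> s"
    "\<And>i l. i \<in> {1..k} \<Longrightarrow> l \<in> {1..n} \<Longrightarrow> eucl_dist m (\<omega> (i, l)) (c i) \<le> s \<Longrightarrow> av i (L i) \<le> av i l"
    by blast+
  define A where "A i = a + av i (L i)" for i
  have A_ge: "1 + s \<le> A i" if "i \<in> {1..k}" for i
    using lower[OF that L(1,2)[OF that]] by (simp add: A_def av_def)
  have A_le: "A i \<le> H" if "i \<in> {1..k}" for i
    using upper[OF that] L(3)[OF that] unfolding A_def av_def by force
  have own: "eucl_dist m (\<omega> (i, l)) (\<omega> (i, l')) \<le> A i"
    if "i \<in> {1..k}" "l \<in> {1..n}" "l' \<in> {1..n}" "eucl_dist m (\<omega> (i, l)) (c i) \<le> s" for i l l'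
    using eucl_dist_triangle[of m "\<omega> (i, l)" "\<omega> (i, l')" "c i"] eucl_dist_commute[of m "c i" "\<omega> (i, l')"]
      ball[OF that(1,3)] A_ge[OF that(1)] that(4) by linarith
  have cross: "A j < eucl_dist m (\<omega> (i, l)) (\<omega> (j, l'))"
    if "i \<in> {1..k}" "j \<in> {1..k}" "i \<noteq> j" "l \<in> {1..n}" "l' \<in> {1..n}" "eucl_dist m (\<omega> (i, l)) (c i) \<le> s" for i j l l'
    using sep[OF that(1-3)] eucl_dist_triangle[of m "c i" "c j" "\<omega> (i, l)"]
      eucl_dist_triangle[of m "\<omega> (i, l)" "c j" "\<omega> (j, l')"] eucl_dist_commute[of m "c i" "\<omega> (i, l)"]
      ball[OF that(2,5)] A_le[OF that(2)] that(6) by linarith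
  have commute: "(\<Sum>q\<in>S i. f (eucl_dist m x q)) = n * samp_mean n i (\<lambda>y. f (eucl_dist m y x)) \<omega>"
    if "i \<in> {1..k}" for i x and f :: "real \<Rightarrow> real"
    using sumS[OF that] by (simp add: eucl_dist_commute)
  have "exact_recovery (eucl_dist m) k S"
  proof (rule exact_recovery_certificate[where A = A and p = "\<lambda>i. \<omega> (i, L i)" and \<gamma> = "n * a"])
    fix i assume i: "i \<in> {1..k}"
    show "finite (S i)" unfolding S_def drawn_from_def by simp
    show "\<omega> (i, L i) \<in> S i" unfolding S_def drawn_from_def using L(1)[OF i] by simp
    show "(\<Sum>q\<in>S i. A i - eucl_dist m (\<omega> (i, L i)) q) = n * a"
    proof -
      have "(\<Sum>q\<in>S i. A i - eucl_dist m (\<omega> (i, L i)) q) =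
          n * samp_mean n i (\<lambda>y. A i - eucl_dist m y (\<omega> (i, L i))) \<omega>"
        by (rule commute[OF i])
      also have "\<dots> = n * (A i - av i (L i))"
        using n by (simp add: samp_mean_def av_def sum_subtractf diff_divide_distrib)
      finally show ?thesis by (simp add: A_def)
    qed
    show "eucl_dist m (\<omega> (i, L i)) q \<le> A i" if "q \<in> S i" for q
      using that own[OF i L(1)[OF i] _ L(2)[OF i]] unfolding S_def drawn_from_def by auto
    show "A j < eucl_dist m (\<omega> (i, L i)) q" if "j \<in> {1..k}" "i \<noteq> j" "q \<in> S j" for j q
      using that(3) cross[OF i that(1,2) L(1)[OF i] _ L(2)[OF i]] unfolding S_def drawn_from_def by auto
    show "S i \<inter> S j = {}" if j: "j \<in> {1..k}" "i \<noteq> j" for j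
    proof -
      have "\<omega> (i, l) \<noteq> \<omega> (j, l')" if "l \<in> {1..n}" "l' \<in> {1..n}" for l l'
      proof
        assume "\<omega> (i, l) = \<omega> (j, l')"
        then have "eucl_dist m (c i) (c j) \<le> 2"
          using eucl_dist_triangle[of m "c i" "c j" "\<omega> (i, l)"] ball[OF i that(1)] ball[OF j(1) that(2)]
            eucl_dist_commute[of m "c i" "\<omega> (i, l)"] by simp
        moreover have "H + 1 + s \<ge> 2"
          using A_ge[OF i] A_le[OF i] L(2)[OF i] eucl_dist_nonneg[of m "\<omega> (i, L i)" "c i"] by linarith
        ultimately show False using sep[OF i j] by simp
      qed
      then show ?thesis unfolding S_def drawn_from_def by auto
    qed
    fix x assume x: "x \<in> S i" "x \<noteq> \<omega> (i, L i)"
    then obtain l where "l \<in> {1..n}" "x = \<omega> (i, l)"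
      unfolding S_def drawn_from_def by blast
    moreover from this have "l \<noteq> L i" using x(2) by blast
    ultimately have l: "l \<in> {1..n}" "x = \<omega> (i, l)" "l \<noteq> L i" .
    show "(\<Sum>j\<in>{1..k}. \<Sum>q\<in>S j. max 0 (A j - eucl_dist m x q)) < n * a"
    proof (cases "eucl_dist m x (c i) \<le> s")
      case True
      have "(\<Sum>q\<in>S j. max 0 (A j - eucl_dist m x q)) = (if j = i then n * (A i - av i l) else 0)"
        if j: "j \<in> {1..k}" for j
      proof (cases "j = i")
        case True
        have "(\<Sum>q\<in>S i. max 0 (A i - eucl_dist m x q)) = (\<Sum>q\<in>S i. A i - eucl_dist m x q)"
          using own[OF i l(1)] \<open>eucl_dist m x (c i) \<le> s\<close> l(2)
          unfolding S_def drawn_from_def by (intro sum.cong) auto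
        also have "\<dots> = n * samp_mean n i (\<lambda>y. A i - eucl_dist m y x) \<omega>"
          by (rule commute[OF i])
        also have "\<dots> = n * (A i - av i l)"
          using n l(2) by (simp add: samp_mean_def av_def sum_subtractf diff_divide_distrib)
        finally show ?thesis using True by simp
      next
        case False
        have "max 0 (A j - eucl_dist m x q) = 0" if "q \<in> S j" for q
          using that cross[OF i j False[symmetric] l(1)] \<open>eucl_dist m x (c i) \<le> s\<close> l(2)
          unfolding S_def drawn_from_def by (fastforce simp: max_def)
        then show ?thesis using False by simp
      qed
      then have "(\<Sum>j\<in>{1..k}. \<Sum>q\<in>S j. max 0 (A j - eucl_dist m x q)) =
          (\<Sum>j\<in>{1..k}. if j = i then n * (A i - av i l) else 0)"
        by (rule sum.cong[OF refl])
      also have "\<dots> = n * (A i - av i l)"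
        using i by simp
      also have "\<dots> < n * (A i - av i (L i))"
      proof -
        have "av i (L i) \<le> av i l"
          using L(3)[OF i l(1)] True l(2) by simp
        moreover have "av i (L i) \<noteq> av i l"
          unfolding av_def using no_ties[OF \<omega> i l(1) L(1)[OF i] l(3)] by simp
        ultimately show ?thesis using n by simp
      qed
      finally show ?thesis by (simp add: A_def)
    next
      case False
      have "(\<Sum>q\<in>S j. max 0 (A j - eucl_dist m x q)) \<le> n * samp_mean n j (\<lambda>y. max 0 (H - eucl_dist m y x)) \<omega>"
        if j: "j \<in> {1..k}" for j
      proof -
        have "(\<Sum>q\<in>S j. max 0 (A j - eucl_dist m x q)) \<le> (\<Sum>q\<in>S j. max 0 (H - eucl_dist m x q))"
          using A_le[OF j] by (intro sum_mono) auto
        then show ?thesis using commute[OF j, of "\<lambda>d. max 0 (H - d)"] by simp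
      qed
      then have "(\<Sum>j\<in>{1..k}. \<Sum>q\<in>S j. max 0 (A j - eucl_dist m x q)) \<le>
          (\<Sum>j\<in>{1..k}. n * samp_mean n j (\<lambda>y. max 0 (H - eucl_dist m y x)) \<omega>)"
        by (rule sum_mono)
      also have "\<dots> = n * (\<Sum>j\<in>{1..k}. samp_mean n j (\<lambda>y. max 0 (H - eucl_dist m y x)) \<omega>)"
        by (simp add: sum_distrib_left)
      also have "\<dots> < n * a"
        using far[OF i l(1)] False l(2) n by simp
      finally show ?thesis .
    qed
  qed
  then show ?thesis unfolding S_def .
qed

end

section \<open>Recovery with high probability\<close>

text \<open>A grid of mesh \<open>\<delta> / (m + 1)\<close>: rounding all coordinates down moves a
  point by at most \<open>\<delta>\<close> even in the sum norm, which dominates the Euclidean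
  one.\<close>

lemma finite_net:
  assumes c: "c \<in> eucl m" and \<delta>: "\<delta> > 0"
  obtains F where "finite F" "\<And>x. x \<in> eucl m \<Longrightarrow> eucl_dist m x c \<le> 1 \<Longrightarrow> \<exists>p\<in>F. eucl_dist m x p \<le> \<delta>"
proof -
  define h where "h = \<delta> / (m + 1)"
  have h: "h > 0" "m * h \<le> \<delta>" using \<delta> by (simp_all add: h_def field_simps)
  define Z where "Z = \<lceil>1 / h\<rceil> + 1"
  define F where "F = (\<Pi>\<^sub>E i\<in>{..<m}. (\<lambda>z::int. c i + h * z) ` {- Z..Z})"
  show ?thesis
  proof (rule that[of F])
    show "finite F" unfolding F_def by (intro finite_PiE) auto
    fix x assume x: "x \<in> eucl m" "eucl_dist m x c \<le> 1"
    define z where "z i = \<lfloor>(x i - c i) / h\<rfloor>" for i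
    define p where "p = (\<lambda>i\<in>{..<m}. c i + h * z i)"
    have "z i \<in> {- Z..Z}" if "i < m" for i
    proof -
      have "\<bar>x i - c i\<bar> \<le> 1"
        using abs_component_le_eucl_dist[OF that, of x c] x by simp
      then have "x i - c i \<le> 1" "- 1 \<le> x i - c i" by linarith+
      then have "(x i - c i) / h \<le> 1 / h" "(- 1) / h \<le> (x i - c i) / h"
        using h by (intro divide_right_mono; simp)+
      then have "z i \<le> Z" "- Z \<le> z i"
        unfolding z_def Z_def by linarith+
      then show ?thesis by simp
    qed
    then have "p \<in> F"
      unfolding F_def p_def by auto
    moreover have "eucl_dist m x p \<le> \<delta>"
    proof -
      have "\<bar>x i - p i\<bar> \<le> h" if "i < m" for i
      proof -
        have "x i - p i = h * ((x i - c i) / h - z i)"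
        proof -
          have "h * ((x i - c i) / h) = x i - c i" using h by simp
          then show ?thesis using that by (simp only: right_diff_distrib p_def) simp
        qed
        moreover have "\<bar>(x i - c i) / h - z i\<bar> \<le> 1"
          unfolding z_def by linarith
        ultimately show ?thesis
          using h by (simp add: abs_mult)
      qed
      then have "(\<Sum>i<m. \<bar>x i - p i\<bar>) \<le> (\<Sum>i<m. h)"
        by (intro sum_mono) auto
      moreover have "eucl_dist m x p \<le> (\<Sum>i<m. \<bar>x i - p i\<bar>)"
        unfolding eucl_dist_def by (rule L2_set_le_sum_abs)
      ultimately show ?thesis using h by simp
    qed
    ultimately show "\<exists>p\<in>F. eucl_dist m x p \<le> \<delta>" by blast
  qed
qed

section \<open>From population bounds to samples\<close>

context ball_model
begin

lemma sets_recovery: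
  "{\<omega>\<in>space (M n). exact_recovery (eucl_dist m) k (drawn_from (\<lambda>_. n) \<omega>)} \<in> sets (M n)"
proof -
  have "drawn_from (\<lambda>_. n) \<omega> = (\<lambda>i. \<omega> ` ({i} \<times> {1..n}))" for \<omega> :: "nat \<times> nat \<Rightarrow> nat \<Rightarrow> real"
    unfolding drawn_from_def by (intro ext) auto
  moreover have "{\<omega>\<in>space (M n). exact_recovery (eucl_dist m) k (\<lambda>i. \<omega> ` ({i} \<times> {1..n}))} \<in> sets (M n)"
  proof (rule sets_exact_recovery_event[of "idx n"])
    fix \<omega> a b assume *: "\<omega> \<in> space (M n)" "a \<in> idx n" "b \<in> idx n"
    then have "\<omega> a \<in> eucl m" "\<omega> b \<in> eucl m"
      using space_M by (auto simp: space_N)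
    then show "eucl_dist m (\<omega> a) (\<omega> b) = 0 \<longleftrightarrow> \<omega> a = \<omega> b"
      by (rule eucl_dist_eq_0)
  next
    show "{i} \<times> {1..n} \<subseteq> idx n" if "i \<in> {1..k}" for i
      using that by (auto simp: idx_def)
  qed (rule finite_idx measurable_sample_dist; assumption?)+
  ultimately show ?thesis by simp
qed

text \<open>Recovery is deterministic outside the null set of ties and the unlikely set
  \<open>B n\<close>. The passage to the probability of recovery is monotonicity of the measure,
  which rests on \<open>sets_recovery\<close>.\<close>

lemma recovery_whp:
  assumes good: "\<And>n \<omega>. n \<ge> 3 \<Longrightarrow> \<omega> \<in> space (M n) - ties n - B n \<Longrightarrow>
      exact_recovery (eucl_dist m) k (drawn_from (\<lambda>_. n) \<omega>)"
    and B: "\<And>n. B n \<in> sets (M n)" and lim: "(\<lambda>n. measure (M n) (B n)) \<longlonglongrightarrow> 0"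
  shows "with_high_probability M (\<lambda>n \<omega>. exact_recovery (eucl_dist m) k (drawn_from (\<lambda>_. n) \<omega>))"
  unfolding with_high_probability_def
proof (intro allI impI)
  fix \<delta> :: real assume \<delta>: "0 < \<delta> \<and> \<delta> < 1"
  then have "\<forall>\<^sub>F n in sequentially. measure (M n) (B n) < \<delta>"
    using order_tendstoD(2)[OF lim] by simp
  then obtain N0 where N0: "\<And>n. n \<ge> N0 \<Longrightarrow> measure (M n) (B n) < \<delta>"
    by (auto simp: eventually_sequentially)
  show "\<exists>N0>0. \<forall>n>N0. 1 - \<delta> < measure (M n)
      {\<omega>\<in>space (M n). exact_recovery (eucl_dist m) k (drawn_from (\<lambda>_. n) \<omega>)}"
  proof (intro exI[of _ "max 3 N0"] conjI allI impI)
    fix n assume n: "max 3 N0 < n"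
    interpret P: prob_space "M n" by (rule prob_M)
    have t: "ties n \<in> null_sets (M n)" using ties_null n by simp
    have "measure (M n) (ties n \<union> B n) \<le> measure (M n) (ties n) + measure (M n) (B n)"
      using t B by (intro measure_Un_le) auto
    also have "measure (M n) (ties n) = 0"
      using t by (simp add: measure_eq_0_null_sets)
    finally have "measure (M n) (ties n \<union> B n) < \<delta>"
      using N0[of n] n by simp
    then have "1 - \<delta> < P.prob (space (M n) - (ties n \<union> B n))"
      using t B by (subst P.prob_compl) auto
    also have "\<dots> \<le> measure (M n) {\<omega>\<in>space (M n). exact_recovery (eucl_dist m) k (drawn_from (\<lambda>_. n) \<omega>)}"
      using good[of n] n by (intro P.finite_measure_mono sets_recovery) auto
    finally show "1 - \<delta> < measure (M n)
        {\<omega>\<in>space (M n). exact_recovery (eucl_dist m) k (drawn_from (\<lambda>_. n) \<omega>)}" .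
  qed simp
qed

text \<open>A union bound over a family that does not grow with \<open>n\<close>; for this reason
  the net is fixed before the sample is drawn.\<close>

lemma deviations_tendsto_0:
  assumes T: "finite T"
    and f: "\<And>j f \<epsilon>. (j, f, \<epsilon>) \<in> T \<Longrightarrow> j \<in> {1..k} \<and> \<epsilon> > 0 \<and> f \<in> borel_measurable (\<mu> j) \<and>
      (\<exists>K. \<forall>x\<in>space (\<mu> j). \<bar>f x\<bar> \<le> K)"
  shows "(\<Union>(j, f, \<epsilon>)\<in>T. deviation n j f \<epsilon>) \<in> sets (M n)"
    and "(\<lambda>n. measure (M n) (\<Union>(j, f, \<epsilon>)\<in>T. deviation n j f \<epsilon>)) \<longlonglongrightarrow> 0"
proof -
  let ?D = "\<lambda>n (j, f, \<epsilon>). deviation n j f \<epsilon>"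
  have sets: "?D n t \<in> sets (M n)" if "t \<in> T" for t n
    using f sets_deviation that by (cases t) auto
  then show "(\<Union>(j, f, \<epsilon>)\<in>T. deviation n j f \<epsilon>) \<in> sets (M n)"
    using T by (intro sets.finite_UN) auto
  show "(\<lambda>n. measure (M n) (\<Union>(j, f, \<epsilon>)\<in>T. deviation n j f \<epsilon>)) \<longlonglongrightarrow> 0"
  proof (rule tendsto_sandwich[of "\<lambda>_. 0" _ _ "\<lambda>n. \<Sum>t\<in>T. measure (M n) (?D n t)"])
    show "\<forall>\<^sub>F n in sequentially. measure (M n) (\<Union>t\<in>T. ?D n t) \<le> (\<Sum>t\<in>T. measure (M n) (?D n t))"
    proof (intro always_eventually allI)
      fix n
      show "measure (M n) (\<Union>t\<in>T. ?D n t) \<le> (\<Sum>t\<in>T. measure (M n) (?D n t))"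
        using sets by (intro measure_UNION_le T)
    qed
    show "(\<lambda>n. \<Sum>t\<in>T. measure (M n) (?D n t)) \<longlonglongrightarrow> 0"
    proof (rule tendsto_null_sum)
      fix t assume t: "t \<in> T"
      obtain j g \<epsilon> where [simp]: "t = (j, g, \<epsilon>)" by (cases t)
      obtain K where K: "\<forall>x\<in>space (\<mu> j). \<bar>g x\<bar> \<le> K"
        using f[of j g \<epsilon>] t by auto
      show "(\<lambda>n. measure (M n) (?D n t)) \<longlonglongrightarrow> 0"
        using f[of j g \<epsilon>] t K deviation_tendsto_0[of g j K \<epsilon>] by auto
    qed
  qed auto
qed

text \<open>With \<open>s = 1\<close> the zone of candidate medians is the whole ball and no point
  is far. Mean distances within a ball lie between 0 and 2, so \<open>a = 2\<close> puts the budgets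
  between \<open>1 + s = 2\<close> and \<open>H = 4\<close>, and
  \<open>H + 1 + s = 6\<close>.\<close>

lemma exact_recovery_whp_large_separation:
  assumes "\<And>i j. i \<in> {1..k} \<Longrightarrow> j \<in> {1..k} \<Longrightarrow> i \<noteq> j \<Longrightarrow> eucl_dist m (c i) (c j) > 6"
  shows "with_high_probability M (\<lambda>n \<omega>. exact_recovery (eucl_dist m) k (drawn_from (\<lambda>_. n) \<omega>))"
proof (rule recovery_whp[where B = "\<lambda>_. {}"])
  fix n \<omega> assume n: "n \<ge> (3::nat)" and \<omega>: "\<omega> \<in> space (M n) - ties n - {}"
  have ball: "eucl_dist m (\<omega> (i, l)) (c i) \<le> 1" if "i \<in> {1..k}" "l \<in> {1..n}" for i l
    using space_M[of \<omega> n "(i, l)"] \<omega> that by (simp add: space_N idx_def)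
  have mean_le: "samp_mean n i (\<lambda>x. eucl_dist m x (\<omega> (i, l))) \<omega> \<le> 2" if "i \<in> {1..k}" "l \<in> {1..n}" for i l
  proof -
    have "samp_mean n i (\<lambda>x. eucl_dist m x (\<omega> (i, l))) \<omega> \<le> samp_mean n i (\<lambda>_. 2) \<omega>"
    proof (rule samp_mean_mono)
      fix l' assume "l' \<in> {1..n}"
      then show "eucl_dist m (\<omega> (i, l')) (\<omega> (i, l)) \<le> 2"
        using ball[OF that(1)] that eucl_dist_triangle[of m "\<omega> (i, l')" "\<omega> (i, l)" "c i"]
          eucl_dist_commute[of m "c i" "\<omega> (i, l)"] by (smt (verit))
    qed
    then show ?thesis using n by (simp add: samp_mean_def)
  qed
  have mean_ge: "0 \<le> samp_mean n i (\<lambda>x. eucl_dist m x (\<omega> (i, l))) \<omega>" for i l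
    unfolding samp_mean_def by (intro divide_nonneg_nonneg sum_nonneg) auto
  show "exact_recovery (eucl_dist m) k (drawn_from (\<lambda>_. n) \<omega>)"
  proof (rule exact_recovery_if_separated[where s = 1 and H = 4 and a = 2])
    fix i assume i: "i \<in> {1..k}"
    have "1 \<in> {1..n}" using n by simp
    then show "\<exists>l\<in>{1..n}. eucl_dist m (\<omega> (i, l)) (c i) \<le> 1 \<and>
        2 + samp_mean n i (\<lambda>x. eucl_dist m x (\<omega> (i, l))) \<omega> \<le> 4"
      using ball[OF i] mean_le[OF i] by (intro bexI[of _ 1]) auto
  next
    fix i l assume "i \<in> {1..k}" "l \<in> {1..n}" "1 < eucl_dist m (\<omega> (i, l)) (c i)"
    then show "(\<Sum>j\<in>{1..k}. samp_mean n j (\<lambda>x. max 0 (4 - eucl_dist m x (\<omega> (i, l)))) \<omega>) < 2"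
      using ball[of i l] by simp
  qed (use n \<omega> assms mean_ge in auto)
qed simp_all

abbreviation radius :: "nat \<Rightarrow> real" where
  "radius i \<equiv> (\<integral>x. eucl_dist m x (c i) \<partial>\<mu> i)"

abbreviation visible :: "nat \<Rightarrow> real \<Rightarrow> (nat \<Rightarrow> real) \<Rightarrow> real" where
  "visible j \<alpha> p \<equiv> (\<integral>x. max 0 (\<alpha> - eucl_dist m x p) \<partial>\<mu> j)"

text \<open>Let \<open>t\<close> be the distance of \<open>p\<close> to its centre. Any other centre
  is farther than \<open>2 + 2 * \<eta> - t\<close>. For \<open>t \<le> \<eta>\<close> this hides
  the other balls completely. Otherwise it still exceeds \<open>1 + \<eta>\<close> because
  \<open>t \<le> 1\<close>, as \<open>\<Phi>_other\<close> requires, and the own loss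
  \<open>\<eta> * t / 6\<close> is at least \<open>\<eta>^2 / 6\<close>.\<close>

lemma population_gap:
  fixes \<eta> :: real
  assumes m8: "m \<ge> 8" and i: "i \<in> {1..k}" and \<eta>: "\<eta> > 0"
    and sep: "\<And>j. j \<in> {1..k} \<Longrightarrow> i \<noteq> j \<Longrightarrow> eucl_dist m (c i) (c j) > 2 + 2 * \<eta>"
    and s: "0 < s" "s \<le> eucl_dist m p (c i)" "eucl_dist m p (c i) \<le> 1"
  shows "(\<Sum>j\<in>{1..k}. visible j (1 + \<eta>) p) \<le>
    1 + \<eta> - radius i - min (s\<^sup>2 / 6) (\<eta>\<^sup>2 / 6 - 1 / m - k * (1 + \<eta>) / m)"
proof -
  interpret own: isotropic_ball "\<mu> i" m "c i" by (rule iso)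
  define t where "t = eucl_dist m p (c i)"
  have t: "0 < t" "t \<le> 1" "s \<le> t" using s by (auto simp: t_def)
  have far: "eucl_dist m p (c j) > 2 + 2 * \<eta> - t" if "j \<in> {1..k}" "i \<noteq> j" for j
    using sep[OF that] eucl_dist_triangle[of m "c i" "c j" p] eucl_dist_commute[of m p "c i"]
    unfolding t_def by simp
  have split: "(\<Sum>j\<in>{1..k}. visible j (1 + \<eta>) p) =
      visible i (1 + \<eta>) p + (\<Sum>j\<in>{1..k} - {i}. visible j (1 + \<eta>) p)"
    using i by (intro sum.remove) auto
  show ?thesis
  proof (cases "t \<le> \<eta>")
    case True
    have "visible j (1 + \<eta>) p = 0" if "j \<in> {1..k} - {i}" for j
      using isotropic_ball.\<Phi>_other_far[OF iso, of "1 + \<eta>" p j] far[of j] that True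
      unfolding isotropic_ball.\<Phi>_def[OF iso] by auto
    then have "(\<Sum>j\<in>{1..k}. visible j (1 + \<eta>) p) = visible i (1 + \<eta>) p"
      unfolding split by simp
    also have "\<dots> \<le> 1 + \<eta> - radius i - t\<^sup>2 / 6"
      using own.\<Phi>_own_near[OF m8, of p \<eta>] t True
      unfolding own.\<Phi>_def own.mean_radius_def t_def by simp
    finally have "(\<Sum>j\<in>{1..k}. visible j (1 + \<eta>) p) \<le> 1 + \<eta> - radius i - t\<^sup>2 / 6" .
    moreover have "s\<^sup>2 \<le> t\<^sup>2" using s t by (intro power_mono) auto
    ultimately show ?thesis by linarith
  next
    case False
    have "visible j (1 + \<eta>) p \<le> (1 + \<eta>) / m" if "j \<in> {1..k} - {i}" for j
      using isotropic_ball.\<Phi>_other[OF iso, of "1 + \<eta>" p j] far[of j] that t \<eta>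
      unfolding isotropic_ball.\<Phi>_def[OF iso] by auto
    then have "(\<Sum>j\<in>{1..k} - {i}. visible j (1 + \<eta>) p) \<le> (\<Sum>j\<in>{1..k} - {i}. (1 + \<eta>) / m)"
      by (rule sum_mono)
    also have "\<dots> \<le> (\<Sum>j\<in>{1..k}. (1 + \<eta>) / m)"
      using \<eta> by (intro sum_mono2) auto
    also have "\<dots> = k * (1 + \<eta>) / m" by simp
    finally have 1: "(\<Sum>j\<in>{1..k} - {i}. visible j (1 + \<eta>) p) \<le> k * (1 + \<eta>) / m" .
    have "min 1 (\<eta> / t) * (t\<^sup>2 / 6) = \<eta> * t / 6"
      using False t by (simp add: min_def power2_eq_square)
    moreover have "\<eta>\<^sup>2 / 6 \<le> \<eta> * t / 6"
      using False \<eta> by (simp add: power2_eq_square)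
    ultimately have "visible i (1 + \<eta>) p \<le> 1 + \<eta> - radius i - \<eta>\<^sup>2 / 6 + 1 / m"
      using own.\<Phi>_own_far[OF m8, of p \<eta>] t \<eta>
      unfolding own.\<Phi>_def own.mean_radius_def t_def by simp
    then show ?thesis using 1 split by linarith
  qed
qed

text \<open>This makes sample points arbitrarily close to the centre available as medians. It is
  phrased as an integral so that \<open>deviation\<close> applies to the hit frequency.\<close>

lemma near_center_prob:
  assumes \<delta>: "\<delta> > 0"
  shows "(\<integral>x. indicator {x. eucl_dist m x (c i) \<le> \<delta>} x \<partial>\<mu> i) > (0::real)"
proof -
  interpret own: isotropic_ball "\<mu> i" m "c i" by (rule iso)
  interpret E: Metric_space "eucl m" "eucl_dist m" by (rule Metric_space_eucl)
  let ?U = "eucl_cball m (c i) 1 \<inter> E.mball (c i) \<delta>"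
  have "openin (subtopology E.mtopology (eucl_cball m (c i) 1)) ?U"
    by (intro openin_subtopology_Int2) (rule E.openin_mball)
  moreover have "c i \<in> ?U"
    using own.center \<delta> eucl_dist_eq_0[OF own.center own.center] by (simp add: mem_eucl_cball)
  ultimately have "measure (\<mu> i) ?U > 0"
    using pos[of i] unfolding positive_near_center_def by blast
  also have "measure (\<mu> i) ?U \<le> measure (\<mu> i) {x\<in>space (\<mu> i). eucl_dist m x (c i) \<le> \<delta>}"
  proof (rule own.finite_measure_mono)
    show "?U \<subseteq> {x\<in>space (\<mu> i). eucl_dist m x (c i) \<le> \<delta>}"
      by (auto simp: own.space_\<mu> eucl_dist_commute[of m "c i"])
  qed measurable
  also have "\<dots> = (\<integral>x. indicator {x\<in>space (\<mu> i). eucl_dist m x (c i) \<le> \<delta>} x \<partial>\<mu> i)"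
    by simp
  also have "\<dots> = (\<integral>x. indicator {x. eucl_dist m x (c i) \<le> \<delta>} x \<partial>\<mu> i)"
    by (intro Bochner_Integration.integral_cong) (auto simp: indicator_def)
  finally show ?thesis .
qed

text \<open>The triangle inequality under the integral: the visible budget is 1-Lipschitz in the
  position of the observer.\<close>

lemma visible_shift: "visible j \<alpha> p \<le> visible j \<alpha> x + eucl_dist m x p"
proof -
  interpret isotropic_ball "\<mu> j" m "c j" by (rule iso)
  have "visible j \<alpha> p \<le> (\<integral>y. max 0 (\<alpha> - eucl_dist m y x) + eucl_dist m x p \<partial>\<mu> j)"
  proof (intro integral_mono)
    fix y
    show "max 0 (\<alpha> - eucl_dist m y p) \<le> max 0 (\<alpha> - eucl_dist m y x) + eucl_dist m x p"
      using eucl_dist_triangle[of m y x p] eucl_dist_commute[of m p x] eucl_dist_nonneg[of m x p] by simp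
  qed auto
  then show ?thesis by (simp add: prob_space)
qed

text \<open>Three families of deviations have to be small: \<open>T1\<close> controls the mean
  distance to the centre, which locates the budgets; \<open>T2\<close> guarantees a sample point
  close to the centre; \<open>T3\<close> controls the visible budgets at the points of the
  nets.\<close>

lemma exact_recovery_whp_gap:
  fixes \<eta> :: real
  assumes m8: "m \<ge> 8" and k: "k \<ge> 1" and \<eta>: "\<eta> > 0"
    and rad: "\<And>i. i \<in> {1..k} \<Longrightarrow> radius i = r"
    and sep: "\<And>i j. i \<in> {1..k} \<Longrightarrow> j \<in> {1..k} \<Longrightarrow> i \<noteq> j \<Longrightarrow> eucl_dist m (c i) (c j) > 2 + 2 * \<eta>"
    and gap: "\<eta>\<^sup>2 / 6 - 1 / m - k * (1 + \<eta>) / m > 0"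
  shows "with_high_probability M (\<lambda>n \<omega>. exact_recovery (eucl_dist m) k (drawn_from (\<lambda>_. n) \<omega>))"
proof -
  define \<alpha> where "\<alpha> = 1 + \<eta>"
  \<comment> \<open>The separation \<open>2 + 2 * \<eta>\<close> has to exceed
    \<open>H + 1 + s\<close> with \<open>H = \<alpha> + 2 * \<delta>\<close>. For
    \<open>s = \<eta> / 4\<close> and \<open>\<delta> \<le> \<eta> / 4\<close> this uses at most
    \<open>7 / 4 * \<eta>\<close>, and the budgets stay above \<open>1 + s\<close>.\<close>
  define s where "s = \<eta> / 4"
  define g where "g = min (s\<^sup>2 / 6) (\<eta>\<^sup>2 / 6 - 1 / m - k * (1 + \<eta>) / m)"
  have "g > 0" unfolding g_def using gap \<eta> by (simp add: s_def)
  \<comment> \<open>The comparison for far points loses \<open>5 * \<delta>\<close> in each of the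
    \<open>k\<close> balls, in total less than the margin \<open>g\<close>.\<close>
  define \<delta> where "\<delta> = min (\<eta> / 4) (g / (6 * k))"
  have \<delta>: "0 < \<delta>" "\<delta> \<le> s" "5 * k * \<delta> < g"
  proof -
    show "0 < \<delta>" "\<delta> \<le> s"
      using \<open>g > 0\<close> \<eta> k by (auto simp: \<delta>_def s_def)
    have "5 * k * \<delta> \<le> 5 * k * (g / (6 * k))"
      unfolding \<delta>_def by (intro mult_left_mono) auto
    also have "\<dots> < g" using k \<open>g > 0\<close> by simp
    finally show "5 * k * \<delta> < g" .
  qed
  have "\<exists>F. finite F \<and> (\<forall>x. x \<in> eucl m \<longrightarrow> eucl_dist m x (c i) \<le> 1 \<longrightarrow> (\<exists>p\<in>F. eucl_dist m x p \<le> \<delta>))" for i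
    using finite_net[OF isotropic_ball.center[OF iso] \<delta>(1), of i] by metis
  then obtain F where F: "\<And>i. finite (F i)"
    "\<And>i x. x \<in> eucl m \<Longrightarrow> eucl_dist m x (c i) \<le> 1 \<Longrightarrow> \<exists>p\<in>F i. eucl_dist m x p \<le> \<delta>"
    by metis
  define near where "near i = (indicator {x. eucl_dist m x (c i) \<le> \<delta>} :: _ \<Rightarrow> real)" for i
  define T1 where "T1 = (\<lambda>i. (i, \<lambda>x. eucl_dist m x (c i), \<delta>)) ` {1..k}"
  define T2 where "T2 = (\<lambda>i. (i, near i, integral\<^sup>L (\<mu> i) (near i))) ` {1..k}"
  define T3 where "T3 = (\<Union>i\<in>{1..k}. \<Union>p\<in>F i. (\<lambda>j. (j, \<lambda>x. max 0 (\<alpha> - eucl_dist m x p), \<delta>)) ` {1..k})"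
  define T where "T = T1 \<union> T2 \<union> T3"
  define B where "B n = (\<Union>(j, f, \<epsilon>)\<in>T. deviation n j f \<epsilon>)" for n
  have finT: "finite T"
    unfolding T_def T1_def T2_def T3_def using F(1) by auto
  have T: "j \<in> {1..k} \<and> \<epsilon> > 0 \<and> f \<in> borel_measurable (\<mu> j) \<and> (\<exists>K. \<forall>x\<in>space (\<mu> j). \<bar>f x\<bar> \<le> K)"
    if mem: "(j, f, \<epsilon>) \<in> T" for j f \<epsilon>
  proof -
    interpret own: isotropic_ball "\<mu> j" m "c j" by (rule iso)
    consider "(j, f, \<epsilon>) \<in> T1" | "(j, f, \<epsilon>) \<in> T2" | "(j, f, \<epsilon>) \<in> T3"
      using mem unfolding T_def by blast
    then show ?thesis
    proof cases
      case 1
      then show ?thesis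
        unfolding T1_def using \<delta>(1) own.space_D(2) by (auto intro!: exI[of _ 1])
    next
      case 2
      then have j: "j \<in> {1..k}" "f = near j" "\<epsilon> = integral\<^sup>L (\<mu> j) (near j)"
        unfolding T2_def by auto
      have "near j \<in> borel_measurable (\<mu> j)"
        unfolding near_def by measurable
      moreover have "integral\<^sup>L (\<mu> j) (near j) > 0"
        unfolding near_def by (rule near_center_prob[OF \<delta>(1)])
      moreover have "\<bar>near j x\<bar> \<le> 1" for x
        unfolding near_def by (simp add: indicator_def)
      ultimately show ?thesis
        using j by blast
    next
      case 3
      then obtain p where j: "j \<in> {1..k}" "f = (\<lambda>x. max 0 (\<alpha> - eucl_dist m x p))" "\<epsilon> = \<delta>"
        unfolding T3_def by auto
      have "\<bar>f x\<bar> \<le> \<bar>\<alpha>\<bar>" for x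
        using eucl_dist_nonneg[of m x p] unfolding j by linarith
      moreover have "f \<in> borel_measurable (\<mu> j)"
        unfolding j by measurable
      ultimately show ?thesis using j \<delta>(1) by blast
    qed
  qed
  show ?thesis
  proof (rule recovery_whp[where B = B])
    show "B n \<in> sets (M n)" for n
      unfolding B_def by (rule deviations_tendsto_0(1)[OF finT T])
    show "(\<lambda>n. measure (M n) (B n)) \<longlonglongrightarrow> 0"
      unfolding B_def by (rule deviations_tendsto_0(2)[OF finT T])
    fix n \<omega> assume n: "n \<ge> (3::nat)" and \<omega>: "\<omega> \<in> space (M n) - ties n - B n"
    have dev: "\<bar>samp_mean n j f \<omega> - integral\<^sup>L (\<mu> j) f\<bar> < \<epsilon>" if "(j, f, \<epsilon>) \<in> T" for j f \<epsilon>
      using \<omega> that unfolding B_def deviation_def by force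
    have n0: "n > 0" using n by simp
    have ball: "\<omega> (i, l) \<in> eucl m" "eucl_dist m (\<omega> (i, l)) (c i) \<le> 1" if "i \<in> {1..k}" "l \<in> {1..n}" for i l
      using space_M[of \<omega> n "(i, l)"] \<omega> that by (simp_all add: space_N idx_def)
    have mean_center: "\<bar>samp_mean n i (\<lambda>x. eucl_dist m x (c i)) \<omega> - r\<bar> < \<delta>" if "i \<in> {1..k}" for i
      using dev[of i "\<lambda>x. eucl_dist m x (c i)" \<delta>] rad[OF that] that unfolding T_def T1_def by auto
    have mean_shift: "samp_mean n i (\<lambda>x. eucl_dist m x p) \<omega> \<le> samp_mean n i (\<lambda>x. eucl_dist m x q) \<omega> + eucl_dist m q p"
      for i p q
      using samp_mean_mono[of n "\<lambda>x. eucl_dist m x p" \<omega> i "\<lambda>x. eucl_dist m x q + eucl_dist m q p"]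
        eucl_dist_triangle samp_mean_add_const[OF n0] by auto
    show "exact_recovery (eucl_dist m) k (drawn_from (\<lambda>_. n) \<omega>)"
    proof (rule exact_recovery_if_separated[where s = s and H = "\<alpha> + 2 * \<delta>" and a = "\<alpha> - r"])
      show "\<omega> \<in> space (M n) - ties n" "n > 0" using \<omega> n by auto
      show "\<alpha> + 2 * \<delta> + 1 + s < eucl_dist m (c i) (c j)" if "i \<in> {1..k}" "j \<in> {1..k}" "i \<noteq> j" for i j
        using sep[OF that] \<delta>(2) \<eta> unfolding \<alpha>_def s_def by simp
      fix i assume i: "i \<in> {1..k}"
      show "\<exists>l\<in>{1..n}. eucl_dist m (\<omega> (i, l)) (c i) \<le> s \<and>
          \<alpha> - r + samp_mean n i (\<lambda>x. eucl_dist m x (\<omega> (i, l))) \<omega> \<le> \<alpha> + 2 * \<delta>"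
      proof -
        \<comment> \<open>A deviation smaller than the expectation itself keeps the hit frequency
          away from 0.\<close>
        have "\<bar>samp_mean n i (near i) \<omega> - integral\<^sup>L (\<mu> i) (near i)\<bar> < integral\<^sup>L (\<mu> i) (near i)"
          using i by (intro dev) (auto simp: T_def T2_def)
        then have "samp_mean n i (near i) \<omega> \<noteq> 0" by auto
        then obtain l where l: "l \<in> {1..n}" "near i (\<omega> (i, l)) \<noteq> 0"
          unfolding samp_mean_def by (metis div_0 sum.neutral)
        then have d: "eucl_dist m (\<omega> (i, l)) (c i) \<le> \<delta>"
          unfolding near_def by (auto simp: indicator_def split: if_splits)
        then show ?thesis
          using mean_shift[of i "\<omega> (i, l)" "c i"] mean_center[OF i] l(1) \<delta>(2)
            eucl_dist_commute[of m "c i" "\<omega> (i, l)"] by (intro bexI[of _ l]) auto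
      qed
      fix l assume l: "l \<in> {1..n}"
      show "1 + s \<le> \<alpha> - r + samp_mean n i (\<lambda>x. eucl_dist m x (\<omega> (i, l))) \<omega>"
        if "eucl_dist m (\<omega> (i, l)) (c i) \<le> s"
        using mean_shift[of i "c i" "\<omega> (i, l)"] mean_center[OF i] that \<delta>(2) \<eta>
        unfolding \<alpha>_def s_def by linarith
      assume far: "s < eucl_dist m (\<omega> (i, l)) (c i)"
      let ?x = "\<omega> (i, l)"
      obtain p where p: "p \<in> F i" "eucl_dist m ?x p \<le> \<delta>"
        using F(2)[OF ball[OF i l]] by blast
      \<comment> \<open>The five \<open>\<delta>\<close> are: two for raising the budget to
        \<open>H\<close>, one for moving the observer to the net, one for the sampling error there,
        and one for moving back. Net points may lie outside the ball, so the population bound is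
        used at the sample point.\<close>
      have "samp_mean n j (\<lambda>x. max 0 (\<alpha> + 2 * \<delta> - eucl_dist m x ?x)) \<omega> \<le> visible j \<alpha> ?x + 5 * \<delta>"
        if j: "j \<in> {1..k}" for j
      proof -
        have "samp_mean n j (\<lambda>x. max 0 (\<alpha> + 2 * \<delta> - eucl_dist m x ?x)) \<omega> \<le>
            samp_mean n j (\<lambda>x. max 0 (\<alpha> - eucl_dist m x p) + 3 * \<delta>) \<omega>"
        proof (rule samp_mean_mono)
          fix l'
          show "max 0 (\<alpha> + 2 * \<delta> - eucl_dist m (\<omega> (j, l')) ?x) \<le> max 0 (\<alpha> - eucl_dist m (\<omega> (j, l')) p) + 3 * \<delta>"
            using eucl_dist_triangle[of m "\<omega> (j, l')" p ?x] p(2) \<delta>(1) by simp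
        qed
        also have "\<dots> = samp_mean n j (\<lambda>x. max 0 (\<alpha> - eucl_dist m x p)) \<omega> + 3 * \<delta>"
          by (rule samp_mean_add_const[OF n0])
        also have "samp_mean n j (\<lambda>x. max 0 (\<alpha> - eucl_dist m x p)) \<omega> \<le> visible j \<alpha> p + \<delta>"
        proof -
          have "(j, \<lambda>x. max 0 (\<alpha> - eucl_dist m x p), \<delta>) \<in> T"
            unfolding T_def T3_def using i j p(1) by blast
          from dev[OF this] show ?thesis by linarith
        qed
        also have "visible j \<alpha> p \<le> visible j \<alpha> ?x + \<delta>"
          using visible_shift[of j \<alpha> p ?x] p(2) by simp
        finally show ?thesis by simp
      qed
      then have "(\<Sum>j\<in>{1..k}. samp_mean n j (\<lambda>x. max 0 (\<alpha> + 2 * \<delta> - eucl_dist m x ?x)) \<omega>) \<le>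
          (\<Sum>j\<in>{1..k}. visible j \<alpha> ?x + 5 * \<delta>)"
        by (rule sum_mono)
      also have "\<dots> = (\<Sum>j\<in>{1..k}. visible j \<alpha> ?x) + 5 * k * \<delta>"
        by (simp add: sum.distrib)
      also have "(\<Sum>j\<in>{1..k}. visible j \<alpha> ?x) \<le> \<alpha> - r - g"
        using population_gap[OF m8 i \<eta> sep[OF i], of s ?x] far ball(2)[OF i l] rad[OF i] \<eta>
        unfolding g_def \<alpha>_def s_def by simp
      finally show "(\<Sum>j\<in>{1..k}. samp_mean n j (\<lambda>x. max 0 (\<alpha> + 2 * \<delta> - eucl_dist m x ?x)) \<omega>) < \<alpha> - r"
        using \<delta>(3) by simp
    qed
  qed
qed

end

section \<open>Numerical conditions and conclusion\<close>

lemma half_le_ln: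
  assumes "m \<ge> (2::nat)"
  shows "1 / 2 \<le> ln (real m)"
proof -
  have "exp (1 / 2) \<le> real m"
    using exp_half_le2 assms by simp
  then show ?thesis
    using assms by (subst ln_ge_iff) auto
qed

text \<open>
  Since \<open>ln m \<ge> 1 / 2\<close>, the choice of \<open>\<eta>\<close> gives \<open>50 * k / m \<le> \<eta>\<^sup>2\<close>.
\<close>

lemma gap_numerics:
  assumes m: "m \<ge> (2::nat)" and k: "k \<ge> (1::nat)"
  defines "\<eta> \<equiv> 10 * sqrt (real k * ln (real m) / real m)"
  assumes "\<eta> < 2"
  shows "\<eta> > 0" "m \<ge> 8" "\<eta>\<^sup>2 / 6 - 1 / m - k * (1 + \<eta>) / m > 0"
proof -
  have l: "1 / 2 \<le> ln (real m)" by (rule half_le_ln[OF m])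
  have sq: "\<eta>\<^sup>2 = 100 * (k * ln m / m)"
    unfolding \<eta>_def using l by (simp add: power_mult_distrib)
  show \<eta>: "\<eta> > 0" unfolding \<eta>_def using l m k by simp
  have "real k * (1 / 2) \<le> k * ln m"
    using l by (intro mult_left_mono) auto
  then have km: "50 * k / m \<le> \<eta>\<^sup>2"
    unfolding sq by (simp add: divide_right_mono)
  have "\<eta>\<^sup>2 < 2\<^sup>2"
    using \<eta> \<open>\<eta> < 2\<close> by (intro power_strict_mono) auto
  then have "50 * k / m < 4" using km by simp
  then have "50 * real k < 4 * m" using m by (simp add: field_simps)
  then show "m \<ge> 8" using k by simp
  have "k * (1 + \<eta>) / m \<le> real k * 3 / m"
    using \<open>\<eta> < 2\<close> by (intro divide_right_mono mult_left_mono) auto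
  moreover have "1 / m \<le> k / m"
    using k by (intro divide_right_mono) auto
  moreover have "k / m > 0" using k m by simp
  \<comment> \<open>The subtracted terms amount to at most \<open>4 * k / m\<close>, whereas
    \<open>\<eta>^2 / 6\<close> is at least \<open>50 / 6 * k / m\<close>.\<close>
  ultimately show "\<eta>\<^sup>2 / 6 - 1 / m - k * (1 + \<eta>) / m > 0"
    using km by simp
qed

theorem theorem7:
  "\<exists>C>0. \<forall>m\<ge>2. \<forall>k\<ge>1. \<forall>c r \<mu>.
     esbm m k c r \<mu> \<and>
     (\<forall>i\<in>{1..k}. rotation_invariant m (c i) (\<mu> i) \<and>
        positive_near_center m (c i) (r i) (\<mu> i) \<and>
        null_on_lebesgue_null m (c i) (r i) (\<mu> i)) \<and>
     (\<forall>i\<in>{1..k}. r i = 1) \<and>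
     (\<forall>i\<in>{1..k}. \<forall>j\<in>{1..k}.
        (\<integral>x. eucl_dist m x (c i) \<partial>\<mu> i) = (\<integral>x. eucl_dist m x (c j) \<partial>\<mu> j)) \<and>
     (\<forall>i\<in>{1..k}. \<forall>j\<in>{1..k}. i \<noteq> j \<longrightarrow>
        eucl_dist m (c i) (c j) > 2 + C * sqrt (real k * ln (real m) / real m)) \<longrightarrow>
     with_high_probability (\<lambda>n. esbm_sample k \<mu> (\<lambda>_. n))
       (\<lambda>n \<omega>. exact_recovery (eucl_dist m) k (drawn_from (\<lambda>_. n) \<omega>))"
proof (intro exI[of _ 20] conjI allI impI, simp)
  fix m k :: nat and c r \<mu>
  assume m: "2 \<le> m" and k: "1 \<le> k"
  assume *: "esbm m k c r \<mu> \<and>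
     (\<forall>i\<in>{1..k}. rotation_invariant m (c i) (\<mu> i) \<and>
        positive_near_center m (c i) (r i) (\<mu> i) \<and>
        null_on_lebesgue_null m (c i) (r i) (\<mu> i)) \<and>
     (\<forall>i\<in>{1..k}. r i = 1) \<and>
     (\<forall>i\<in>{1..k}. \<forall>j\<in>{1..k}.
        (\<integral>x. eucl_dist m x (c i) \<partial>\<mu> i) = (\<integral>x. eucl_dist m x (c j) \<partial>\<mu> j)) \<and>
     (\<forall>i\<in>{1..k}. \<forall>j\<in>{1..k}. i \<noteq> j \<longrightarrow>
        eucl_dist m (c i) (c j) > 2 + 20 * sqrt (real k * ln (real m) / real m))"
  \<comment> \<open>Indices outside \<open>{1..k}\<close> are sent to the first ball, which exists
    since \<open>k \<ge> 1\<close>; the sample space involves only indices in \<open>{1..k}\<close>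
    and stays the same.\<close>
  define fix_idx where "fix_idx i = (if i \<in> {1..k} then i else 1)" for i
  have fi: "fix_idx i \<in> {1..k}" for i using k by (auto simp: fix_idx_def)
  have fi_id: "fix_idx i = i" if "i \<in> {1..k}" for i using that by (simp add: fix_idx_def)
  have model: "esbm m k c r \<mu>"
    using * by (elim conjE)
  have regular: "\<forall>i\<in>{1..k}. rotation_invariant m (c i) (\<mu> i) \<and>
        positive_near_center m (c i) (r i) (\<mu> i) \<and> null_on_lebesgue_null m (c i) (r i) (\<mu> i)"
    using * by (elim conjE)
  have r1: "\<forall>i\<in>{1..k}. r i = 1"
    using * by (elim conjE)
  have radii: "\<forall>i\<in>{1..k}. \<forall>j\<in>{1..k}.
        (\<integral>x. eucl_dist m x (c i) \<partial>\<mu> i) = (\<integral>x. eucl_dist m x (c j) \<partial>\<mu> j)"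
    using * by (elim conjE)
  have sepc: "\<forall>i\<in>{1..k}. \<forall>j\<in>{1..k}. i \<noteq> j \<longrightarrow>
        eucl_dist m (c i) (c j) > 2 + 20 * sqrt (real k * ln (real m) / real m)"
    using * by (elim conjE)
  interpret ball_model m k "\<lambda>i. c (fix_idx i)" "\<lambda>i. \<mu> (fix_idx i)"
  proof (rule ball_model.intro)
    fix i
    note fi = fi[of i]
    have r: "r (fix_idx i) = 1" using r1 fi by blast
    have "c (fix_idx i) \<in> eucl m" "prob_space (\<mu> (fix_idx i))"
      "sets (\<mu> (fix_idx i)) = sets (restrict_space (eucl_borel m) (eucl_cball m (c (fix_idx i)) (r (fix_idx i))))"
      using model fi unfolding esbm_def by blast+
    then show "isotropic_ball (\<mu> (fix_idx i)) m (c (fix_idx i))"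
      using m regular fi unfolding isotropic_ball_def isotropic_ball_axioms_def r by blast
    show "null_on_lebesgue_null m (c (fix_idx i)) 1 (\<mu> (fix_idx i))"
      "positive_near_center m (c (fix_idx i)) 1 (\<mu> (fix_idx i))"
      using regular fi unfolding r[symmetric] by blast+
  qed
  have sample: "esbm_sample k \<mu> (\<lambda>_. n) = M n" for n
    unfolding esbm_sample_def idx_def N_def using fi_id by (intro PiM_cong) auto
  \<comment> \<open>Half of the guaranteed gap, hence 10 in place of 20.\<close>
  define \<eta> where "\<eta> = 10 * sqrt (real k * ln (real m) / real m)"
  have sep: "eucl_dist m (c (fix_idx i)) (c (fix_idx j)) > 2 + 2 * \<eta>"
    if "i \<in> {1..k}" "j \<in> {1..k}" "i \<noteq> j" for i j
    using sepc that fi_id unfolding \<eta>_def by auto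
  have "with_high_probability M (\<lambda>n \<omega>. exact_recovery (eucl_dist m) k (drawn_from (\<lambda>_. n) \<omega>))"
  proof (cases "\<eta> < 2")
    case True
    note num = gap_numerics[OF m k True[unfolded \<eta>_def], folded \<eta>_def]
    have "radius i = radius 1" if "i \<in> {1..k}" for i
      using radii fi by blast
    from exact_recovery_whp_gap[OF num(2) k num(1) this sep num(3)] show ?thesis .
  next
    case False
    show ?thesis
    proof (rule exact_recovery_whp_large_separation)
      fix i j assume "i \<in> {1..k}" "j \<in> {1..k}" "i \<noteq> j"
      from sep[OF this] False show "6 < eucl_dist m (c (fix_idx i)) (c (fix_idx j))" by simp
    qed
  qed
  then show "with_high_probability (\<lambda>n. esbm_sample k \<mu> (\<lambda>_. n))
       (\<lambda>n \<omega>. exact_recovery (eucl_dist m) k (drawn_from (\<lambda>_. n) \<omega>))"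
    unfolding sample .
qed

end
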